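(* Let $G$ be a non-discrete, compactly generated, quasi just-non-compact tdlc group. If an open subgroup of finite index in $G$ is a Chabauty limit of a sequence of discrete subgroups of $G$, then there is a prime $p$ and a compact open subgroup $V \leq G$ such that $V$ is a pro-$p$ group that is not topologically finitely generated.
   Context: "tdlc" means totally disconnected locally compact (Hausdorff topological group). A locally compact group is quasi just-non-compact if it is non-compact and every closed normal subgroup of it is discrete or cocompact. For a locally compact group $G$, $\mathbf{Sub}(G)$ is the set of closed subgroups of $G$ with the (compact) Chabauty topology, a basis of which is given by the sets $\{H \in \mathbf{Sub}(G) : H \cap K = \emptyset,\ H \cap U_i \neq \emptyset \text{ for all } i\}$ with $K \subset G$ compact and $U_1,\ldots,U_m \subset G$ open. A Chabauty limit is a limit in $\mathbf{Sub}(G)$. *)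

theory Defs
  imports
    "HOL-Analysis.Analysis"
    "HOL-Algebra.Coset"
    "HOL-Algebra.Generated_Groups"
    "HOL-Computational_Algebra.Primes"
begin

section \<open>Topological groups\<close>

locale topological_group = group G for G (structure) +
  fixes T :: "'a topology"
  assumes topspace_eq_carrier: "topspace T = carrier G"
    and continuous_mult: "continuous_map (prod_topology T T) T (\<lambda>(x, y). x \<otimes> y)"
    and continuous_inv: "continuous_map T T (\<lambda>x. inv x)"

definition totally_disconnected_space :: "'a topology \<Rightarrow> bool" where
  "totally_disconnected_space X \<longleftrightarrow> (\<forall>S. connectedin X S \<longrightarrow> (\<exists>a. S \<subseteq> {a}))"

definition locally_compact_group :: "('a, 'b) monoid_scheme \<Rightarrow> 'a topology \<Rightarrow> bool" where
  "locally_compact_group G T \<longleftrightarrow>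
     topological_group G T \<and> Hausdorff_space T \<and> locally_compact_space T"

definition tdlc_group :: "('a, 'b) monoid_scheme \<Rightarrow> 'a topology \<Rightarrow> bool" where
  "tdlc_group G T \<longleftrightarrow> locally_compact_group G T \<and> totally_disconnected_space T"

definition compactly_generated :: "('a, 'b) monoid_scheme \<Rightarrow> 'a topology \<Rightarrow> bool" where
  "compactly_generated G T \<longleftrightarrow> (\<exists>K. compactin T K \<and> generate G K = carrier G)"

definition topologically_finitely_generated ::
  "('a, 'b) monoid_scheme \<Rightarrow> 'a topology \<Rightarrow> bool" where
  "topologically_finitely_generated G T \<longleftrightarrow>
     (\<exists>S. finite S \<and> S \<subseteq> carrier G \<and> T closure_of (generate G S) = carrier G)"

definition discretein :: "'a topology \<Rightarrow> 'a set \<Rightarrow> bool" where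
  "discretein X S \<longleftrightarrow> S \<subseteq> topspace X \<and> subtopology X S = discrete_topology S"

text \<open>The quotient topology on the set of cosets of \<open>N\<close>: since the points are themselves disjoint
  subsets of the group, the preimage of a set \<open>A\<close> of cosets under the projection is \<open>\<Union>A\<close>.\<close>

definition coset_topology ::
  "('a, 'b) monoid_scheme \<Rightarrow> 'a topology \<Rightarrow> 'a set \<Rightarrow> 'a set topology" where
  "coset_topology G T N = topology (\<lambda>A. A \<subseteq> rcosets\<^bsub>G\<^esub> N \<and> openin T (\<Union>A))"

lemma openin_coset_topology:
  assumes "group G" and "subgroup N G"
  shows "openin (coset_topology G T N) A \<longleftrightarrow> A \<subseteq> rcosets\<^bsub>G\<^esub> N \<and> openin T (\<Union>A)"
proof -
  have Int: "\<Union>(A \<inter> B) = \<Union>A \<inter> \<Union>B"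
    if "A \<subseteq> rcosets\<^bsub>G\<^esub> N" "B \<subseteq> rcosets\<^bsub>G\<^esub> N" for A B
  proof (rule subset_antisym)
    show "\<Union>A \<inter> \<Union>B \<subseteq> \<Union>(A \<inter> B)"
    proof
      fix x assume "x \<in> \<Union>A \<inter> \<Union>B"
      then obtain C D where CD: "C \<in> A" "D \<in> B" "x \<in> C" "x \<in> D"
        by blast
      then have "C = D"
        using that pairwiseD[OF group.rcos_disjoint[OF assms], of C D]
        by (metis disjnt_iff subsetD)
      then show "x \<in> \<Union>(A \<inter> B)"
        using CD by blast
    qed
  qed blast
  have "istopology (\<lambda>A. A \<subseteq> rcosets\<^bsub>G\<^esub> N \<and> openin T (\<Union>A))"
    unfolding istopology_def
  proof (intro conjI allI impI)
    fix \<K> assume "\<forall>K\<in>\<K>. K \<subseteq> rcosets\<^bsub>G\<^esub> N \<and> openin T (\<Union>K)"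
    moreover have "\<Union>(\<Union>\<K>) = \<Union>(Union ` \<K>)"
      by blast
    ultimately show "openin T (\<Union>(\<Union>\<K>))"
      by (metis (mono_tags, lifting) imageE openin_Union)
  qed (auto simp: Int)
  then show ?thesis
    by (simp add: coset_topology_def)
qed

lemma topspace_coset_topology:
  assumes "topological_group G T" and "subgroup N G"
  shows "topspace (coset_topology G T N) = rcosets\<^bsub>G\<^esub> N"
proof -
  interpret topological_group G T by fact
  have "\<Union>(rcosets\<^bsub>G\<^esub> N) = carrier G"
    by (simp add: assms(2) rcosets_part_G)
  then have "openin (coset_topology G T N) (rcosets\<^bsub>G\<^esub> N)"
    by (metis assms(2) is_group openin_coset_topology openin_topspace order_refl
        topspace_eq_carrier)
  then show ?thesis
    by (metis assms(2) is_group openin_coset_topology openin_subset openin_topspace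
        subset_antisym)
qed

lemma quotient_map_coset_topology:
  assumes "topological_group G T" and "subgroup N G"
  shows "quotient_map T (coset_topology G T N) (\<lambda>x. N #>\<^bsub>G\<^esub> x)"
proof -
  interpret topological_group G T by fact
  have pre: "{x \<in> carrier G. N #>\<^bsub>G\<^esub> x \<in> A} = \<Union>A" if A: "A \<subseteq> rcosets\<^bsub>G\<^esub> N" for A
  proof
    show "{x \<in> carrier G. N #>\<^bsub>G\<^esub> x \<in> A} \<subseteq> \<Union>A"
      using rcos_self[OF _ assms(2)] by blast
    show "\<Union>A \<subseteq> {x \<in> carrier G. N #>\<^bsub>G\<^esub> x \<in> A}"
    proof clarify
      fix x C assume xC: "x \<in> C" "C \<in> A"
      then obtain a where a: "a \<in> carrier G" "C = N #>\<^bsub>G\<^esub> a"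
        using A by (auto simp: RCOSETS_def)
      with xC have "C = N #>\<^bsub>G\<^esub> x"
        using repr_independence[OF _ _ assms(2)] by blast
      moreover have "x \<in> carrier G"
        using a xC r_coset_subset_G subgroup.subset[OF assms(2)] by blast
      ultimately show "x \<in> carrier G \<and> N #>\<^bsub>G\<^esub> x \<in> A"
        using xC by blast
    qed
  qed
  show ?thesis
    unfolding quotient_map_def topspace_coset_topology[OF assms] topspace_eq_carrier
    using pre openin_coset_topology[OF is_group assms(2)] by (auto simp: RCOSETS_def)
qed

definition cocompact :: "('a, 'b) monoid_scheme \<Rightarrow> 'a topology \<Rightarrow> 'a set \<Rightarrow> bool" where
  "cocompact G T N \<longleftrightarrow> compact_space (coset_topology G T N)"

definition quasi_just_non_compact :: "('a, 'b) monoid_scheme \<Rightarrow> 'a topology \<Rightarrow> bool" where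
  "quasi_just_non_compact G T \<longleftrightarrow>
     locally_compact_group G T \<and> \<not> compact_space T \<and>
     (\<forall>N. N \<lhd> G \<and> closedin T N \<longrightarrow> discretein T N \<or> cocompact G T N)"

section \<open>Profinite and pro-p groups\<close>

definition profinite_group :: "('a, 'b) monoid_scheme \<Rightarrow> 'a topology \<Rightarrow> bool" where
  "profinite_group G T \<longleftrightarrow>
     topological_group G T \<and> compact_space T \<and> Hausdorff_space T \<and> totally_disconnected_space T"

text \<open>An infinite quotient has order 0, which is not a power of a prime.\<close>

definition pro_p_group :: "nat \<Rightarrow> ('a, 'b) monoid_scheme \<Rightarrow> 'a topology \<Rightarrow> bool" where
  "pro_p_group p G T \<longleftrightarrow>
     prime p \<and> profinite_group G T \<and>
     (\<forall>N. N \<lhd> G \<and> openin T N \<longrightarrow> (\<exists>k. order (G Mod N) = p ^ k))"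

section \<open>The Chabauty space\<close>

definition closed_subgroups :: "('a, 'b) monoid_scheme \<Rightarrow> 'a topology \<Rightarrow> 'a set set" where
  "closed_subgroups G T = {H. subgroup H G \<and> closedin T H}"

definition chabauty_basic_set ::
  "('a, 'b) monoid_scheme \<Rightarrow> 'a topology \<Rightarrow> 'a set \<Rightarrow> 'a set set \<Rightarrow> 'a set set" where
  "chabauty_basic_set G T K \<U> =
     {H \<in> closed_subgroups G T. H \<inter> K = {} \<and> (\<forall>U\<in>\<U>. H \<inter> U \<noteq> {})}"

definition chabauty_topology ::
  "('a, 'b) monoid_scheme \<Rightarrow> 'a topology \<Rightarrow> 'a set topology" where
  "chabauty_topology G T =
     topology_generated_by
       {chabauty_basic_set G T K \<U> | K \<U>. compactin T K \<and> finite \<U> \<and> (\<forall>U\<in>\<U>. openin T U)}"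

lemma topspace_chabauty_topology: "topspace (chabauty_topology G T) = closed_subgroups G T"
proof -
  let ?B = "{chabauty_basic_set G T K \<U> | K \<U>.
    compactin T K \<and> finite \<U> \<and> (\<forall>U\<in>\<U>. openin T U)}"
  have "closed_subgroups G T = chabauty_basic_set G T {} {}"
    by (simp add: chabauty_basic_set_def)
  then have "closed_subgroups G T \<in> ?B"
    using compactin_empty[of T] by blast
  moreover have "B \<subseteq> closed_subgroups G T" if "B \<in> ?B" for B
    using that unfolding chabauty_basic_set_def by blast
  ultimately show ?thesis
    unfolding chabauty_topology_def topology_generated_by_topspace by blast
qed

end

theory Submission
  imports Defs "HOL-Algebra.Group_Action" "HOL-Algebra.Sylow" "HOL-Algebra.Multiplicative_Group"
begin

text \<open>
  Let \<open>\<Gamma>\<^sub>n \<rightarrow> H\<close> be the discrete subgroups and \<open>U \<le> H\<close> a small compact open subgroup.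

  \<^item> If the closure of a normal subgroup \<open>D\<close> is not discrete, it is cocompact, so \<open>DU\<close> is compactly
    generated and hence generated by \<open>U\<close> and finitely many elements of \<open>D\<close>. A compact subgroup of \<open>U\<close>
    normalised by those has a normaliser of finite index, so finitely many conjugates, whose product
    (inside a normal open subgroup) is a compact normal subgroup of \<open>G\<close> and therefore finite.
    Taking for \<open>D\<close> the quasi-centre (the elements with open centraliser) shows that it is discrete.
  \<^item> Let \<open>L\<close> be an infinite pro-p closed normal subgroup of \<open>U\<close> and \<open>D\<close> its normal closure. If \<open>V\<close> is
    open, normal in \<open>U\<close> and subnormal in \<open>gUg\<^sup>-\<^sup>1\<close>, then \<open>O\<^sup>p(V)\<close> is normalised by \<open>U\<close> and by the p-group
    \<open>gLg\<^sup>-\<^sup>1\<close>. By the first point \<open>O\<^sup>p(V)\<close> is finite for a suitable \<open>V\<close>, so \<open>G\<close> is locally pro-p.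
  \<^item> To find \<open>L\<close>, choose \<open>U\<close> with trivial core in \<open>H\<close> and, as in the Thompson--Wielandt theorem, an open
    \<open>V\<close>, normal in \<open>U\<close> and subnormal in its conjugates by generators of \<open>H\<close>. Some minimal subnormal
    subgroup \<open>S\<close> of the finite group \<open>\<Gamma>\<^sub>n \<inter> U\<close> is not contained in \<open>V\<close>, as otherwise the set of all of
    them would be invariant under conjugation by \<open>\<Gamma>\<^sub>n\<close>. So \<open>S \<inter> V = 1\<close>. If \<open>S\<close> is
    not abelian it centralises \<open>\<Gamma>\<^sub>n \<inter> V\<close>; this cannot happen infinitely often, for in the limit it
    yields a quasi-central element of \<open>U - V\<close>. If \<open>S\<close> is abelian, it lies in \<open>O\<^sub>p(\<Gamma>\<^sub>n \<inter> U)\<close> for one of the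
    finitely many primes up to a bound depending on \<open>U\<close> and \<open>V\<close>; in the limit this yields \<open>L\<close> not
    contained in \<open>V\<close>, which is infinite because finite normal subgroups of \<open>U\<close> are quasi-central.
  \<^item> If an open pro-p subgroup \<open>V \<le> H\<close> were topologically finitely generated, its Frattini subgroup
    would be open, so \<open>\<Gamma>\<^sub>n \<inter> V\<close> would meet all its cosets and equal \<open>V\<close>, which is infinite.
\<close>

section \<open>Conjugation and normalisers\<close>

text \<open>Minimal subnormal subgroups take the place of minimal normal ones because subnormality
  is transitive: those that lie in a common subnormal subgroup of
  \<open>\<Gamma> n \<inter> U\<close> and of a conjugate are the same for both groups, although
  neither group contains the other. The difficulty is the passage to the limit, since \<Gamma>_n,
  its minimal subnormal subgroups and the prime all vary with n, while \<open>U\<close> and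
  \<open>V\<close> are fixed beforehand. Elements found in the compact set \<open>U - V\<close>
  cannot converge to the identity, so a limit point still witnesses something non-trivial; and the
  exponents that carry elements of \<open>U\<close> into \<open>V\<close> are bounded independently
  of n, which leaves finitely many primes and hence one that occurs for infinitely many n. What is
  carried to the limit must make sense modulo each open subgroup normal in \<open>U\<close>. This is
  why p-groups are described by powers of elements landing in a subgroup and normality by
  \<open>normzr\<close>, quotient groups entering only through finite p-groups.\<close>

context group
begin

definition conjg :: "'a \<Rightarrow> 'a \<Rightarrow> 'a" where
  "conjg g x = g \<otimes> x \<otimes> inv g"

text \<open>For \<open>K\<close> inside the carrier the equivalence asks for
  \<open>g K g^-1 = K\<close>; one inclusion alone would in general not be closed under inverses.
  \<open>K\<close> is an arbitrary set, so \<open>A \<subseteq> normzr B\<close> expresses that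
  \<open>A\<close> normalises \<open>B\<close> without either containing the other.\<close>

definition normzr :: "'a set \<Rightarrow> 'a set" where
  "normzr K = {g \<in> carrier G. \<forall>x\<in>carrier G. conjg g x \<in> K \<longleftrightarrow> x \<in> K}"

lemma cancel_left [simp]:
  assumes "x \<in> carrier G" "y \<in> carrier G"
  shows "x \<otimes> (inv x \<otimes> y) = y" "inv x \<otimes> (x \<otimes> y) = y"
  using assms by (simp_all flip: m_assoc)

text \<open>The subgroup axioms with \<open>G\<close> fixed: the general versions make proof search diverge.\<close>

lemma sg_one: "subgroup A G \<Longrightarrow> \<one> \<in> A"
  and sg_inv: "subgroup A G \<Longrightarrow> x \<in> A \<Longrightarrow> inv x \<in> A"
  and sg_mult: "subgroup A G \<Longrightarrow> x \<in> A \<Longrightarrow> y \<in> A \<Longrightarrow> x \<otimes> y \<in> A"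
  and sg_carrier: "subgroup A G \<Longrightarrow> x \<in> A \<Longrightarrow> x \<in> carrier G"
  and sg_subset: "subgroup A G \<Longrightarrow> A \<subseteq> carrier G"
  by (rule subgroup.one_closed subgroup.m_inv_closed subgroup.m_closed subgroup.mem_carrier
      subgroup.subset; assumption)+

lemmas word_simps = m_assoc inv_mult_group

lemma conjg_closed [simp, intro]: "g \<in> carrier G \<Longrightarrow> x \<in> carrier G \<Longrightarrow> conjg g x \<in> carrier G"
  by (simp add: conjg_def)

lemma conjg_one [simp]: "g \<in> carrier G \<Longrightarrow> conjg g \<one> = \<one>"
  by (simp add: conjg_def)

lemma one_conjg [simp]: "x \<in> carrier G \<Longrightarrow> conjg \<one> x = x"
  by (simp add: conjg_def)

lemma conjg_mult:
  assumes "g \<in> carrier G" "x \<in> carrier G" "y \<in> carrier G"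
  shows "conjg g (x \<otimes> y) = conjg g x \<otimes> conjg g y"
  using assms by (simp add: conjg_def word_simps)

lemma conjg_inv:
  assumes "g \<in> carrier G" "x \<in> carrier G"
  shows "conjg g (inv x) = inv (conjg g x)"
  using assms by (simp add: conjg_def word_simps)

lemma conjg_conjg:
  assumes "g \<in> carrier G" "h \<in> carrier G" "x \<in> carrier G"
  shows "conjg g (conjg h x) = conjg (g \<otimes> h) x"
  using assms by (simp add: conjg_def word_simps)

lemma conjg_inv_cancel [simp]:
  assumes "g \<in> carrier G" "x \<in> carrier G"
  shows "conjg g (conjg (inv g) x) = x" "conjg (inv g) (conjg g x) = x"
  using assms by (simp_all add: conjg_conjg)

lemma conjg_pow:
  assumes "g \<in> carrier G" "x \<in> carrier G"
  shows "conjg g (x [^] (n::nat)) = conjg g x [^] n"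
  by (induction n) (simp_all add: assms conjg_mult)

lemma conjg_eq_one_iff:
  assumes "g \<in> carrier G" "x \<in> carrier G"
  shows "conjg g x = \<one> \<longleftrightarrow> x = \<one>"
  by (metis assms conjg_inv_cancel(2) conjg_one inv_closed)

lemma conjg_eq_iff_commute:
  assumes "g \<in> carrier G" "x \<in> carrier G"
  shows "conjg g x = x \<longleftrightarrow> g \<otimes> x = x \<otimes> g"
  using assms by (metis conjg_def inv_solve_right m_closed)

lemma mem_conjg_image:
  assumes "g \<in> carrier G" "A \<subseteq> carrier G"
  shows "x \<in> conjg g ` A \<longleftrightarrow> x \<in> carrier G \<and> conjg (inv g) x \<in> A"
proof
  assume "x \<in> conjg g ` A"
  then show "x \<in> carrier G \<and> conjg (inv g) x \<in> A"
    using assms by auto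
next
  assume "x \<in> carrier G \<and> conjg (inv g) x \<in> A"
  then show "x \<in> conjg g ` A"
    by (metis assms(1) conjg_inv_cancel(1) image_eqI)
qed

lemma subgroup_conjg:
  assumes "g \<in> carrier G" "subgroup A G"
  shows "subgroup (conjg g ` A) G"
proof -
  have A: "A \<subseteq> carrier G" using assms(2) sg_subset by blast
  show ?thesis
  proof (rule subgroupI)
    show "conjg g ` A \<subseteq> carrier G" using A assms(1) by auto
    show "conjg g ` A \<noteq> {}" using sg_one[OF assms(2)] by blast
    fix x y assume "x \<in> conjg g ` A" "y \<in> conjg g ` A"
    then obtain a b where "a \<in> A" "b \<in> A" "x = conjg g a" "y = conjg g b" by blast
    moreover have "a \<in> carrier G" "b \<in> carrier G"
      using A \<open>a \<in> A\<close> \<open>b \<in> A\<close> by auto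
    ultimately have "inv x = conjg g (inv a)" "x \<otimes> y = conjg g (a \<otimes> b)"
      using assms(1) by (simp_all add: conjg_inv conjg_mult)
    then show "inv x \<in> conjg g ` A" "x \<otimes> y \<in> conjg g ` A"
      using \<open>a \<in> A\<close> \<open>b \<in> A\<close> assms(2) by (auto simp: sg_inv sg_mult)
  qed
qed

lemma normzr_subset: "normzr K \<subseteq> carrier G"
  by (auto simp: normzr_def)

lemma normzrD: "g \<in> normzr K \<Longrightarrow> x \<in> carrier G \<Longrightarrow> conjg g x \<in> K \<longleftrightarrow> x \<in> K"
  by (auto simp: normzr_def)

lemma subgroup_normzr: "subgroup (normzr K) G"
proof (rule subgroupI)
  show "normzr K \<noteq> {}" by (auto simp: normzr_def intro!: exI[of _ \<one>])
  show "inv g \<in> normzr K" if "g \<in> normzr K" for g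
  proof -
    have g: "g \<in> carrier G" using that by (simp add: normzr_def)
    have "conjg (inv g) x \<in> K \<longleftrightarrow> x \<in> K" if "x \<in> carrier G" for x
      using that g \<open>g \<in> normzr K\<close> normzrD[of g K "conjg (inv g) x"] unfolding normzr_def by simp
    then show ?thesis using g by (simp add: normzr_def)
  qed
  show "g \<otimes> h \<in> normzr K" if "g \<in> normzr K" "h \<in> normzr K" for g h
    using that by (simp add: normzr_def flip: conjg_conjg)
qed (auto simp: normzr_def)

text \<open>One inclusion suffices for a subgroup \<open>A\<close>: applied to \<open>inv a\<close>
  it gives the other.\<close>

lemma subgroup_subset_normzrI:
  assumes "subgroup A G" "\<And>a x. a \<in> A \<Longrightarrow> x \<in> K \<Longrightarrow> x \<in> carrier G \<Longrightarrow> conjg a x \<in> K"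
  shows "A \<subseteq> normzr K"
proof
  fix a assume a: "a \<in> A"
  then have ia: "inv a \<in> A" and ac: "a \<in> carrier G"
    using sg_inv[OF assms(1)] sg_carrier[OF assms(1)] by blast+
  have "x \<in> K" if "conjg a x \<in> K" "x \<in> carrier G" for x
    using assms(2)[OF ia that(1)] that(2) ac by simp
  then show "a \<in> normzr K"
    using assms(2)[OF a] ac unfolding normzr_def by blast
qed

lemma conjg_in_subgroup:
  "subgroup A G \<Longrightarrow> a \<in> A \<Longrightarrow> x \<in> A \<Longrightarrow> conjg a x \<in> A"
  unfolding conjg_def by (intro sg_mult sg_inv)

lemma set_multI: "a \<in> A \<Longrightarrow> b \<in> B \<Longrightarrow> a \<otimes> b \<in> A <#> B"
  unfolding set_mult_def by blast

lemma set_mult_subset: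
  assumes "subgroup U G" "A \<subseteq> U" "B \<subseteq> U"
  shows "A <#> B \<subseteq> U"
proof
  fix x assume "x \<in> A <#> B"
  then obtain a b where "a \<in> A" "b \<in> B" "x = a \<otimes> b" unfolding set_mult_def by blast
  then show "x \<in> U" using sg_mult[OF assms(1), of a b] assms(2,3) by blast
qed

lemma conjg_image_cancel:
  assumes "g \<in> carrier G" "A \<subseteq> carrier G"
  shows "conjg (inv g) ` conjg g ` A = A"
proof -
  have "(\<lambda>x. conjg (inv g) (conjg g x)) ` A = (\<lambda>x. x) ` A"
    using assms by (intro image_cong) auto
  then show ?thesis by (simp add: image_image)
qed

lemma subgroup_subset_normzr: "subgroup A G \<Longrightarrow> A \<subseteq> normzr A"
  by (rule subgroup_subset_normzrI) (use conjg_in_subgroup in blast)+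

lemma normzr_Int: "normzr A \<inter> normzr B \<subseteq> normzr (A \<inter> B)"
  by (auto simp: normzr_def)

lemma subgroup_Int2: "subgroup A G \<Longrightarrow> subgroup B G \<Longrightarrow> subgroup (A \<inter> B) G"
  by (simp add: subgroups_Inter_pair)

lemma subgroup_set_mult:
  assumes "subgroup A G" "subgroup B G" "A \<subseteq> normzr B"
  shows "subgroup (A <#> B) G"
proof -
  have AB: "A \<subseteq> carrier G" "B \<subseteq> carrier G"
    using assms sg_subset by blast+
  show ?thesis
  proof (rule subgroupI)
    show "A <#> B \<subseteq> carrier G" using AB by (auto simp: set_mult_def)
    show "A <#> B \<noteq> {}" 
      using set_multI[OF sg_one[OF assms(1)] sg_one[OF assms(2)]] by blast
    fix x y assume "x \<in> A <#> B" "y \<in> A <#> B"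
    then obtain a b a' b' where *: "a \<in> A" "b \<in> B" "x = a \<otimes> b" "a' \<in> A" "b' \<in> B" "y = a' \<otimes> b'"
      by (auto simp: set_mult_def)
    then have c: "a \<in> carrier G" "b \<in> carrier G" "a' \<in> carrier G" "b' \<in> carrier G"
      using AB by auto
    have "inv x = inv a \<otimes> conjg a (inv b)" using * c by (simp add: conjg_def word_simps)
    moreover have "conjg a (inv b) \<in> B"
      using normzrD[of a B "inv b"] sg_inv[OF assms(2)] * c assms(3) by blast
    moreover have "inv a \<in> A" using * assms(1) sg_inv by metis
    ultimately show "inv x \<in> A <#> B" using set_multI by metis
    have "inv a' \<in> normzr B" using sg_inv[OF assms(1)] * assms(3) by blast
    then have "conjg (inv a') b \<otimes> b' \<in> B"
      using normzrD[of "inv a'" B b] * c by (intro sg_mult[OF assms(2)]) blast+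
    moreover have "x \<otimes> y = a \<otimes> a' \<otimes> (conjg (inv a') b \<otimes> b')"
      using * c by (simp add: conjg_def word_simps)
    moreover have "a \<otimes> a' \<in> A" using * assms(1) sg_mult by metis
    ultimately show "x \<otimes> y \<in> A <#> B" using set_multI by metis
  qed
qed

lemma normzr_set_mult:
  assumes "subgroup A G" "subgroup B G" "X \<subseteq> normzr A" "X \<subseteq> normzr B" "subgroup X G"
  shows "X \<subseteq> normzr (A <#> B)"
proof (rule subgroup_subset_normzrI[OF assms(5)])
  fix g x assume g: "g \<in> X" and "x \<in> A <#> B"
  then obtain a b where ab: "a \<in> A" "b \<in> B" "x = a \<otimes> b" by (auto simp: set_mult_def)
  have c: "a \<in> carrier G" "b \<in> carrier G" "g \<in> carrier G"
    using ab g assms sg_carrier by metis+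
  have "conjg g a \<in> A" "conjg g b \<in> B"
    using ab g c assms normzrD by blast+
  then show "conjg g x \<in> A <#> B"
    using c by (auto simp: ab set_mult_def conjg_mult)
qed

lemma subset_set_mult:
  assumes "subgroup A G" "subgroup B G"
  shows "A \<subseteq> A <#> B" "B \<subseteq> A <#> B"
proof -
  show "A \<subseteq> A <#> B"
  proof
    fix a assume "a \<in> A"
    then have "a \<otimes> \<one> = a" using sg_carrier[OF assms(1)] by simp
    then show "a \<in> A <#> B" using set_multI[OF \<open>a \<in> A\<close> sg_one[OF assms(2)]] by simp
  qed
  show "B \<subseteq> A <#> B"
  proof
    fix b assume "b \<in> B"
    then have "\<one> \<otimes> b = b" using sg_carrier[OF assms(2)] by simp
    then show "b \<in> A <#> B" using set_multI[OF sg_one[OF assms(1)] \<open>b \<in> B\<close>] by simp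
  qed
qed

lemma subgroup_pow_closed: "subgroup A G \<Longrightarrow> x \<in> A \<Longrightarrow> x [^] (n::nat) \<in> A"
  by (induction n) (auto simp: sg_one sg_mult)

lemma pow_mem_dvd:
  assumes "subgroup A G" "x \<in> carrier G" "x [^] (m::nat) \<in> A" "m dvd n"
  shows "x [^] n \<in> A"
proof -
  obtain k where "n = m * k" using assms(4) by blast
  then have "x [^] n = (x [^] m) [^] k" using assms(2) by (simp add: nat_pow_pow)
  then show ?thesis using assms subgroup_pow_closed by simp
qed

text \<open>Bezout: \<open>x\<close> is a product of powers of \<open>x [^] m\<close> and
  \<open>x [^] n\<close>. With \<open>m\<close> a power of p and \<open>n\<close> prime to p, this
  is how elements are forced into a subgroup, which may fail to be normal.\<close>

lemma pow_coprime_mem: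
  assumes A: "subgroup A G" and x: "x \<in> carrier G"
    and "x [^] (m::nat) \<in> A" "x [^] (n::nat) \<in> A" "coprime m n"
  shows "x \<in> A"
proof -
  obtain u v :: int where uv: "u * int m + v * int n = 1"
    using assms(5) by (metis bezout_int coprime_int_iff coprime_iff_gcd_eq_1)
  have sub: "x [^] (k * int j) \<in> A" if "x [^] j \<in> A" for k and j::nat
  proof -
    have "x [^] (int j * k) = (x [^] int j) [^] k"
      using x by (simp add: int_pow_pow)
    also have "\<dots> \<in> A" using that A x
      by (simp add: int_pow_int subgroup_int_pow_closed)
    finally show ?thesis by (simp add: mult.commute)
  qed
  have "x = x [^] (u * int m + v * int n)" using uv x by simp
  also have "\<dots> = x [^] (u * int m) \<otimes> x [^] (v * int n)" using x by (simp add: int_pow_mult)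
  finally show ?thesis using sub assms sg_mult by metis
qed

text \<open>In the quotient of \<open>normzr W\<close> by \<open>W\<close>, the elements
  \<open>x\<close> and \<open>x \<otimes> w\<close> coincide, hence so do their powers.\<close>

lemma mult_pow_mem_coset:
  assumes W: "subgroup W G" and x: "x \<in> normzr W" and w: "w \<in> W"
  shows "\<exists>w'\<in>W. (x \<otimes> w) [^] (n::nat) = x [^] n \<otimes> w'"
proof (induction n)
  case 0
  then show ?case using W sg_one by force
next
  case (Suc n)
  then obtain w' where w': "w' \<in> W" "(x \<otimes> w) [^] n = x [^] n \<otimes> w'" by blast
  have c: "x \<in> carrier G" "w \<in> carrier G" "w' \<in> carrier G"
    using assms w' normzr_subset sg_carrier by auto
  have "inv x \<in> normzr W" using x subgroup_normzr sg_inv by blast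
  then have "conjg (inv x) w' \<otimes> w \<in> W"
    using w' c W w by (meson normzrD sg_mult)
  moreover have "(x \<otimes> w) [^] Suc n = x [^] Suc n \<otimes> (conjg (inv x) w' \<otimes> w)"
    using w' c by (simp add: conjg_def word_simps)
  ultimately show ?case by blast
qed

end

section \<open>Subnormal subgroups and finite p-groups\<close>

context group
begin

text \<open>The bottom \<open>S\<close> is fixed and the chain grows at the top, so that an
  induction carries information about \<open>S\<close> from each member of the chain to the next
  larger one.\<close>

inductive subnormal :: "'a set \<Rightarrow> 'a set \<Rightarrow> bool" for S where
  refl: "subgroup S G \<Longrightarrow> subnormal S S"
| step: "subnormal S B \<Longrightarrow> subgroup A G \<Longrightarrow> B \<subseteq> A \<Longrightarrow> A \<subseteq> normzr B \<Longrightarrow> subnormal S A"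

lemma subnormal_subgroups:
  "subnormal S A \<Longrightarrow> subgroup S G \<and> subgroup A G \<and> S \<subseteq> A"
  by (induction rule: subnormal.induct) auto

lemma subnormal_trans: "subnormal B A \<Longrightarrow> subnormal S B \<Longrightarrow> subnormal S A"
  by (induction rule: subnormal.induct) (auto intro: subnormal.step)

lemma normal_imp_subnormal:
  "subgroup S G \<Longrightarrow> subgroup A G \<Longrightarrow> S \<subseteq> A \<Longrightarrow> A \<subseteq> normzr S \<Longrightarrow> subnormal S A"
  by (rule subnormal.step[OF subnormal.refl])

lemma subnormal_Int:
  assumes "subnormal S A" "subgroup C G"
  shows "subnormal (S \<inter> C) (A \<inter> C)"
  using assms(1)
proof induction
  case refl
  then show ?case using assms(2) subgroup_Int2 subnormal.refl by blast
next
  case (step B A)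
  have "A \<inter> C \<subseteq> normzr (B \<inter> C)"
    using step(4) subgroup_subset_normzr[OF assms(2)] normzr_Int by blast
  then show ?case
    using subnormal.step[OF step(5) subgroup_Int2[OF step(2) assms(2)]] step(3) by blast
qed

lemma conjg_image_normzr:
  assumes g: "g \<in> carrier G" and B: "B \<subseteq> carrier G" and A: "A \<subseteq> normzr B"
  shows "conjg g ` A \<subseteq> normzr (conjg g ` B)"
proof
  fix y assume "y \<in> conjg g ` A"
  then obtain a where a: "a \<in> A" "y = conjg g a" by blast
  then have ac: "a \<in> carrier G" using A normzr_subset by blast
  have "conjg y x \<in> conjg g ` B \<longleftrightarrow> x \<in> conjg g ` B" if x: "x \<in> carrier G" for x
  proof -
    have "conjg (inv g) (conjg y x) = conjg a (conjg (inv g) x)"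
      using x g ac by (simp add: a conjg_def word_simps)
    then show ?thesis
      using normzrD[of a B "conjg (inv g) x"] a A x g ac mem_conjg_image[OF g B] by auto
  qed
  then show "y \<in> normzr (conjg g ` B)"
    using a ac g by (simp add: normzr_def)
qed

lemma subnormal_conjg:
  assumes "subnormal S A" "g \<in> carrier G"
  shows "subnormal (conjg g ` S) (conjg g ` A)"
  using assms(1)
proof induction
  case refl
  then show ?case using subnormal.refl subgroup_conjg[OF assms(2)] by blast
next
  case (step B A)
  have "B \<subseteq> carrier G" using sg_subset subnormal_subgroups[OF step(1)] by blast
  then show ?case
    using subnormal.step[OF step(5) subgroup_conjg[OF assms(2) step(2)]]
      conjg_image_normzr[OF assms(2) _ step(4)] step(3) by blast
qed

section \<open>Minimal subnormal subgroups and normal p-subgroups\<close>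

definition min_subnormal :: "'a set \<Rightarrow> 'a set \<Rightarrow> bool" where
  "min_subnormal S A \<longleftrightarrow> subnormal S A \<and> S \<noteq> {\<one>} \<and>
     (\<forall>S'. subnormal S' A \<longrightarrow> S' \<subseteq> S \<longrightarrow> S' \<noteq> {\<one>} \<longrightarrow> S' = S)"

lemma min_subnormal_exists:
  assumes "subgroup A G" "finite A" "A \<noteq> {\<one>}"
  obtains S where "min_subnormal S A"
proof -
  let ?P = "\<lambda>S. subnormal S A \<and> S \<noteq> {\<one>}"
  have "?P A" using assms subnormal.refl by blast
  then obtain S where S: "?P S" "\<And>S'. ?P S' \<Longrightarrow> card S \<le> card S'"
    using ex_has_least_nat[of ?P A card] by blast
  have "finite S" using S(1) assms(2) subnormal_subgroups finite_subset by blast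
  then have "S' = S" if "?P S'" "S' \<subseteq> S" for S'
    using card_seteq[of S S'] S(2)[OF that(1)] that(2) by blast
  then have "min_subnormal S A"
    using S(1) unfolding min_subnormal_def by blast
  then show thesis by (rule that)
qed

text \<open>Intersecting a subnormal chain with \<open>K\<close> shows that, for subgroups of
  \<open>K\<close>, subnormality in \<open>A\<close>, in \<open>A'\<close> and in \<open>K\<close>
  mean the same.\<close>

lemma min_subnormal_transfer:
  assumes "min_subnormal S A" "S \<subseteq> K" "subnormal K A" "subnormal K A'"
  shows "min_subnormal S A'"
proof -
  have KA: "K \<subseteq> A" "subgroup K G" and KA': "K \<subseteq> A'"
    using assms(3,4) subnormal_subgroups by blast+
  have "subnormal S A" using assms(1) unfolding min_subnormal_def by blast
  then have "subnormal (S \<inter> K) (A \<inter> K)" by (rule subnormal_Int[OF _ KA(2)])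
  then have "subnormal S K" using KA assms(2) by (simp add: inf.absorb1 inf.absorb2)
  then have 1: "subnormal S A'" using assms(4) subnormal_trans by blast
  have 2: "S' = S" if S': "subnormal S' A'" "S' \<subseteq> S" "S' \<noteq> {\<one>}" for S'
  proof -
    have "subnormal (S' \<inter> K) (A' \<inter> K)" by (rule subnormal_Int[OF S'(1) KA(2)])
    then have "subnormal S' K" using KA' S' assms(2) by (simp add: inf.absorb1 inf.absorb2)
    then have "subnormal S' A" using assms(3) subnormal_trans by blast
    then show ?thesis using assms(1) S' unfolding min_subnormal_def by blast
  qed
  show ?thesis using 1 2 assms(1) unfolding min_subnormal_def by blast
qed

lemma min_subnormal_conjg:
  assumes "min_subnormal S A" and g: "g \<in> carrier G"
  shows "min_subnormal (conjg g ` S) (conjg g ` A)"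
proof -
  have sn: "subnormal S A" and ne: "S \<noteq> {\<one>}"
    and min: "\<And>S'. subnormal S' A \<Longrightarrow> S' \<subseteq> S \<Longrightarrow> S' \<noteq> {\<one>} \<Longrightarrow> S' = S"
    using assms(1) unfolding min_subnormal_def by blast+
  have sub: "S \<subseteq> carrier G" "A \<subseteq> carrier G" using subnormal_subgroups[OF sn] sg_subset by blast+
  have one: "conjg h ` X \<noteq> {\<one>}" if "X \<noteq> {\<one>}" "h \<in> carrier G" "X \<subseteq> carrier G" for h X
  proof
    assume *: "conjg h ` X = {\<one>}"
    then have "\<forall>x\<in>X. x = \<one>" using that conjg_eq_one_iff[OF that(2)] by blast
    moreover have "X \<noteq> {}" using * by blast
    ultimately have "X = {\<one>}" by auto
    then show False using that(1) by blast
  qed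
  have "S' = conjg g ` S" if S': "subnormal S' (conjg g ` A)" "S' \<subseteq> conjg g ` S" "S' \<noteq> {\<one>}" for S'
  proof -
    have c: "S' \<subseteq> carrier G" using S'(1) subnormal_subgroups sg_subset by blast
    have "subnormal (conjg (inv g) ` S') A"
      using subnormal_conjg[OF S'(1), of "inv g"] g conjg_image_cancel[OF g sub(2)] by simp
    moreover have "conjg (inv g) ` S' \<subseteq> S"
      using S'(2) conjg_image_cancel[OF g sub(1)] by blast
    ultimately have "conjg (inv g) ` S' = S"
      using min one[OF S'(3) inv_closed[OF g] c] by simp
    then show ?thesis using conjg_image_cancel[OF inv_closed[OF g] c] g by simp
  qed
  then show ?thesis
    using subnormal_conjg[OF sn g] one[OF ne g sub(1)] unfolding min_subnormal_def by blast
qed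

text \<open>Write \<open>f u\<close> for the commutator of \<open>k\<close> and \<open>u\<close>, so
  that \<open>conjg k u = f u \<otimes> u\<close>. The hypotheses make these commutators commute
  with \<open>S\<close> and with each other, so \<open>f s\<close> and \<open>f t\<close> cancel
  from the commutator of \<open>conjg k s\<close> and \<open>conjg k t\<close>, which is therefore
  that of \<open>s\<close> and \<open>t\<close>.\<close>

lemma min_subnormal_centralizes_aux:
  assumes k: "k \<in> carrier G" and S: "subgroup S G"
    and f: "\<And>s t. s \<in> S \<Longrightarrow> t \<in> S \<Longrightarrow> conjg (conjg k s \<otimes> inv s) t = t"
    and f': "\<And>s t. s \<in> S \<Longrightarrow> t \<in> S \<Longrightarrow> conjg (conjg (inv k) s \<otimes> inv s) t = t"
    and st: "s \<in> S" "t \<in> S"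
  shows "conjg k (s \<otimes> t \<otimes> inv (t \<otimes> s)) = s \<otimes> t \<otimes> inv (t \<otimes> s)"
proof -
  define f where "f u = conjg k u \<otimes> inv u" for u
  have c: "u \<in> carrier G" if "u \<in> S" for u using that sg_carrier[OF S] by blast
  have fc: "f u \<in> carrier G" if "u \<in> S" for u using c[OF that] k by (simp add: f_def)
  have kf: "conjg k u = f u \<otimes> u" if "u \<in> S" for u
    using c[OF that] k by (simp add: f_def m_assoc)
  have C: "conjg (f u) v = v" if "u \<in> S" "v \<in> S" for u v
    using assms(3)[OF that] by (simp add: f_def)
  \<comment> \<open>Conjugating the hypothesis on \<open>inv k\<close> by \<open>k\<close> shows
    that \<open>f u\<close> commutes with \<open>conjg k v = f v \<otimes> v\<close>, hence with
    \<open>f v\<close>, since it commutes with \<open>v\<close>.\<close>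
  have comm: "conjg (f u) (f v) = f v" if u: "u \<in> S" and v: "v \<in> S" for u v
  proof -
    let ?h = "conjg (inv k) u \<otimes> inv u"
    have h: "?h \<in> carrier G" using c[OF u] k by simp
    have "conjg k ?h = inv (f u)" using c[OF u] k by (simp add: f_def conjg_def word_simps)
    moreover have "conjg (conjg k ?h) (conjg k v) = conjg k (conjg ?h v)"
      using c[OF u] c[OF v] k by (simp add: conjg_def word_simps)
    ultimately have "conjg (inv (f u)) (conjg k v) = conjg k v"
      using f'[OF u v] by simp
    then have "conjg (f u) (conjg k v) = conjg k v"
      using fc[OF u] c[OF v] k by (metis conjg_closed conjg_inv_cancel(1))
    then have "conjg (f u) (f v) \<otimes> v = f v \<otimes> v"
      using kf[OF v] C[OF u v] conjg_mult[OF fc[OF u] fc[OF v] c[OF v]] by simp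
    then show ?thesis using fc[OF u] fc[OF v] c[OF v] by simp
  qed
  have swap: "u \<otimes> f v = f v \<otimes> u" if "u \<in> S" "v \<in> S" for u v
    using C[OF that(2,1)] conjg_eq_iff_commute[OF fc[OF that(2)] c[OF that(1)]] by simp
  have prod: "conjg k (u \<otimes> v) = f u \<otimes> f v \<otimes> (u \<otimes> v)" if u: "u \<in> S" and v: "v \<in> S" for u v
  proof -
    have "conjg k (u \<otimes> v) = f u \<otimes> (u \<otimes> f v) \<otimes> v"
      using kf[OF u] kf[OF v] c[OF u] c[OF v] fc[OF u] fc[OF v] k
      by (simp add: conjg_mult m_assoc)
    also have "\<dots> = f u \<otimes> (f v \<otimes> u) \<otimes> v" using swap[OF u v] by simp
    finally show ?thesis using c[OF u] c[OF v] fc[OF u] fc[OF v] by (simp add: m_assoc)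
  qed
  have ff: "f s \<otimes> f t = f t \<otimes> f s"
    using comm[OF st] conjg_eq_iff_commute[OF fc[OF st(1)] fc[OF st(2)]] by simp
  let ?c = "s \<otimes> t \<otimes> inv (t \<otimes> s)"
  have cS: "?c \<in> S" using st S by (intro sg_mult sg_inv)
  have "conjg k ?c = conjg k (s \<otimes> t) \<otimes> inv (conjg k (t \<otimes> s))"
    using c st k by (simp add: conjg_mult conjg_inv)
  also have "\<dots> = f s \<otimes> f t \<otimes> (s \<otimes> t) \<otimes> inv (f s \<otimes> f t \<otimes> (t \<otimes> s))"
    using prod st ff by simp
  also have "\<dots> = conjg (f s) (conjg (f t) ?c)"
    using st c fc by (simp add: conjg_def word_simps)
  also have "\<dots> = ?c" using C st cS by simp
  finally show ?thesis .
qed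

text \<open>Induction up the subnormal chain from \<open>S\<close> to \<open>A\<close>. If
  \<open>B\<close> is normal in \<open>D\<close>, then for \<open>k\<close> in
  \<open>K \<inter> D\<close> the commutators of \<open>k\<close> with \<open>S\<close> lie in
  \<open>K \<inter> B\<close> and so centralise \<open>S\<close>; by the preceding lemma
  \<open>k\<close> fixes all commutators of \<open>S\<close>. The fixed points of \<open>k\<close>
  in \<open>S\<close> form a normal subgroup of \<open>S\<close>, non-trivial because
  \<open>S\<close> is not abelian, hence all of \<open>S\<close> by minimality.\<close>

lemma min_subnormal_centralizes:
  assumes min: "min_subnormal S A" and K: "subgroup K G" "A \<subseteq> normzr K" "S \<inter> K = {\<one>}"
    and ab: "a \<in> S" "b \<in> S" "a \<otimes> b \<noteq> b \<otimes> a"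
    and ks: "k \<in> K" "k \<in> A" "s \<in> S"
  shows "conjg k s = s"
proof -
  have SA: "subnormal S A" using min unfolding min_subnormal_def by blast
  have S: "subgroup S G" "S \<subseteq> A" and A: "subgroup A G" using subnormal_subgroups[OF SA] by blast+
  have "B \<subseteq> A \<Longrightarrow> \<forall>k\<in>K \<inter> B. \<forall>s\<in>S. conjg k s = s" if "subnormal S B" for B
    using that
  proof induction
    case refl
    have "k = \<one>" if "k \<in> K \<inter> S" for k using that K(3) by blast
    then show ?case using sg_carrier[OF S(1)] one_conjg by blast
  next
    case (step B D)
    then have IH: "\<And>k s. k \<in> K \<Longrightarrow> k \<in> B \<Longrightarrow> s \<in> S \<Longrightarrow> conjg k s = s" by blast
    have B: "subgroup B G" "S \<subseteq> B" using subnormal_subgroups[OF step(1)] by blast+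
    have aux: "conjg (conjg k s \<otimes> inv s) t = t"
      if k: "k \<in> K" "k \<in> D" and st: "s \<in> S" "t \<in> S" for k s t
    proof (rule IH[OF _ _ st(2)])
      have c: "k \<in> carrier G" "s \<in> carrier G"
        using k st sg_carrier[OF K(1)] sg_carrier[OF S(1)] by blast+
      have "s \<in> normzr K" using st S K(2) by blast
      then have "conjg s (inv k) \<in> K" using normzrD[of s K "inv k"] c sg_inv[OF K(1) k(1)] by simp
      then have "k \<otimes> conjg s (inv k) \<in> K" using sg_mult[OF K(1) k(1)] by blast
      then show "conjg k s \<otimes> inv s \<in> K" using c by (simp add: conjg_def word_simps)
      have "conjg k s \<in> B" using normzrD[of k B s] k step(4) B(2) st c by blast
      then show "conjg k s \<otimes> inv s \<in> B" using B st sg_inv[OF B(1)] sg_mult[OF B(1)] by blast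
    qed
    show ?case
    proof (intro ballI)
      fix k s assume k: "k \<in> K \<inter> D" and s: "s \<in> S"
      have kc: "k \<in> carrier G" using k sg_carrier[OF K(1)] by blast
      have ik: "inv k \<in> K" "inv k \<in> D"
        using k sg_inv[OF K(1)] sg_inv[OF step(2)] by blast+
      define Z where "Z = {x \<in> S. conjg k x = x}"
      have sc: "x \<in> carrier G" if "x \<in> S" for x using sg_carrier[OF S(1) that] .
      have Z: "subgroup Z G"
      proof (rule subgroupI)
        show "Z \<subseteq> carrier G" using sc by (auto simp: Z_def)
        show "Z \<noteq> {}" using sg_one[OF S(1)] kc by (auto simp: Z_def)
        show "inv x \<in> Z" if "x \<in> Z" for x
          using that sg_inv[OF S(1)] sc kc by (auto simp: Z_def conjg_inv)
        show "x \<otimes> y \<in> Z" if "x \<in> Z" "y \<in> Z" for x y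
          using that sg_mult[OF S(1)] sc kc by (auto simp: Z_def conjg_mult)
      qed
      have "S \<subseteq> normzr Z"
      proof (rule subgroup_subset_normzrI[OF S(1)])
        fix u x assume u: "u \<in> S" and x: "x \<in> Z" "x \<in> carrier G"
        have xS: "x \<in> S" and kx: "conjg k x = x" using x by (auto simp: Z_def)
        have cS: "conjg u x \<in> S" using conjg_in_subgroup[OF S(1) u xS] .
        have "conjg k (conjg u x) = conjg (conjg k u \<otimes> inv u) (conjg u (conjg k x))"
          using kc sc[OF u] x(2) by (simp add: conjg_def word_simps)
        also have "\<dots> = conjg u x" using aux[OF _ _ u cS] k kx by simp
        finally show "conjg u x \<in> Z" using cS by (simp add: Z_def)
      qed
      then have "subnormal Z A"
        using normal_imp_subnormal[OF Z S(1)] subnormal_trans[OF SA] by (auto simp: Z_def)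
      moreover have "a \<otimes> b \<otimes> inv (b \<otimes> a) \<in> Z"
        using min_subnormal_centralizes_aux[OF kc S(1) aux aux[OF ik] ab(1,2)] k ab
        by (auto simp: Z_def intro!: sg_mult[OF S(1)] sg_inv[OF S(1)])
      moreover have "a \<otimes> b \<otimes> inv (b \<otimes> a) \<noteq> \<one>"
        using ab sc by (metis inv_closed inv_equality inv_inv m_closed)
      ultimately have "Z = S" using min unfolding min_subnormal_def by (auto simp: Z_def)
      then show "conjg k s = s" using s by (auto simp: Z_def)
    qed
  qed
  from this[OF SA] show ?thesis using ks by blast
qed

text \<open>In the abelian group \<open>S\<close> the elements with trivial p-th power form a normal
  subgroup. For p dividing the order of some \<open>x \<noteq> \<one>\<close> in \<open>S\<close> it
  contains a non-trivial power of \<open>x\<close>, so minimality makes it all of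
  \<open>S\<close>.\<close>

lemma min_subnormal_abelian_exponent:
  assumes min: "min_subnormal S A" and "finite A"
    and comm: "\<And>a b. a \<in> S \<Longrightarrow> b \<in> S \<Longrightarrow> a \<otimes> b = b \<otimes> a"
  obtains p :: nat where "prime p" "\<And>x. x \<in> S \<Longrightarrow> x [^] p = \<one>"
proof -
  have SA: "subnormal S A" using min unfolding min_subnormal_def by blast
  have S: "subgroup S G" "S \<subseteq> A" using subnormal_subgroups[OF SA] by blast+
  have finS: "finite S" using S assms(2) finite_subset by blast
  have sc: "x \<in> carrier G" if "x \<in> S" for x using sg_carrier[OF S(1) that] .
  obtain x where x: "x \<in> S" "x \<noteq> \<one>" using min sg_one[OF S(1)] unfolding min_subnormal_def by blast
  interpret SG: group "G\<lparr>carrier := S\<rparr>" by (rule subgroup.subgroup_is_group[OF S(1)]) (rule is_group)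
  define n where "n = SG.ord x"
  have xn: "x [^] n = \<one>"
    using SG.pow_ord_eq_1[of x] x by (simp add: n_def nat_pow_def)
  have n0: "n > 0" using SG.ord_ge_1[of x] finS x by (simp add: n_def)
  have "n \<noteq> 1" using xn x sc by auto
  then obtain p where p: "prime p" "p dvd n" using prime_factor_nat by blast
  define y where "y = x [^] (n div p)"
  have yp: "y [^] p = \<one>" using p xn sc[OF x(1)] by (simp add: y_def nat_pow_pow)
  have "y \<noteq> \<one>"
  proof
    assume "y = \<one>"
    then have "x [^]\<^bsub>G\<lparr>carrier := S\<rparr>\<^esub> (n div p) = \<one>\<^bsub>G\<lparr>carrier := S\<rparr>\<^esub>" by (simp add: y_def nat_pow_def)
    then have "n dvd n div p" using SG.pow_eq_id[of x "n div p"] x by (simp add: n_def)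
    moreover have "0 < n div p" using n0 p by (simp add: dvd_imp_le div_greater_zero_iff prime_gt_0_nat)
    moreover have "n div p < n" using n0 prime_gt_1_nat[OF p(1)] by simp
    ultimately show False using dvd_imp_le by fastforce
  qed
  have yS: "y \<in> S" unfolding y_def using subgroup_pow_closed[OF S(1) x(1)] .
  define Z where "Z = {z \<in> S. z [^] p = \<one>}"
  have powm: "(u \<otimes> v) [^] m = u [^] m \<otimes> v [^] m" if "u \<in> S" "v \<in> S" for u v and m :: nat
    using pow_mult_distrib[OF comm] that sc by blast
  have Z: "subgroup Z G"
  proof (rule subgroupI)
    show "Z \<subseteq> carrier G" using sc by (auto simp: Z_def)
    show "Z \<noteq> {}" using yS yp by (auto simp: Z_def)
    show "inv u \<in> Z" if "u \<in> Z" for u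
      using that sg_inv[OF S(1)] sc by (auto simp: Z_def nat_pow_inv)
    show "u \<otimes> v \<in> Z" if "u \<in> Z" "v \<in> Z" for u v
      using that sg_mult[OF S(1)] sc by (auto simp: Z_def powm)
  qed
  have "S \<subseteq> normzr Z"
  proof (rule subgroup_subset_normzrI[OF S(1)])
    fix u z assume "u \<in> S" "z \<in> Z"
    then show "conjg u z \<in> Z"
      using comm[of u z] conjg_eq_iff_commute[of u z] sc by (auto simp: Z_def)
  qed
  then have "subnormal Z A"
    using normal_imp_subnormal[OF Z S(1)] subnormal_trans[OF SA] by (auto simp: Z_def)
  moreover have "y \<in> Z" using yS yp by (simp add: Z_def)
  ultimately have "Z = S"
    using min \<open>y \<noteq> \<one>\<close> unfolding min_subnormal_def by (auto simp: Z_def)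
  then show thesis using that[OF p(1)] by (auto simp: Z_def)
qed

text \<open>When \<open>R\<close> normalises the subgroup \<open>W\<close> and p is prime, this says
  that \<open>R <#> W\<close> modulo \<open>W\<close> is a p-group in the sense of element orders.
  \<open>W\<close> may lie outside \<open>R\<close>, and \<open>{\<one>}\<close> gives p-groups
  themselves.\<close>

definition p_power_into :: "nat \<Rightarrow> 'a set \<Rightarrow> 'a set \<Rightarrow> bool" where
  "p_power_into p W R \<longleftrightarrow> (\<forall>x\<in>R. \<exists>k. x [^] (p ^ k) \<in> W)"

text \<open>An extension of a p-group by a p-group: one p-power moves \<open>r \<otimes> w\<close>
  into \<open>W\<close>, a second one moves the result from \<open>W\<close> into
  \<open>W'\<close>.\<close>

lemma p_power_into_set_mult:
  assumes R: "subgroup R G" and W: "subgroup W G" "R \<subseteq> normzr W"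
    and RW': "p_power_into p W' R" "p_power_into p W' W" "W' \<subseteq> W"
  shows "p_power_into p W' (R <#> W)"
  unfolding p_power_into_def
proof
  fix x assume "x \<in> R <#> W"
  then obtain r w where rw: "r \<in> R" "w \<in> W" "x = r \<otimes> w" by (auto simp: set_mult_def)
  obtain k where k: "r [^] (p ^ k) \<in> W'" using RW'(1) rw(1) unfolding p_power_into_def by blast
  obtain w' where w': "w' \<in> W" "x [^] (p ^ k) = r [^] (p ^ k) \<otimes> w'"
    using mult_pow_mem_coset[OF W(1) _ rw(2)] rw W(2) by blast
  then have "x [^] (p ^ k) \<in> W" using k RW'(3) sg_mult[OF W(1)] by auto
  then obtain l where l: "(x [^] (p ^ k)) [^] (p ^ l) \<in> W'"
    using RW'(2) unfolding p_power_into_def by blast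
  have "x \<in> carrier G" using rw sg_carrier[OF R] sg_carrier[OF W(1)] by simp
  then show "\<exists>k. x [^] (p ^ k) \<in> W'"
    using l by (metis nat_pow_pow power_add)
qed

text \<open>Induction up the chain: a normal p-subgroup of \<open>B\<close> lies in the largest one,
  \<open>O\<^sub>p(B)\<close>, and this is invariant under everything that normalises
  \<open>B\<close>.\<close>

lemma subnormal_p_subgroup_in_normal:
  assumes "subnormal S A" "p_power_into p {\<one>} S"
  shows "\<exists>P. subgroup P G \<and> S \<subseteq> P \<and> P \<subseteq> A \<and> A \<subseteq> normzr P \<and> p_power_into p {\<one>} P"
  using assms(1)
proof induction
  case refl
  then show ?case using assms(2) subgroup_subset_normzr by blast
next
  case (step B A)
  have B: "subgroup B G" using subnormal_subgroups[OF step(1)] by blast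
  let ?N = "\<lambda>R. subgroup R G \<and> R \<subseteq> B \<and> B \<subseteq> normzr R \<and> p_power_into p {\<one>} R"
  \<comment> \<open>\<open>Q\<close> is \<open>O\<^sub>p(B)\<close>, formed as a plain union: the
    product of two normal p-subgroups is another one, so the union is directed and already a
    subgroup.\<close>
  define Q where "Q = \<Union>{R. ?N R}"
  have mult: "?N (R <#> R')" if R: "?N R" and R': "?N R'" for R R'
  proof -
    have "R \<subseteq> normzr R'" using R R' by blast
    moreover have "R <#> R' \<subseteq> B"
      by (rule set_mult_subset[OF B]) (use R R' in blast)+
    moreover have "{\<one>} \<subseteq> R'" using R' sg_one by blast
    ultimately show ?thesis
      using subgroup_set_mult[of R R'] normzr_set_mult[of R R' B] B
        p_power_into_set_mult[of R R' p "{\<one>}"] R R' by blast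
  qed
  have QI: "x \<in> Q" if "?N R" "x \<in> R" for x R using that unfolding Q_def by blast
  have Q: "subgroup Q G"
  proof (rule subgroupI)
    show "Q \<subseteq> carrier G" using sg_subset[OF B] by (auto simp: Q_def)
    have "?N {\<one>}"
      using sg_one[OF B] sg_subset[OF B] triv_subgroup
      by (auto simp: p_power_into_def normzr_def conjg_eq_one_iff)
    then show "Q \<noteq> {}" using QI by blast
    fix x assume "x \<in> Q"
    then obtain R where R: "?N R" "x \<in> R" unfolding Q_def by blast
    then show "inv x \<in> Q" using QI[OF R(1)] sg_inv by blast
    fix y assume "y \<in> Q"
    then obtain R' where R': "?N R'" "y \<in> R'" unfolding Q_def by blast
    show "x \<otimes> y \<in> Q" using QI[OF mult[OF R(1) R'(1)]] set_multI R(2) R'(2) by blast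
  qed
  have "p_power_into p {\<one>} Q" unfolding Q_def p_power_into_def by blast
  moreover have "A \<subseteq> normzr Q"
  proof (rule subgroup_subset_normzrI[OF step(2)])
    fix a x assume a: "a \<in> A" and "x \<in> Q"
    then obtain R where R: "?N R" "x \<in> R" unfolding Q_def by blast
    have ac: "a \<in> carrier G" using sg_carrier[OF step(2) a] .
    have imB: "conjg a ` B = B"
    proof -
      have "a \<in> normzr B" "inv a \<in> normzr B" using a step(4) sg_inv[OF step(2)] by blast+
      then have "\<And>y. y \<in> carrier G \<Longrightarrow> conjg (inv a) y \<in> B \<longleftrightarrow> y \<in> B" using normzrD by blast
      then show ?thesis using mem_conjg_image[OF ac sg_subset[OF B]] sg_carrier[OF B] by blast
    qed
    have "?N (conjg a ` R)"
    proof (intro conjI)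
      show "subgroup (conjg a ` R) G" using R subgroup_conjg[OF ac, of R] by simp
      show "conjg a ` R \<subseteq> B" using R imB by blast
      show "B \<subseteq> normzr (conjg a ` R)"
        using conjg_image_normzr[OF ac sg_subset, of R B] R imB by simp
      show "p_power_into p {\<one>} (conjg a ` R)"
        unfolding p_power_into_def
      proof (clarify, goal_cases)
        case (1 _ r)
        then have "r \<in> carrier G" using R sg_carrier by blast
        moreover obtain k where "r [^] (p ^ k) = \<one>" using 1 R unfolding p_power_into_def by blast
        ultimately have "conjg a r [^] (p ^ k) = \<one>" using ac by (simp flip: conjg_pow)
        then show ?case by blast
      qed
    qed
    then show "conjg a x \<in> Q" using QI R(2) by blast
  qed
  moreover obtain P where "?N P" "S \<subseteq> P" using step(5) by blast
  moreover have "Q \<subseteq> A" using step(3) unfolding Q_def by blast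
  ultimately show ?case using Q QI by blast
qed

end

section \<open>Finite p-groups\<close>

lemma prime_power_if_unique_prime:
  fixes n p :: nat
  assumes "n > 0" "prime p" "\<And>q. prime q \<Longrightarrow> q dvd n \<Longrightarrow> q = p"
  shows "\<exists>k. n = p ^ k"
proof -
  obtain m where m: "n = p ^ multiplicity p n * m" "\<not> p dvd m"
    using multiplicity_decompose'[of n p] assms by (metis not_prime_unit neq0_conv)
  have "m = 1"
  proof (rule ccontr)
    assume "m \<noteq> 1"
    then obtain q where "prime q" "q dvd m" using prime_factor_nat by blast
    then show False using m assms(3) by (metis dvd_mult)
  qed
  then show ?thesis using m by auto
qed

text \<open>A second prime divisor q would give, through a Sylow q-subgroup, a non-trivial element
  having both a q-power and a p-power trivial, which Bezout excludes.\<close>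

lemma (in group) order_p_power:
  assumes "finite (carrier G)" "prime p" "p_power_into p {\<one>} (carrier G)"
  shows "\<exists>k. order G = p ^ k"
proof (rule prime_power_if_unique_prime)
  show "order G > 0" using assms(1) by (simp add: order_gt_0_iff_finite)
  fix q :: nat assume q: "prime q" "q dvd order G"
  show "q = p"
  proof (rule ccontr)
    assume "q \<noteq> p"
    obtain m where m: "order G = q ^ multiplicity q (order G) * m"
      using multiplicity_dvd by blast
    obtain H where H: "subgroup H G" "card H = q ^ multiplicity q (order G)"
      using sylow_thm[OF q(1) is_group m assms(1)] by blast
    have "multiplicity q (order G) > 0"
      using q assms(1) by (simp add: prime_multiplicity_gt_zero_iff order_gt_0_iff_finite)
    then have "card H > 1" unfolding H(2) using prime_gt_1_nat[OF q(1)] by (rule one_less_power[rotated])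
    then obtain x where x: "x \<in> H" "x \<noteq> \<one>"
      by (metis card_1_singleton_iff card.empty less_irrefl not_less_zero is_singletonI' is_singleton_altdef sg_one[OF H(1)])
    then have xc: "x \<in> carrier G" using sg_carrier[OF H(1)] by blast
    interpret HG: group "G\<lparr>carrier := H\<rparr>" by (rule subgroup.subgroup_is_group[OF H(1)]) (rule is_group)
    have "x [^] card H = \<one>"
      using HG.pow_order_eq_1[of x] x by (simp add: order_def nat_pow_def)
    moreover obtain k where "x [^] (p ^ k) = \<one>" using assms(3) xc unfolding p_power_into_def by blast
    moreover have "coprime (card H) (p ^ k)"
      using H(2) \<open>q \<noteq> p\<close> q(1) assms(2) by (simp add: primes_coprime)
    ultimately show False
      using pow_coprime_mem[OF triv_subgroup xc, of "card H" "p ^ k"] x by simp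
  qed
qed (use assms in auto)

text \<open>The inverse turns right multiplication into a left action.\<close>

lemma (in group) rcosets_action:
  assumes Q: "subgroup Q G"
  shows "group_action (G\<lparr>carrier := Q\<rparr>) (rcosets Q) (\<lambda>q. \<lambda>X\<in>rcosets Q. X #> inv q)"
proof -
  let ?E = "rcosets Q" and ?f = "\<lambda>q. \<lambda>X\<in>rcosets Q. X #> inv q"
  have Qc: "Q \<subseteq> carrier G" using sg_subset[OF Q] .
  have mem: "X #> g \<in> ?E" if X: "X \<in> ?E" and g: "g \<in> carrier G" for X g
  proof -
    obtain x where x: "x \<in> carrier G" "X = Q #> x" using X unfolding RCOSETS_def by blast
    then have "X #> g = Q #> (x \<otimes> g)" using coset_mult_assoc[OF Qc x(1) g] by simp
    then show ?thesis using x g unfolding RCOSETS_def by blast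
  qed
  have Xc: "X \<subseteq> carrier G" if "X \<in> ?E" for X using subgroup.rcosets_carrier[OF Q is_group that] .
  have canc: "X #> inv g #> g = X" "X #> g #> inv g = X" if "X \<in> ?E" "g \<in> carrier G" for X g
    using that coset_mult_assoc[OF Xc[OF that(1)]] coset_mult_one[OF Xc[OF that(1)]] by simp_all
  have bij: "?f q \<in> Bij ?E" if q: "q \<in> Q" for q
  proof -
    have qc: "q \<in> carrier G" using q Qc by blast
    have "bij_betw (\<lambda>X. X #> inv q) ?E ?E"
      by (rule bij_betw_byWitness[where f' = "\<lambda>X. X #> q"])
        (use canc qc mem in \<open>auto simp del: coset_mult_assoc\<close>)
    then show ?thesis by (simp add: Bij_def bij_betw_restrict_eq)
  qed
  have hom: "?f (q \<otimes> r) = compose ?E (?f q) (?f r)" if qr: "q \<in> Q" "r \<in> Q" for q r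
  proof
    fix X
    have c: "q \<in> carrier G" "r \<in> carrier G" using qr Qc by blast+
    show "?f (q \<otimes> r) X = compose ?E (?f q) (?f r) X"
    proof (cases "X \<in> ?E")
      case True
      then show ?thesis
        using c mem[OF True, of "inv r"] coset_mult_assoc[OF Xc[OF True], of "inv r" "inv q"]
        by (simp add: compose_def inv_mult_group)
    qed (simp add: compose_def)
  qed
  have "?f \<in> hom (G\<lparr>carrier := Q\<rparr>) (BijGroup ?E)"
    using bij hom by (auto simp: hom_def BijGroup_def)
  then show ?thesis
    unfolding group_action_def group_hom_def group_hom_axioms_def
    using group_BijGroup subgroup.subgroup_is_group[OF Q is_group] by blast
qed

text \<open>Counting cosets modulo p. \<open>Q\<close> acts on its right cosets with orbits of
  p-power size, and if \<open>Q #> x\<close> is fixed then \<open>x\<close> normalises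
  \<open>Q\<close>. If only elements of \<open>Q\<close> do so, then \<open>Q\<close> is the only
  fixed point, and the number of cosets, a multiple of p, would be 1 modulo p.\<close>

lemma (in group) p_group_normalizer_grows:
  assumes fin: "finite (carrier G)" and p: "prime p" and ord: "order G = p ^ k"
    and Q: "subgroup Q G" "Q \<noteq> carrier G"
  shows "\<exists>x\<in>carrier G - Q. x \<in> normzr Q"
proof (rule ccontr)
  assume no: "\<not> ?thesis"
  let ?H = "G\<lparr>carrier := Q\<rparr>" and ?E = "rcosets Q" and ?f = "\<lambda>q. \<lambda>X\<in>rcosets Q. X #> inv q"
  interpret A: group_action ?H ?E ?f by (rule rcosets_action[OF Q(1)])
  have Qc: "Q \<subseteq> carrier G" using sg_subset[OF Q(1)] .
  have finQ: "finite Q" using finite_subset[OF Qc fin] .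
  have finE: "finite ?E" using fin unfolding RCOSETS_def by simp
  have lag: "card ?E * card Q = p ^ k" using lagrange[OF Q(1)] ord by simp
  have QE: "Q \<in> ?E" by (rule subgroup.subgroup_in_rcosets[OF Q(1) is_group]) 
  have pE: "p dvd card ?E"
  proof -
    have "card ?E \<noteq> 1"
    proof
      assume "card ?E = 1"
      then have "card Q = card (carrier G)" using lag ord by (simp add: order_def)
      then show False using card_subset_eq[OF fin Qc] Q(2) by blast
    qed
    moreover have "card ?E dvd p ^ k" using lag by (metis dvd_triv_left)
    ultimately show ?thesis
      using divides_primepow_nat[OF p] by (metis One_nat_def dvd_power gr0I power_0)
  qed
  have orbQ: "orbit ?H ?f Q = {Q}"
  proof -
    have "?f q Q = Q" if "q \<in> Q" for q
      using QE that coset_join2[OF _ Q(1)] sg_inv[OF Q(1)] Qc by auto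
    then show ?thesis using sg_one[OF Q(1)] QE unfolding orbit_def by auto
  qed
  have div: "p dvd card X" if X: "X \<in> orbits ?H ?E ?f - {{Q}}" for X
  proof -
    obtain Y where Y: "Y \<in> ?E" "X = orbit ?H ?f Y" using X unfolding orbits_def by blast
    obtain x where x: "x \<in> carrier G" "Y = Q #> x" using Y(1) unfolding RCOSETS_def by blast
    have "card X dvd order ?H"
      using A.orbit_stabilizer_theorem[OF Y(1)] Y(2) by (metis dvd_triv_left)
    then have "card X dvd p ^ k"
      using lag by (simp add: order_def) (metis dvd_trans dvd_triv_right)
    moreover have "card X \<noteq> 1"
    proof
      assume "card X = 1"
      then obtain Z where Z: "X = {Z}" using card_1_singletonE by blast
      have fY: "?f q Y = Y" if "q \<in> Q" for q
      proof -
        have "X = (\<lambda>q. ?f q Y) ` Q" unfolding Y(2) orbit_def by auto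
        then have "?f q Y \<in> X" "?f \<one> Y \<in> X" using that sg_one[OF Q(1)] by blast+
        moreover have "?f \<one> Y = Y" using Y(1) subgroup.rcosets_carrier[OF Q(1) is_group Y(1)] by simp
        ultimately show ?thesis using Z by auto
      qed
      have sub: "conjg x q \<in> Q" if q: "q \<in> Q" for q
      proof -
        have qc: "q \<in> carrier G" using q Qc by blast
        have "Y #> inv (inv q) = Y" using fY[OF sg_inv[OF Q(1) q]] Y(1) by simp
        then have "Q #> (x \<otimes> q) = Q #> x" using x qc coset_mult_assoc[OF Qc x(1) qc] by simp
        moreover have "x \<otimes> q \<in> Q #> (x \<otimes> q)" using rcos_self[OF _ Q(1)] x qc by simp
        ultimately have "x \<otimes> q \<in> Q #> x" by simp
        then obtain q' where "q' \<in> Q" "x \<otimes> q = q' \<otimes> x" unfolding r_coset_def by blast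
        then show ?thesis using x qc Qc by (auto simp: conjg_def m_assoc)
      qed
      \<comment> \<open>\<open>Q\<close> is finite, so the injective map \<open>conjg x\<close>,
        which sends \<open>Q\<close> into itself, is onto.\<close>
      have im: "conjg x ` Q = Q"
      proof (rule card_subset_eq[OF finQ])
        show "conjg x ` Q \<subseteq> Q" using sub by blast
        have "inj_on (conjg x) Q"
          by (rule inj_on_inverseI[of _ "conjg (inv x)"]) (use x Qc in auto)
        then show "card (conjg x ` Q) = card Q" by (rule card_image)
      qed
      have "y \<in> Q" if "conjg x y \<in> Q" "y \<in> carrier G" for y
      proof -
        obtain z where "z \<in> Q" "conjg x y = conjg x z" using im \<open>conjg x y \<in> Q\<close> by blast
        then show ?thesis using x that Qc by (metis conjg_inv_cancel(2) subsetD)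
      qed
      then have "x \<in> normzr Q" using sub x unfolding normzr_def by blast
      then have "x \<in> Q" using no x by blast
      then have "Y = Q" using x coset_join2[OF x(1) Q(1)] by simp
      then show False using X Y(2) orbQ by blast
    qed
    ultimately show ?thesis
      using divides_primepow_nat[OF p] by (metis One_nat_def dvd_power gr0I power_0)
  qed
  have finO: "finite (orbits ?H ?E ?f)" using finE unfolding orbits_def by simp
  have QO: "{Q} \<in> orbits ?H ?E ?f" using orbQ QE unfolding orbits_def by blast
  have "card ?E = (\<Sum>X\<in>orbits ?H ?E ?f. card X)"
    using A.disjoint_sum[OF finE, of "\<lambda>_. 1::nat"] by simp
  also have "\<dots> = card {Q} + (\<Sum>X\<in>orbits ?H ?E ?f - {{Q}}. card X)"
    using sum.remove[OF finO QO] by blast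
  finally have "card ?E = 1 + (\<Sum>X\<in>orbits ?H ?E ?f - {{Q}}. card X)" by simp
  moreover have "p dvd (\<Sum>X\<in>orbits ?H ?E ?f - {{Q}}. card X)"
    using dvd_sum[of "orbits ?H ?E ?f - {{Q}}" p card] div by blast
  ultimately have "p dvd 1" using pE by (metis dvd_add_left_iff)
  then show False using p by (simp add: prime_nat_iff)
qed

section \<open>Topological groups\<close>

text \<open>By directedness every finite intersection of the sets \<open>F i\<close> contains some
  \<open>F k\<close> and so meets \<open>U\<close>; what remains is the finite intersection
  property.\<close>

lemma compactin_directed_Inter:
  assumes U: "compactin X U" and I: "I \<noteq> {}"
    and F: "\<And>i. i \<in> I \<Longrightarrow> closedin X (F i)" "\<And>i. i \<in> I \<Longrightarrow> U \<inter> F i \<noteq> {}"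
    and dir: "\<And>i j. i \<in> I \<Longrightarrow> j \<in> I \<Longrightarrow> \<exists>k\<in>I. F k \<subseteq> F i \<inter> F j"
  obtains x where "x \<in> U" "\<And>i. i \<in> I \<Longrightarrow> x \<in> F i"
proof -
  have "\<exists>k\<in>I. F k \<subseteq> \<Inter>\<F>" if "finite \<F>" "\<F> \<subseteq> F ` I" for \<F>
    using that
  proof (induction \<F>)
    case empty
    then show ?case using I by auto
  next
    case (insert A \<F>)
    then obtain k i where "k \<in> I" "F k \<subseteq> \<Inter>\<F>" "i \<in> I" "A = F i" by auto
    then obtain j where "j \<in> I" "F j \<subseteq> F k \<inter> F i" using dir by blast
    then show ?case using \<open>F k \<subseteq> \<Inter>\<F>\<close> \<open>A = F i\<close> by blast
  qed
  then have "U \<inter> \<Inter>\<F> \<noteq> {}" if "finite \<F>" "\<F> \<subseteq> F ` I" for \<F>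
    using F(2) that by fastforce
  moreover have "\<forall>C\<in>F ` I. closedin X C" using F(1) by blast
  ultimately have "U \<inter> \<Inter>(F ` I) \<noteq> {}"
    using U unfolding compactin_fip by meson
  then show thesis using that by blast
qed

section \<open>Unions of cosets, cores and compact sets in topological groups\<close>

context topological_group
begin

lemma continuous_map_mult [continuous_intros]:
  assumes "continuous_map X T f" "continuous_map X T g"
  shows "continuous_map X T (\<lambda>x. f x \<otimes> g x)"
  using continuous_map_compose[OF continuous_map_pairedI[OF assms] continuous_mult]
  by (simp add: o_def)

lemma continuous_map_inv [continuous_intros]:
  assumes "continuous_map X T f"
  shows "continuous_map X T (\<lambda>x. inv (f x))"
  using continuous_map_compose[OF assms continuous_inv] by (simp add: o_def)

lemma continuous_map_const_carrier: "a \<in> carrier G \<Longrightarrow> continuous_map X T (\<lambda>x. a)"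
  by (simp add: topspace_eq_carrier)

lemma continuous_map_conjg:
  assumes "continuous_map X T f" "continuous_map X T g"
  shows "continuous_map X T (\<lambda>x. conjg (f x) (g x))"
  unfolding conjg_def by (intro continuous_intros assms)

lemma openin_preimage: "continuous_map T T f \<Longrightarrow> openin T A \<Longrightarrow> openin T {x \<in> carrier G. f x \<in> A}"
  using openin_continuous_map_preimage[of T T f A] by (simp add: topspace_eq_carrier)

lemma closedin_preimage: "continuous_map T T f \<Longrightarrow> closedin T A \<Longrightarrow> closedin T {x \<in> carrier G. f x \<in> A}"
  using closedin_continuous_map_preimage[of T T f A] by (simp add: topspace_eq_carrier)

lemma continuous_translate:
  assumes "a \<in> carrier G"
  shows "continuous_map T T (\<lambda>x. a \<otimes> x)" "continuous_map T T (\<lambda>x. x \<otimes> a)"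
    "continuous_map T T (conjg a)" "continuous_map T T (\<lambda>x. conjg x a)"
  by (intro continuous_map_mult continuous_map_const_carrier continuous_map_conjg
      continuous_map_id[unfolded id_def] assms)+

lemma openin_imp_carrier: "openin T A \<Longrightarrow> A \<subseteq> carrier G"
  using openin_subset topspace_eq_carrier by blast

lemma compactin_imp_carrier: "compactin T A \<Longrightarrow> A \<subseteq> carrier G"
  using compactin_subset_topspace topspace_eq_carrier by blast

text \<open>The last hypothesis says that \<open>X\<close> is a union of left cosets of the open
  subgroup \<open>W\<close>. The complement is then such a union as well, so \<open>X\<close> is
  also closed.\<close>

lemma coset_invariant_open:
  assumes W: "subgroup W G" "openin T W" and X: "X \<subseteq> carrier G"
    and inv: "\<And>x w. x \<in> X \<Longrightarrow> w \<in> W \<Longrightarrow> x \<otimes> w \<in> X"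
  shows "openin T X"
  unfolding openin_subopen[of T X]
proof
  fix x assume x: "x \<in> X"
  then have xc: "x \<in> carrier G" using X by blast
  let ?V = "{y \<in> carrier G. inv x \<otimes> y \<in> W}"
  have "openin T ?V" using xc by (intro openin_preimage continuous_translate W) auto
  moreover have "x \<in> ?V" using xc sg_one[OF W(1)] by simp
  moreover have "?V \<subseteq> X"
  proof
    fix y assume y: "y \<in> ?V"
    then have "x \<otimes> (inv x \<otimes> y) \<in> X" using inv[OF x] by blast
    then show "y \<in> X" using y xc by simp
  qed
  ultimately show "\<exists>V. openin T V \<and> x \<in> V \<and> V \<subseteq> X" by blast
qed

lemma coset_invariant_closed:
  assumes W: "subgroup W G" "openin T W" and X: "X \<subseteq> carrier G"
    and inv: "\<And>x w. x \<in> X \<Longrightarrow> w \<in> W \<Longrightarrow> x \<otimes> w \<in> X"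
  shows "closedin T X"
proof -
  have "openin T (carrier G - X)"
  proof (rule coset_invariant_open[OF W])
    fix x w assume x: "x \<in> carrier G - X" and w: "w \<in> W"
    have wc: "w \<in> carrier G" using sg_carrier[OF W(1) w] .
    have "x \<otimes> w \<notin> X"
    proof
      assume "x \<otimes> w \<in> X"
      from inv[OF this sg_inv[OF W(1) w]] show False using x wc by (simp add: m_assoc)
    qed
    then show "x \<otimes> w \<in> carrier G - X" using x wc by simp
  qed blast
  then show ?thesis using X by (simp add: closedin_def topspace_eq_carrier)
qed

lemma open_subgroup_closed: "subgroup W G \<Longrightarrow> openin T W \<Longrightarrow> closedin T W"
  using coset_invariant_closed[of W W] sg_mult[of W] sg_subset[of W] by simp

lemma subgroup_over_open:
  "subgroup W G \<Longrightarrow> openin T W \<Longrightarrow> subgroup A G \<Longrightarrow> W \<subseteq> A \<Longrightarrow> openin T A"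
  using coset_invariant_open[of W A] sg_mult[of A] sg_subset[of A] by blast

lemma compact_coset_cover:
  assumes C: "compactin T C" and W: "subgroup W G" "openin T W"
  obtains R where "finite R" "R \<subseteq> C" "\<And>c. c \<in> C \<Longrightarrow> \<exists>r\<in>R. inv r \<otimes> c \<in> W"
proof -
  let ?V = "\<lambda>r. {y \<in> carrier G. inv r \<otimes> y \<in> W}"
  have Cc: "C \<subseteq> carrier G" using compactin_imp_carrier[OF C] .
  have op: "openin T V" if V: "V \<in> ?V ` C" for V
  proof -
    obtain r where r: "r \<in> C" "V = ?V r" using V by blast
    then have "inv r \<in> carrier G" using Cc by blast
    then show ?thesis unfolding r(2) by (intro openin_preimage continuous_translate W)
  qed
  have cov: "C \<subseteq> \<Union>(?V ` C)"
  proof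
    fix c assume c: "c \<in> C"
    then have "c \<in> ?V c" using Cc sg_one[OF W(1)] by auto
    then show "c \<in> \<Union>(?V ` C)" using c by blast
  qed
  obtain \<F> where F: "finite \<F>" "\<F> \<subseteq> ?V ` C" "C \<subseteq> \<Union>\<F>"
    using C op cov unfolding compactin_def by meson
  obtain R where R: "R \<subseteq> C" "finite R" "\<F> = ?V ` R"
    using finite_subset_image[OF F(1,2)] by blast
  have "\<exists>r\<in>R. inv r \<otimes> c \<in> W" if "c \<in> C" for c using that F(3) R(3) by blast
  then show thesis using that R by blast
qed

lemma compactin_inv_image: "compactin T C \<Longrightarrow> compactin T (m_inv G ` C)"
  using image_compactin continuous_inv by blast

lemma compact_coset_cover_right:
  assumes C: "compactin T C" and W: "subgroup W G" "openin T W"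
  obtains R where "finite R" "R \<subseteq> C" "\<And>c. c \<in> C \<Longrightarrow> \<exists>r\<in>R. c \<otimes> inv r \<in> W"
proof -
  have Cc: "C \<subseteq> carrier G" using compactin_imp_carrier[OF C] .
  obtain R where R: "finite R" "R \<subseteq> m_inv G ` C" "\<And>c. c \<in> m_inv G ` C \<Longrightarrow> \<exists>r\<in>R. inv r \<otimes> c \<in> W"
    using compact_coset_cover[OF compactin_inv_image[OF C] W] by blast
  obtain S where S: "S \<subseteq> C" "finite S" "R = m_inv G ` S" using finite_subset_image[OF R(1,2)] by blast
  have "\<exists>r\<in>S. c \<otimes> inv r \<in> W" if c: "c \<in> C" for c
  proof -
    obtain s where s: "s \<in> S" "inv (inv s) \<otimes> inv c \<in> W" using R(3)[of "inv c"] S(3) c by blast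
    have cc: "s \<in> carrier G" "c \<in> carrier G" using s S(1) c Cc by blast+
    have "inv (s \<otimes> inv c) \<in> W" using sg_inv[OF W(1) s(2)] cc by simp
    then have "c \<otimes> inv s \<in> W" using cc by (simp add: inv_mult_group)
    then show ?thesis using s by blast
  qed
  then show thesis using that S by blast
qed

text \<open>For a subgroup \<open>C\<close> and a subgroup \<open>W\<close>, the largest subgroup of
  \<open>W\<close> normalised by \<open>C\<close>. Arbitrary sets are allowed because
  \<open>C\<close> will also be a finite set of coset representatives or a union of conjugate
  subgroups.\<close>

definition core :: "'a set \<Rightarrow> 'a set \<Rightarrow> 'a set" where
  "core C W = {x \<in> carrier G. \<forall>c\<in>C. conjg c x \<in> W}"

lemma subgroup_core:
  assumes "C \<subseteq> carrier G" "subgroup W G"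
  shows "subgroup (core C W) G"
proof (rule subgroupI)
  show "core C W \<noteq> {}" using assms sg_one[OF assms(2)] by (fastforce simp: core_def)
  show "inv x \<in> core C W" if "x \<in> core C W" for x
    using that assms(1) sg_inv[OF assms(2)] by (auto simp: core_def conjg_inv subset_iff)
  show "x \<otimes> y \<in> core C W" if "x \<in> core C W" "y \<in> core C W" for x y
    using that assms(1) sg_mult[OF assms(2)] by (auto simp: core_def conjg_mult subset_iff)
qed (auto simp: core_def)

lemma subset_normzr_core:
  assumes "subgroup C G"
  shows "C \<subseteq> normzr (core C W)"
proof (rule subgroup_subset_normzrI[OF assms])
  fix a x assume a: "a \<in> C" and x: "x \<in> core C W" "x \<in> carrier G"
  have "conjg c (conjg a x) \<in> W" if c: "c \<in> C" for c
    using x sg_mult[OF assms c a] conjg_conjg[of c a x] sg_carrier[OF assms] a c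
    by (simp add: core_def)
  then show "conjg a x \<in> core C W"
    using x sg_carrier[OF assms a] by (simp add: core_def)
qed

lemma core_subset: "\<one> \<in> C \<Longrightarrow> core C W \<subseteq> W"
  unfolding core_def using one_conjg by fastforce

lemma openin_core_finite:
  assumes "finite R" "R \<subseteq> carrier G" "openin T W"
  shows "openin T (core R W)"
  using assms(1,2)
proof induction
  case empty
  then show ?case using openin_topspace[of T] by (simp add: core_def topspace_eq_carrier)
next
  case (insert r R)
  have "core (insert r R) W = {x \<in> carrier G. conjg r x \<in> W} \<inter> core R W"
    by (auto simp: core_def)
  moreover have "openin T {x \<in> carrier G. conjg r x \<in> W}"
    using insert by (intro openin_preimage continuous_translate assms) auto
  ultimately show ?case using insert by auto
qed

text \<open>Compactness gives finitely many r such that every c in \<open>C\<close> lies in some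
  coset \<open>W r\<close>. Conjugation by c and by r then differ by an element of \<open>W\<close>,
  so only finitely many conjugates are intersected.\<close>

lemma openin_core:
  assumes C: "compactin T C" and W: "subgroup W G" "openin T W"
  shows "openin T (core C W)"
proof -
  obtain R where R: "finite R" "R \<subseteq> C" "\<And>c. c \<in> C \<Longrightarrow> \<exists>r\<in>R. c \<otimes> inv r \<in> W"
    using compact_coset_cover_right[OF C W] by blast
  have Cc: "C \<subseteq> carrier G" using compactin_imp_carrier[OF C] .
  have "core C W = core R W"
  proof
    show "core C W \<subseteq> core R W" using R(2) by (auto simp: core_def)
    show "core R W \<subseteq> core C W"
    proof
      fix x assume x: "x \<in> core R W"
      then have xc: "x \<in> carrier G" by (simp add: core_def)
      have "conjg c x \<in> W" if c: "c \<in> C" for c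
      proof -
        obtain r where r: "r \<in> R" "c \<otimes> inv r \<in> W" using R(3)[OF c] by blast
        then have cc: "r \<in> carrier G" "c \<in> carrier G" using R(2) c Cc by blast+
        have "conjg r x \<in> W" using x r by (simp add: core_def)
        then have "conjg (c \<otimes> inv r) (conjg r x) \<in> W" using conjg_in_subgroup[OF W(1) r(2)] by blast
        then show ?thesis using cc xc by (simp add: conjg_conjg m_assoc)
      qed
      then show "x \<in> core C W" using xc by (simp add: core_def)
    qed
  qed
  then show ?thesis using openin_core_finite[OF R(1) _ W(2), of] R(2) Cc by auto
qed

lemma closedin_core:
  assumes "closedin T W" "C \<noteq> {}" "C \<subseteq> carrier G"
  shows "closedin T (core C W)"
proof -
  have "core C W = \<Inter>((\<lambda>c. {x \<in> carrier G. conjg c x \<in> W}) ` C)"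
    using assms(2) unfolding core_def by auto
  moreover have "closedin T (\<Inter>((\<lambda>c. {x \<in> carrier G. conjg c x \<in> W}) ` C))"
  proof (rule closedin_Inter)
    show "(\<lambda>c. {x \<in> carrier G. conjg c x \<in> W}) ` C \<noteq> {}" using assms(2) by blast
    fix S assume "S \<in> (\<lambda>c. {x \<in> carrier G. conjg c x \<in> W}) ` C"
    then obtain c where c: "c \<in> C" "S = {x \<in> carrier G. conjg c x \<in> W}" by blast
    then have "c \<in> carrier G" using assms(3) by blast
    then show "closedin T S" unfolding c(2) by (intro closedin_preimage continuous_translate(3) assms(1))
  qed
  ultimately show ?thesis by simp
qed

lemma compactin_set_mult:
  assumes "compactin T A" "compactin T B"
  shows "compactin T (A <#> B)"
proof -
  have "compactin T ((\<lambda>(x, y). x \<otimes> y) ` (A \<times> B))"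
    by (rule image_compactin[OF _ continuous_mult]) (use assms compactin_Times in blast)
  moreover have "(\<lambda>(x, y). x \<otimes> y) ` (A \<times> B) = A <#> B"
    unfolding set_mult_def by auto
  ultimately show ?thesis by simp
qed

lemma compactin_conjg_set:
  assumes "compactin T A" "compactin T B"
  shows "compactin T {conjg a b | a b. a \<in> A \<and> b \<in> B}"
proof -
  have "continuous_map (prod_topology T T) T (\<lambda>z. conjg (fst z) (snd z))"
    by (intro continuous_map_conjg continuous_map_fst continuous_map_snd)
  moreover have "compactin (prod_topology T T) (A \<times> B)" using assms compactin_Times by blast
  ultimately have "compactin T ((\<lambda>z. conjg (fst z) (snd z)) ` (A \<times> B))"
    using image_compactin by blast
  moreover have "(\<lambda>z. conjg (fst z) (snd z)) ` (A \<times> B) = {conjg a b | a b. a \<in> A \<and> b \<in> B}"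
    by force
  ultimately show ?thesis by simp
qed

lemma compactin_conjg_image:
  "a \<in> carrier G \<Longrightarrow> compactin T B \<Longrightarrow> compactin T (conjg a ` B)"
  using image_compactin continuous_translate(3) by blast

lemma openin_conjg_image:
  assumes "a \<in> carrier G" "openin T B"
  shows "openin T (conjg a ` B)"
proof -
  have "conjg a ` B = {x \<in> carrier G. conjg (inv a) x \<in> B}"
    using mem_conjg_image[OF assms(1) openin_imp_carrier[OF assms(2)]] by blast
  then show ?thesis
    using openin_preimage[OF continuous_translate(3) assms(2), of "inv a"] assms(1) by simp
qed

text \<open>The configuration used in the proof of the Thompson--Wielandt theorem.\<close>

lemma open_subnormal_in_conjugates:
  assumes U: "subgroup U G" "openin T U" "compactin T U" and C: "compactin T C"
  obtains V where "subgroup V G" "openin T V" "V \<subseteq> U" "U \<subseteq> normzr V"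
    "\<And>g. g \<in> C \<Longrightarrow> \<exists>B. subgroup B G \<and> V \<subseteq> B \<and> B \<subseteq> conjg g ` U \<and>
        conjg g ` U \<subseteq> normzr B \<and> B \<subseteq> normzr V"
proof -
  have Uc: "U \<subseteq> carrier G" using sg_subset[OF U(1)] .
  \<comment> \<open>\<open>D\<close> is compact, contains \<open>\<one>\<close> and
    \<open>C\<close>, and is stable under left multiplication by \<open>U\<close>. Therefore the
    family of all \<open>g U g^-1\<close> with g in \<open>D\<close>, and whatever is built from it,
    is invariant under conjugation by \<open>U\<close>.\<close>
  define D where "D = U <#> insert \<one> C"
  have "compactin T {\<one>}" by (simp add: topspace_eq_carrier)
  then have "compactin T (insert \<one> C)" using compactin_Un[OF _ C] by fastforce
  then have D: "compactin T D" unfolding D_def by (rule compactin_set_mult[OF U(3)])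
  have Dc: "D \<subseteq> carrier G" using compactin_imp_carrier[OF D] .
  have uD: "u \<otimes> g \<in> D" if "u \<in> U" "g \<in> D" for u g
  proof -
    obtain v c where vc: "v \<in> U" "c \<in> insert \<one> C" "g = v \<otimes> c" using \<open>g \<in> D\<close> unfolding D_def set_mult_def by blast
    have "c \<in> carrier G" using vc(2) compactin_imp_carrier[OF C] by blast
    then have "u \<otimes> g = (u \<otimes> v) \<otimes> c" using vc \<open>u \<in> U\<close> Uc by (simp add: m_assoc subset_iff)
    then show ?thesis unfolding D_def using set_multI[OF sg_mult[OF U(1) \<open>u \<in> U\<close> vc(1)] vc(2)] by simp
  qed
  have oneD: "\<one> \<in> D" using set_multI[OF sg_one[OF U(1)], of \<one> "insert \<one> C"] unfolding D_def by simp
  have CD: "C \<subseteq> D"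
  proof
    fix c assume c: "c \<in> C"
    then have "\<one> \<otimes> c \<in> D" unfolding D_def using set_multI[OF sg_one[OF U(1)]] by blast
    then show "c \<in> D" using c compactin_imp_carrier[OF C] by auto
  qed
  \<comment> \<open>\<open>W\<close> is the intersection of the conjugates \<open>g U g^-1\<close>
    with g in \<open>D\<close>, open because \<open>D\<close> is compact.\<close>
  define W where "W = core (m_inv G ` D) U"
  have W: "subgroup W G" "openin T W"
    unfolding W_def
    by (rule subgroup_core[OF _ U(1)], use Dc in auto)
      (rule openin_core[OF compactin_inv_image[OF D] U(1,2)])
  have Wconj: "W \<subseteq> conjg g ` U" if "g \<in> D" for g
  proof
    fix x assume "x \<in> W"
    then have "x \<in> carrier G" "conjg (inv g) x \<in> U" using that unfolding W_def core_def by blast+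
    then show "x \<in> conjg g ` U" using mem_conjg_image[OF _ Uc, of g] Dc that by blast
  qed
  have UW: "U \<subseteq> normzr W"
  proof (rule subgroup_subset_normzrI[OF U(1)])
    fix u x assume u: "u \<in> U" and x: "x \<in> W" "x \<in> carrier G"
    have "conjg (inv g) (conjg u x) \<in> U" if g: "g \<in> D" for g
    proof -
      have gc: "g \<in> carrier G" "u \<in> carrier G" using g Dc u Uc by blast+
      have "inv u \<otimes> g \<in> D" using uD[OF sg_inv[OF U(1) u] g] .
      then have "conjg (inv (inv u \<otimes> g)) x \<in> U" using x(1) unfolding W_def core_def by blast
      moreover have "conjg (inv (inv u \<otimes> g)) x = conjg (inv g) (conjg u x)"
        using gc x(2) by (simp add: conjg_conjg inv_mult_group)
      ultimately show ?thesis by simp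
    qed
    then show "conjg u x \<in> W" using u Uc x(2) unfolding W_def core_def by auto
  qed
  define E where "E = {conjg g u | g u. g \<in> D \<and> u \<in> U}"
  have E: "compactin T E" unfolding E_def by (rule compactin_conjg_set[OF D U(3)])
  have Ec: "E \<subseteq> carrier G" using compactin_imp_carrier[OF E] .
  \<comment> \<open>\<open>B g\<close> is the largest subgroup of \<open>W\<close> that is normal in
    \<open>g U g^-1\<close>, and \<open>V\<close> is the intersection of all \<open>B g\<close> with
    g in \<open>D\<close>.\<close>
  define V where "V = core E W"
  define B where "B g = core (conjg g ` U) W" for g
  have V: "subgroup V G" "openin T V"
    unfolding V_def by (rule subgroup_core[OF Ec W(1)], rule openin_core[OF E W])
  have Bsub: "subgroup (B g) G" if "g \<in> D" for g
    unfolding B_def by (rule subgroup_core[OF _ W(1)]) (use Uc Dc that in auto)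
  have VB: "V \<subseteq> B g" if "g \<in> D" for g
    using that unfolding V_def B_def core_def E_def by blast
  have xV: "x \<in> V" if "x \<in> carrier G" "\<And>g. g \<in> D \<Longrightarrow> x \<in> B g" for x
    using that unfolding V_def B_def core_def E_def by blast
  have BW: "B g \<subseteq> W" if "g \<in> D" for g
  proof -
    have "\<one> \<in> conjg g ` U" using sg_one[OF U(1)] conjg_one[of g] that Dc by force
    then show ?thesis unfolding B_def by (rule core_subset)
  qed
  have BN: "conjg g ` U \<subseteq> normzr (B g)" if "g \<in> D" for g
    unfolding B_def by (rule subset_normzr_core[OF subgroup_conjg[OF _ U(1)]]) (use Dc that in blast)
  have VU: "V \<subseteq> U"
  proof
    fix x assume "x \<in> V"
    then have "x \<in> conjg \<one> ` U" using VB[OF oneD] BW[OF oneD] Wconj[OF oneD] by blast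
    then show "x \<in> U" using Uc by auto
  qed
  have UV: "U \<subseteq> normzr V"
  proof (rule subgroup_subset_normzrI[OF U(1)])
    fix u x assume u: "u \<in> U" and x: "x \<in> V" "x \<in> carrier G"
    have uc: "u \<in> carrier G" using u Uc by blast
    have "conjg e (conjg u x) \<in> W" if e: "e \<in> E" for e
    proof -
      obtain g v where gv: "g \<in> D" "v \<in> U" "e = conjg g v" using e unfolding E_def by blast
      have c: "g \<in> carrier G" "v \<in> carrier G" using gv Dc Uc by blast+
      have "inv u \<otimes> g \<in> D" using uD[OF sg_inv[OF U(1) u] gv(1)] .
      then have "conjg (inv u \<otimes> g) v \<in> E" using gv(2) unfolding E_def by blast
      then have "conjg (conjg (inv u \<otimes> g) v) x \<in> W" using x(1) unfolding V_def core_def by blast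
      then have "conjg u (conjg (conjg (inv u \<otimes> g) v) x) \<in> W"
        using UW u normzrD[of u W "conjg (conjg (inv u \<otimes> g) v) x"] c uc x(2) by auto
      moreover have "conjg u (conjg (conjg (inv u \<otimes> g) v) x) = conjg e (conjg u x)"
        using c uc x(2) by (simp add: gv(3) conjg_def word_simps)
      ultimately show ?thesis by simp
    qed
    then show "conjg u x \<in> V" using uc x(2) unfolding V_def core_def by auto
  qed
  \<comment> \<open>\<open>B g\<close> lies in \<open>W\<close>, hence in each
    \<open>h U h^-1\<close>, which normalises \<open>B h\<close>; so it normalises the intersection
    \<open>V\<close>.\<close>
  have BV: "B g \<subseteq> normzr V" if g: "g \<in> D" for g
  proof (rule subgroup_subset_normzrI[OF Bsub[OF g]])
    fix b x assume b: "b \<in> B g" and x: "x \<in> V" "x \<in> carrier G"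
    have bc: "b \<in> carrier G" using sg_carrier[OF Bsub[OF g] b] .
    show "conjg b x \<in> V"
    proof (rule xV)
      show "conjg b x \<in> carrier G" using bc x by simp
      fix h assume h: "h \<in> D"
      have "b \<in> normzr (B h)" using b BW[OF g] Wconj[OF h] BN[OF h] by blast
      moreover have "x \<in> B h" using VB[OF h] x by blast
      ultimately show "conjg b x \<in> B h" using normzrD x(2) by blast
    qed
  qed
  show thesis
  proof (rule that[OF V VU UV])
    fix g assume "g \<in> C"
    then have g: "g \<in> D" using CD by blast
    have "B g \<subseteq> conjg g ` U" using BW[OF g] Wconj[OF g] by blast
    then show "\<exists>B. subgroup B G \<and> V \<subseteq> B \<and> B \<subseteq> conjg g ` U \<and> conjg g ` U \<subseteq> normzr B \<and> B \<subseteq> normzr V"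
      using Bsub[OF g] VB[OF g] BN[OF g] BV[OF g] by blast
  qed
qed

end

section \<open>Compact open subgroups of tdlc groups\<close>

locale tdlc = topological_group +
  assumes Hausdorff: "Hausdorff_space T"
    and locally_compact: "locally_compact_space T"
    and totally_disconnected: "totally_disconnected_space T"
begin

lemma compactin_imp_closedin_T: "compactin T K \<Longrightarrow> closedin T K"
  by (rule compactin_imp_closedin[OF Hausdorff])

text \<open>In a locally compact Hausdorff space a compact component, here a single point, has
  clopen neighbourhoods inside every open set around it. Those inside \<open>W\<close> are compact
  because \<open>W\<close> lies in the compact set \<open>K\<close>.\<close>

lemma compact_clopen_neighbourhood:
  assumes A: "openin T A" "x \<in> A"
  obtains C where "openin T C" "compactin T C" "x \<in> C" "C \<subseteq> A"
proof -
  have xT: "x \<in> topspace T" using A openin_subset by blast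
  obtain W K where WK: "openin T W" "compactin T K" "x \<in> W" "W \<subseteq> K"
    using locally_compact xT unfolding locally_compact_space_def by blast
  have comp: "connected_component_of_set T x = {x}"
  proof -
    obtain a where "connected_component_of_set T x \<subseteq> {a}"
      using totally_disconnected connectedin_connected_component_of
      unfolding totally_disconnected_space_def by meson
    moreover have "x \<in> connected_component_of_set T x"
      using xT by (simp add: connected_component_of_refl)
    ultimately show ?thesis by blast
  qed
  have c: "{x} \<in> connected_components_of T"
    using connected_component_in_connected_components_of[of T x] xT comp by simp
  have "openin T (A \<inter> W)" using A WK by blast
  moreover have "compactin T {x}" using xT by simp
  moreover have "{x} \<subseteq> A \<inter> W" using A WK by blast
  ultimately obtain C D where CD: "openin T C" "openin T D" "disjnt C D" "C \<union> D = topspace T"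
    "{x} \<subseteq> C" "C \<subseteq> A \<inter> W"
    using wilder_locally_compact_component_thm[OF locally_compact Hausdorff c] by blast
  have "C = topspace T - D" using CD(3,4) openin_subset[OF CD(1)] by (auto simp: disjnt_iff)
  then have "closedin T C" using CD(2) by blast
  then have "compactin T C" using closed_compactin[OF WK(2)] CD(6) WK(4) by blast
  then show thesis using that CD by blast
qed

text \<open>For a compact open \<open>C\<close> containing \<open>\<one>\<close>, the elements x
  with \<open>C x \<subseteq> C\<close> form a submonoid \<open>N\<close> contained in
  \<open>C\<close>, open because \<open>C\<close> is compact and open. \<open>U\<close> consists of
  the x that lie in \<open>N\<close> together with their inverse.\<close>

lemma van_Dantzig:
  assumes A: "openin T A" "\<one> \<in> A"
  obtains U where "subgroup U G" "openin T U" "compactin T U" "U \<subseteq> A"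
proof -
  obtain C where C: "openin T C" "compactin T C" "\<one> \<in> C" "C \<subseteq> A"
    using compact_clopen_neighbourhood[OF A] by blast
  have Cc: "C \<subseteq> carrier G" using openin_imp_carrier[OF C(1)] .
  define N where "N = {x \<in> carrier G. \<forall>c\<in>C. c \<otimes> x \<in> C}"
  have openN: "openin T N"
  proof -
    let ?P = "prod_topology (subtopology T C) T"
    \<comment> \<open>A tube argument: the complement of \<open>N\<close> is the projection of the
      closed set \<open>?Z\<close> along the compact factor \<open>C\<close>, hence closed.\<close>
    let ?Z = "{z \<in> topspace ?P. fst z \<otimes> snd z \<in> topspace T - C}"
    have "continuous_map ?P T fst"
      using continuous_map_into_fulltopology continuous_map_fst by blast
    then have "continuous_map ?P T (\<lambda>z. fst z \<otimes> snd z)"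
      by (intro continuous_map_mult continuous_map_snd)
    then have "closedin ?P ?Z"
      by (rule closedin_continuous_map_preimage) (use C(1) in blast)
    moreover have "closed_map ?P T snd"
      using closed_map_snd compact_space_subtopology[OF C(2)] by blast
    ultimately have cl: "closedin T (snd ` ?Z)" unfolding closed_map_def by blast
    have "N = topspace T - snd ` ?Z"
    proof
      show "N \<subseteq> topspace T - snd ` ?Z"
        by (auto simp: N_def topspace_eq_carrier)
      show "topspace T - snd ` ?Z \<subseteq> N"
      proof
        fix x assume x: "x \<in> topspace T - snd ` ?Z"
        then have xc: "x \<in> carrier G" by (simp add: topspace_eq_carrier)
        have "c \<otimes> x \<in> C" if c: "c \<in> C" for c
        proof (rule ccontr)
          assume "c \<otimes> x \<notin> C"
          then have "(c, x) \<in> ?Z" using c xc Cc by (auto simp: topspace_eq_carrier)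
          then have "x \<in> snd ` ?Z" by force
          then show False using x by blast
        qed
        then show "x \<in> N" using xc by (simp add: N_def)
      qed
    qed
    then show ?thesis using cl by blast
  qed
  define U where "U = N \<inter> {x \<in> carrier G. inv x \<in> N}"
  have Nmult: "x \<otimes> y \<in> N" if "x \<in> N" "y \<in> N" for x y
    using that Cc by (auto simp: N_def subset_iff simp flip: m_assoc)
  have U: "subgroup U G"
  proof (rule subgroupI)
    show "U \<subseteq> carrier G" by (auto simp: U_def)
    have "\<one> \<in> U" using Cc by (auto simp: U_def N_def)
    then show "U \<noteq> {}" by blast
    show "inv x \<in> U" if "x \<in> U" for x using that by (simp add: U_def)
    show "x \<otimes> y \<in> U" if "x \<in> U" "y \<in> U" for x y
      using that Nmult by (simp add: U_def inv_mult_group)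
  qed
  have openU: "openin T U"
    unfolding U_def using openin_preimage[OF continuous_inv openN] openN by blast
  have "N \<subseteq> C" using C(3) unfolding N_def by force
  then have UC: "U \<subseteq> C" by (auto simp: U_def)
  have "compactin T U"
    using closed_compactin[OF C(2) UC open_subgroup_closed[OF U openU]] .
  then show thesis using that U openU UC C(4) by blast
qed

lemma compact_open_subgroup_exists:
  obtains U where "subgroup U G" "openin T U" "compactin T U"
proof -
  have "openin T (carrier G)" using openin_topspace[of T] by (simp add: topspace_eq_carrier)
  from van_Dantzig[OF this one_closed] show thesis using that by blast
qed

lemma compact_open_subgroup_avoiding:
  assumes W: "subgroup W G" "openin T W" and F: "finite F" "\<one> \<notin> F"
  obtains U where "subgroup U G" "openin T U" "compactin T U" "U \<subseteq> W" "U \<inter> F = {}"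
proof -
  have "closedin T (F \<inter> carrier G)"
    using closedin_Hausdorff_finite[OF Hausdorff] F by (simp add: topspace_eq_carrier)
  then have "openin T (W - (F \<inter> carrier G))" using W(2) openin_diff by blast
  moreover have "\<one> \<in> W - (F \<inter> carrier G)" using sg_one[OF W(1)] F by blast
  ultimately obtain U where U: "subgroup U G" "openin T U" "compactin T U" "U \<subseteq> W - (F \<inter> carrier G)"
    using van_Dantzig by metis
  then show thesis using that[of U] sg_subset[OF U(1)] by blast
qed

end

section \<open>Cocompact normal subgroups and the quasi-centre\<close>

context group
begin

lemma carrier_subgroup: "subgroup (carrier G) G"
  by (rule subgroupI) auto

lemma normal_iff_normzr: "N \<lhd> G \<longleftrightarrow> subgroup N G \<and> carrier G \<subseteq> normzr N"
proof
  assume N: "N \<lhd> G"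
  then have "subgroup N G" by (rule normal_imp_subgroup)
  moreover have "carrier G \<subseteq> normzr N"
    by (rule subgroup_subset_normzrI[OF carrier_subgroup])
      (use N in \<open>auto simp: normal_inv_iff conjg_def\<close>)
  ultimately show "subgroup N G \<and> carrier G \<subseteq> normzr N" by blast
next
  assume N: "subgroup N G \<and> carrier G \<subseteq> normzr N"
  then have "x \<otimes> h \<otimes> inv x \<in> N" if "x \<in> carrier G" "h \<in> N" for x h
    using that normzrD[of x N h] sg_carrier[of N h] unfolding conjg_def by blast
  then show "N \<lhd> G" using N unfolding normal_inv_iff by blast
qed

text \<open>Schreier's lemma for a set \<open>R\<close> of representatives that may contain
  repetitions. Reading a word in \<open>C\<close> from the left, each prefix stays of the form h r
  with h generated by \<open>Y\<close> and r in \<open>R\<close>. The extra letter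
  \<open>\<one>\<close> puts \<open>R \<inter> J\<close> into \<open>Y\<close>, which takes care of
  the final r when the whole word lies in \<open>J\<close>.\<close>

lemma schreier_generators:
  assumes C: "C \<subseteq> carrier G" "generate G C = carrier G"
    and J: "subgroup J G" and R: "R \<subseteq> carrier G" "\<one> \<in> R"
    and cov: "\<And>g. g \<in> carrier G \<Longrightarrow> \<exists>j\<in>J. \<exists>r\<in>R. g = j \<otimes> r"
  defines "Y \<equiv> {y \<in> J. \<exists>r\<in>R. \<exists>c\<in>insert \<one> (C \<union> m_inv G ` C). \<exists>s\<in>R. y = r \<otimes> c \<otimes> inv s}"
  shows "J \<subseteq> generate G Y"
proof -
  have YJ: "Y \<subseteq> J" unfolding Y_def by blast
  then have Yc: "Y \<subseteq> carrier G" using sg_subset[OF J] by blast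
  have gY: "subgroup (generate G Y) G" by (rule generate_is_subgroup[OF Yc])
  define P where "P g \<longleftrightarrow> (\<exists>h\<in>generate G Y. \<exists>r\<in>R. g = h \<otimes> r)" for g
  have step: "P (g \<otimes> c)" if g: "P g" and c: "c \<in> C \<union> m_inv G ` C" for g c
  proof -
    obtain h r where hr: "h \<in> generate G Y" "r \<in> R" "g = h \<otimes> r" using g unfolding P_def by blast
    have cc: "c \<in> carrier G" "r \<in> carrier G" "h \<in> carrier G"
      using c C(1) hr R(1) sg_carrier[OF gY] by auto
    then have "r \<otimes> c \<in> carrier G" by simp
    from cov[OF this] obtain j s where js: "j \<in> J" "s \<in> R" "r \<otimes> c = j \<otimes> s" by blast
    have jsc: "j \<in> carrier G" "s \<in> carrier G" using js sg_carrier[OF J] R(1) by blast+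
    have "j = r \<otimes> c \<otimes> inv s" using js(3) jsc cc by (simp add: m_assoc)
    then have "j \<in> Y" unfolding Y_def using js hr(2) c by blast
    then have "h \<otimes> j \<in> generate G Y" using sg_mult[OF gY hr(1)] generate.incl[of j Y G] by blast
    moreover have "g \<otimes> c = (h \<otimes> j) \<otimes> s"
      using js(3) jsc cc by (simp add: hr(3) m_assoc)
    ultimately show ?thesis unfolding P_def using js(2) by blast
  qed
  have one: "P \<one>" unfolding P_def using sg_one[OF gY] R(2) by force
  have "P g \<Longrightarrow> P (g \<otimes> x)" if "x \<in> generate G C" "g \<in> carrier G" for x g
    using that
  proof (induction arbitrary: g)
    case one
    then show ?case by simp
  next
    case (incl c)
    then show ?case using step[of g c] by blast
  next
    case (inv c)
    then show ?case using step[of g "inv c"] by blast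
  next
    case (eng x y)
    then have xc: "x \<in> carrier G" "y \<in> carrier G" using C by auto
    have "P (g \<otimes> x)" using eng by blast
    then have "P (g \<otimes> x \<otimes> y)" using eng xc by simp
    then show ?case using xc eng.prems by (simp add: m_assoc)
  qed
  then have all: "P g" if "g \<in> carrier G" for g using that one C(2) by force
  show ?thesis
  proof
    fix j assume j: "j \<in> J"
    then have jc: "j \<in> carrier G" using sg_carrier[OF J] by blast
    obtain h r where hr: "h \<in> generate G Y" "r \<in> R" "j = h \<otimes> r" using all[OF jc] unfolding P_def by blast
    have c: "h \<in> carrier G" "r \<in> carrier G" using hr R(1) sg_carrier[OF gY] by blast+
    have hJ: "h \<in> J" using hr(1) generate_subgroup_incl[OF YJ J] by blast
    have "r = inv h \<otimes> j" using hr(3) c by simp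
    then have "r \<in> J" using sg_mult[OF J sg_inv[OF J hJ] j] by simp
    moreover have "r = r \<otimes> \<one> \<otimes> inv \<one>" using c by simp
    ultimately have "r \<in> Y" unfolding Y_def using hr(2) R(2) by blast
    then show "j \<in> generate G Y" using hr(1,3) sg_mult[OF gY] generate.incl[of r Y G] by blast
  qed
qed

end

section \<open>Closures, cocompact subgroups and generators of finite-index subgroups\<close>

context topological_group
begin

lemma closure_of_image_subset:
  assumes "continuous_map T T f" "x \<in> T closure_of A"
  shows "f x \<in> T closure_of (f ` A)"
  using continuous_map_image_closure_subset[OF assms(1)] assms(2) by blast

lemma subgroup_closure_of:
  assumes "subgroup D G"
  shows "subgroup (T closure_of D) G"
proof (rule subgroupI)
  have Dc: "D \<subseteq> topspace T" using sg_subset[OF assms] topspace_eq_carrier by simp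
  show "T closure_of D \<subseteq> carrier G" using closure_of_subset_topspace topspace_eq_carrier by metis
  show "T closure_of D \<noteq> {}" using closure_of_subset[OF Dc] sg_one[OF assms] by blast
  show "inv x \<in> T closure_of D" if "x \<in> T closure_of D" for x
  proof -
    have "m_inv G ` D \<subseteq> D" using sg_inv[OF assms] by blast
    then show ?thesis using closure_of_image_subset[OF continuous_inv that] closure_of_mono by blast
  qed
  show "x \<otimes> y \<in> T closure_of D" if "x \<in> T closure_of D" "y \<in> T closure_of D" for x y
  proof -
    have "(x, y) \<in> prod_topology T T closure_of (D \<times> D)" using that by (simp add: closure_of_Times)
    then have "(\<lambda>(x, y). x \<otimes> y) (x, y) \<in> T closure_of ((\<lambda>(x, y). x \<otimes> y) ` (D \<times> D))"
      using continuous_map_image_closure_subset[OF continuous_mult] by blast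
    moreover have "(\<lambda>(x, y). x \<otimes> y) ` (D \<times> D) \<subseteq> D" using sg_mult[OF assms] by auto
    ultimately show ?thesis using closure_of_mono by fastforce
  qed
qed

lemma normal_closure_of:
  assumes "D \<lhd> G"
  shows "T closure_of D \<lhd> G"
proof -
  have D: "subgroup D G" "carrier G \<subseteq> normzr D" using assms unfolding normal_iff_normzr by blast+
  have "carrier G \<subseteq> normzr (T closure_of D)"
  proof (rule subgroup_subset_normzrI[OF carrier_subgroup])
    fix a x assume a: "a \<in> carrier G" and x: "x \<in> T closure_of D"
    have "conjg a ` D \<subseteq> D" using D normzrD[of a D] a sg_carrier[OF D(1)] by blast
    then show "conjg a x \<in> T closure_of D"
      using closure_of_image_subset[OF continuous_translate(3)[OF a] x] closure_of_mono by blast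
  qed
  then show ?thesis using subgroup_closure_of[OF D(1)] unfolding normal_iff_normzr by blast
qed

text \<open>The sets of cosets of \<open>N\<close> that meet \<open>r U\<close> are open in the
  coset space and cover it, so finitely many of them do.\<close>

lemma cocompact_cover:
  assumes N: "subgroup N G" "cocompact G T N" and U: "subgroup U G" "openin T U"
  obtains R where "finite R" "R \<subseteq> carrier G"
    "\<And>g. g \<in> carrier G \<Longrightarrow> \<exists>n\<in>N. \<exists>r\<in>R. \<exists>u\<in>U. g = n \<otimes> (r \<otimes> u)"
proof -
  have Nc: "N \<subseteq> carrier G" and Uc: "U \<subseteq> carrier G" using sg_subset[OF N(1)] sg_subset[OF U(1)] .
  let ?Q = "coset_topology G T N"
  have top: "topspace ?Q = rcosets N"
    by (rule topspace_coset_topology[OF topological_group_axioms N(1)])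
  define A where "A r = {X \<in> rcosets N. \<exists>u\<in>U. r \<otimes> u \<in> X}" for r
  have UA: "\<Union>(A r) = {x. \<exists>n\<in>N. \<exists>u\<in>U. x = n \<otimes> (r \<otimes> u)}" if r: "r \<in> carrier G" for r
  proof (intro subset_antisym subsetI)
    fix x assume "x \<in> \<Union>(A r)"
    then obtain X u where X: "X \<in> rcosets N" "u \<in> U" "r \<otimes> u \<in> X" "x \<in> X" unfolding A_def by blast
    obtain y where y: "y \<in> carrier G" "X = N #> y" using X(1) unfolding RCOSETS_def by blast
    have "X = N #> (r \<otimes> u)" using repr_independence[OF _ y(1) N(1)] X(3) y(2) by blast
    then show "x \<in> {x. \<exists>n\<in>N. \<exists>u\<in>U. x = n \<otimes> (r \<otimes> u)}"
      using X(2,4) unfolding r_coset_def by blast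
  next
    fix x assume "x \<in> {x. \<exists>n\<in>N. \<exists>u\<in>U. x = n \<otimes> (r \<otimes> u)}"
    then obtain n u where nu: "n \<in> N" "u \<in> U" "x = n \<otimes> (r \<otimes> u)" by blast
    have c: "r \<otimes> u \<in> carrier G" using r nu Uc by blast
    then have "N #> (r \<otimes> u) \<in> A r"
      unfolding A_def RCOSETS_def using rcos_self[OF c N(1)] nu(2) by blast
    moreover have "x \<in> N #> (r \<otimes> u)" using nu unfolding r_coset_def by blast
    ultimately show "x \<in> \<Union>(A r)" by blast
  qed
  have "openin ?Q (A r)" if r: "r \<in> carrier G" for r
  proof -
    have "openin T (\<Union>(A r))"
    proof (rule coset_invariant_open[OF U])
      show "\<Union>(A r) \<subseteq> carrier G" using Nc Uc r unfolding UA[OF r] by auto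
      fix x w assume "x \<in> \<Union>(A r)" and w: "w \<in> U"
      then obtain n u where nu: "n \<in> N" "u \<in> U" "x = n \<otimes> (r \<otimes> u)" unfolding UA[OF r] by blast
      have c: "n \<in> carrier G" "u \<in> carrier G" "w \<in> carrier G" using nu w Nc Uc by blast+
      have "x \<otimes> w = n \<otimes> (r \<otimes> (u \<otimes> w))" using nu c r by (simp add: m_assoc)
      then show "x \<otimes> w \<in> \<Union>(A r)" unfolding UA[OF r] using nu(1) sg_mult[OF U(1) nu(2) w] by blast
    qed
    moreover have "A r \<subseteq> rcosets N" unfolding A_def by blast
    ultimately show ?thesis using openin_coset_topology[OF is_group N(1)] by blast
  qed
  then have op: "\<forall>V\<in>A ` carrier G. openin ?Q V" by blast
  moreover have "topspace ?Q \<subseteq> \<Union>(A ` carrier G)"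
  proof
    fix X assume "X \<in> topspace ?Q"
    then have X: "X \<in> rcosets N" using top by simp
    then obtain r where r: "r \<in> carrier G" "X = N #> r" unfolding RCOSETS_def by blast
    have "r \<otimes> \<one> \<in> X" using rcos_self[OF r(1) N(1)] r by simp
    then have "X \<in> A r" unfolding A_def using X sg_one[OF U(1)] by blast
    then show "X \<in> \<Union>(A ` carrier G)" using r(1) by blast
  qed
  moreover have "compactin ?Q (topspace ?Q)"
    using N(2) unfolding cocompact_def compact_space_def .
  ultimately obtain \<F> where F: "finite \<F>" "\<F> \<subseteq> A ` carrier G" "topspace ?Q \<subseteq> \<Union>\<F>"
    unfolding compactin_def by meson
  obtain R where R: "R \<subseteq> carrier G" "finite R" "\<F> = A ` R" using finite_subset_image[OF F(1,2)] by blast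
  show thesis
  proof (rule that[OF R(2,1)])
    fix g assume g: "g \<in> carrier G"
    then have "N #> g \<in> topspace ?Q" unfolding top RCOSETS_def by blast
    then obtain r where r: "r \<in> R" "N #> g \<in> A r" using F(3) R(3) by blast
    then have "g \<in> \<Union>(A r)" using rcos_self[OF g N(1)] by blast
    then show "\<exists>n\<in>N. \<exists>r\<in>R. \<exists>u\<in>U. g = n \<otimes> (r \<otimes> u)" using UA r(1) R(1) by blast
  qed
qed

text \<open>The Schreier generators of \<open>J\<close> lie in a compact set, hence in finitely many
  cosets of \<open>U\<close>, and each of these contains an element of \<open>D\<close>. It is
  applied with \<open>J = U <#> D\<close> for a normal subgroup \<open>D\<close>, where it matters
  that the new generators come from \<open>D\<close>, and with \<open>D = J = H\<close>.\<close>

lemma finite_index_generators: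
  assumes cg: "compactly_generated G T"
    and J: "subgroup J G" "openin T J" and R: "finite R" "R \<subseteq> carrier G"
    and cov: "\<And>g. g \<in> carrier G \<Longrightarrow> \<exists>r\<in>R. \<exists>j\<in>J. g = r \<otimes> j"
    and U: "subgroup U G" "openin T U" "U \<subseteq> J"
    and D: "D \<subseteq> J" "\<And>j. j \<in> J \<Longrightarrow> \<exists>d\<in>D. \<exists>u\<in>U. j = d \<otimes> u"
  obtains F where "finite F" "F \<subseteq> D" "generate G (U \<union> F) = J"
proof -
  have Jc: "J \<subseteq> carrier G" using sg_subset[OF J(1)] .
  obtain C where C: "compactin T C" "generate G C = carrier G"
    using cg unfolding compactly_generated_def by blast
  have Cc: "C \<subseteq> carrier G" using compactin_imp_carrier[OF C(1)] .
  define S where "S = insert \<one> (m_inv G ` R)"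
  have S: "S \<subseteq> carrier G" "\<one> \<in> S" "finite S" using R unfolding S_def by auto
  have cov': "\<exists>j\<in>J. \<exists>s\<in>S. g = j \<otimes> s" if g: "g \<in> carrier G" for g
  proof -
    obtain r j where rj: "r \<in> R" "j \<in> J" "inv g = r \<otimes> j" using cov[of "inv g"] g by blast
    have c: "r \<in> carrier G" "j \<in> carrier G" using rj R(2) Jc by blast+
    have "g = inv (r \<otimes> j)" using rj(3) g by (metis inv_inv)
    then have "g = inv j \<otimes> inv r" using c by (simp add: inv_mult_group)
    then show ?thesis using sg_inv[OF J(1) rj(2)] rj(1) unfolding S_def by blast
  qed
  define E where "E = insert \<one> (C \<union> m_inv G ` C)"
  define Y where "Y = {y \<in> J. \<exists>r\<in>S. \<exists>c\<in>E. \<exists>s\<in>S. y = r \<otimes> c \<otimes> inv s}"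
  have JY: "J \<subseteq> generate G Y"
    unfolding Y_def E_def by (rule schreier_generators[OF Cc C(2) J(1) S(1,2) cov'])
  have cS: "compactin T S" "compactin T (m_inv G ` S)"
    using S finite_imp_compactin[of S T] compactin_inv_image[of S] by (simp_all add: topspace_eq_carrier)
  have "compactin T {\<one>}" by (simp add: topspace_eq_carrier)
  then have "compactin T E"
    unfolding E_def using compactin_Un[OF _ compactin_Un[OF C(1) compactin_inv_image[OF C(1)]], of "{\<one>}"]
    by simp
  then have "compactin T (S <#> E <#> m_inv G ` S)"
    by (rule compactin_set_mult[OF compactin_set_mult[OF cS(1)] cS(2)])
  then have Q: "compactin T ((S <#> E <#> m_inv G ` S) \<inter> J)"
    using compact_Int_closedin open_subgroup_closed[OF J] by blast
  obtain P where P: "finite P" "P \<subseteq> (S <#> E <#> m_inv G ` S) \<inter> J"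
    "\<And>c. c \<in> (S <#> E <#> m_inv G ` S) \<inter> J \<Longrightarrow> \<exists>r\<in>P. inv r \<otimes> c \<in> U"
    using compact_coset_cover[OF Q U(1,2)] by blast
  have "\<forall>r\<in>P. \<exists>d. d \<in> D \<and> (\<exists>u\<in>U. r = d \<otimes> u)" using D(2) P(2) by blast
  then obtain d where d: "\<And>r. r \<in> P \<Longrightarrow> d r \<in> D \<and> (\<exists>u\<in>U. r = d r \<otimes> u)" by metis
  define F where "F = d ` P"
  have F: "finite F" "F \<subseteq> D" using P(1) d unfolding F_def by auto
  have UFJ: "U \<union> F \<subseteq> J" using U(3) F(2) D(1) by blast
  then have UFc: "U \<union> F \<subseteq> carrier G" using Jc by blast
  have H: "subgroup (generate G (U \<union> F)) G" by (rule generate_is_subgroup[OF UFc])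
  have incl: "U \<union> F \<subseteq> generate G (U \<union> F)"
    using generate.incl[of _ "U \<union> F" G] by blast
  have "Y \<subseteq> generate G (U \<union> F)"
  proof
    fix y assume y: "y \<in> Y"
    have yJ: "y \<in> J" using y unfolding Y_def by blast
    obtain r c s where "r \<in> S" "c \<in> E" "s \<in> S" "y = r \<otimes> c \<otimes> inv s" using y unfolding Y_def by blast
    then have "y \<in> S <#> E <#> m_inv G ` S" unfolding set_mult_def by blast
    then obtain r where r: "r \<in> P" "inv r \<otimes> y \<in> U" using P(3) yJ by blast
    obtain u where u: "u \<in> U" "r = d r \<otimes> u" using d[OF r(1)] by blast
    have "d r \<in> F" using r(1) unfolding F_def by blast
    then have "d r \<otimes> u \<in> generate G (U \<union> F)" using sg_mult[OF H] incl u(1) by blast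
    then have "r \<in> generate G (U \<union> F)" using u(2) by simp
    then have "r \<otimes> (inv r \<otimes> y) \<in> generate G (U \<union> F)" using sg_mult[OF H] incl r(2) by blast
    moreover have "r \<in> carrier G" "y \<in> carrier G" using r(1) P(2) yJ Jc by blast+
    ultimately show "y \<in> generate G (U \<union> F)" by simp
  qed
  then have "J \<subseteq> generate G (U \<union> F)" using JY generate_subgroup_incl[OF _ H] by blast
  moreover have "generate G (U \<union> F) \<subseteq> J" using generate_subgroup_incl[OF UFJ J(1)] .
  ultimately show thesis using that F by blast
qed

text \<open>Pigeonhole on the powers of x with exponents from 0 to the number of cosets: two of them
  lie in the same left coset of \<open>W\<close>, and their quotient is a power of x. The bound is
  uniform in x and will limit the primes that can occur.\<close>

lemma bounded_power_in_open_subgroup: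
  assumes U: "subgroup U G" "compactin T U" and W: "subgroup W G" "openin T W"
  obtains n :: nat where "\<forall>x\<in>U. \<exists>m. 0 < m \<and> m \<le> n \<and> x [^] m \<in> W"
proof -
  obtain R where R: "finite R" "R \<subseteq> U" "\<And>c. c \<in> U \<Longrightarrow> \<exists>r\<in>R. inv r \<otimes> c \<in> W"
    using compact_coset_cover[OF U(2) W] by blast
  have "\<exists>m. 0 < m \<and> m \<le> card R \<and> x [^] m \<in> W" if x: "x \<in> U" for x
  proof -
    have xc: "x \<in> carrier G" using x sg_carrier[OF U(1)] by blast
    have "\<forall>i::nat. \<exists>r\<in>R. inv r \<otimes> x [^] i \<in> W" using R(3) subgroup_pow_closed[OF U(1) x] by blast
    then obtain f where f: "\<And>i::nat. f i \<in> R" "\<And>i. inv (f i) \<otimes> x [^] i \<in> W" by metis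
    have "\<not> inj_on f {0..card R}"
    proof (rule pigeonhole)
      have "card (f ` {0..card R}) \<le> card R" using f(1) R(1) by (intro card_mono) auto
      then show "card {0..card R} > card (f ` {0..card R})" by simp
    qed
    then obtain i j where ij: "i \<le> card R" "j \<le> card R" "i < j" "f i = f j"
      unfolding inj_on_def by (metis atLeastAtMost_iff nat_neq_iff)
    let ?r = "f i"
    have rc: "?r \<in> carrier G" using f(1) R(2) sg_carrier[OF U(1)] by blast
    have "inv (inv ?r \<otimes> x [^] i) \<otimes> (inv ?r \<otimes> x [^] j) \<in> W"
      using f(2)[of i] f(2)[of j] ij(4) sg_mult[OF W(1) sg_inv[OF W(1)]] by simp
    also have "inv (inv ?r \<otimes> x [^] i) \<otimes> (inv ?r \<otimes> x [^] j) = inv (x [^] i) \<otimes> x [^] j"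
      using rc xc by (simp add: word_simps)
    also have "x [^] j = x [^] i \<otimes> x [^] (j - i)" using ij(3) xc by (simp add: nat_pow_mult)
    also have "inv (x [^] i) \<otimes> (x [^] i \<otimes> x [^] (j - i)) = x [^] (j - i)" using xc by simp
    finally show ?thesis using ij by (intro exI[of _ "j - i"]) auto
  qed
  then show thesis using that by blast
qed

section \<open>The quasi-centre, p-elements and p-regular elements\<close>

definition quasi_center :: "'a set" where
  "quasi_center = {g \<in> carrier G. \<exists>W. subgroup W G \<and> openin T W \<and> (\<forall>w\<in>W. conjg g w = w)}"

lemma conjg_fixes_mult:
  assumes "g \<in> carrier G" "h \<in> carrier G" "w \<in> carrier G" "conjg g w = w" "conjg h w = w"
  shows "conjg (g \<otimes> h) w = w"
  using assms by (simp flip: conjg_conjg)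

lemma conjg_fixes_inv:
  assumes "g \<in> carrier G" "w \<in> carrier G" "conjg g w = w"
  shows "conjg (inv g) w = w"
  using conjg_inv_cancel(2)[OF assms(1,2)] assms(3) by simp

lemma normal_quasi_center: "quasi_center \<lhd> G"
proof -
  have "subgroup quasi_center G"
  proof (rule subgroupI)
    show "quasi_center \<subseteq> carrier G" by (auto simp: quasi_center_def)
    have "openin T (carrier G)" using openin_topspace[of T] by (simp add: topspace_eq_carrier)
    then have "\<one> \<in> quasi_center" unfolding quasi_center_def using carrier_subgroup by force
    then show "quasi_center \<noteq> {}" by blast
    show "inv g \<in> quasi_center" if gQ: "g \<in> quasi_center" for g
    proof -
      obtain W where W: "subgroup W G" "openin T W" "\<forall>w\<in>W. conjg g w = w" and g: "g \<in> carrier G"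
        using gQ unfolding quasi_center_def by blast
      have "\<forall>w\<in>W. conjg (inv g) w = w" using W conjg_fixes_inv[OF g] sg_carrier[OF W(1)] by blast
      then show ?thesis using W g unfolding quasi_center_def by blast
    qed
    show "g \<otimes> h \<in> quasi_center" if gh: "g \<in> quasi_center" "h \<in> quasi_center" for g h
    proof -
      obtain W where W: "subgroup W G" "openin T W" "\<forall>w\<in>W. conjg g w = w" and g: "g \<in> carrier G"
        using gh(1) unfolding quasi_center_def by blast
      obtain V where V: "subgroup V G" "openin T V" "\<forall>w\<in>V. conjg h w = w" and h: "h \<in> carrier G"
        using gh(2) unfolding quasi_center_def by blast
      have "\<forall>w\<in>W \<inter> V. conjg (g \<otimes> h) w = w"
        using conjg_fixes_mult[OF g h] W V sg_carrier[OF W(1)] by blast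
      moreover have "subgroup (W \<inter> V) G" "openin T (W \<inter> V)"
        using subgroup_Int2[OF W(1) V(1)] W(2) V(2) by blast+
      ultimately show ?thesis using g h unfolding quasi_center_def by blast
    qed
  qed
  moreover have "carrier G \<subseteq> normzr quasi_center"
  proof (rule subgroup_subset_normzrI[OF carrier_subgroup])
    fix a g assume a: "a \<in> carrier G" and "g \<in> quasi_center"
    then obtain W where W: "subgroup W G" "openin T W" "\<forall>w\<in>W. conjg g w = w" and g: "g \<in> carrier G"
      unfolding quasi_center_def by blast
    have "\<forall>w\<in>conjg a ` W. conjg (conjg a g) w = w"
    proof
      fix w assume "w \<in> conjg a ` W"
      then obtain v where v: "v \<in> W" "w = conjg a v" by blast
      have vc: "v \<in> carrier G" using sg_carrier[OF W(1) v(1)] .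
      have "conjg (conjg a g) w = conjg a (conjg g v)"
        using a g vc by (simp add: v(2) conjg_def word_simps)
      then show "conjg (conjg a g) w = w" using W(3) v by simp
    qed
    then show "conjg a g \<in> quasi_center"
      unfolding quasi_center_def
      using subgroup_conjg[OF a W(1)] openin_conjg_image[OF a W(2)] conjg_closed[OF a g] by blast
  qed
  ultimately show ?thesis unfolding normal_iff_normzr by blast
qed

text \<open>Orders are read off modulo open subgroups. For x in a compact open subgroup of a tdlc
  group, \<open>p_element\<close> says that the closed subgroup generated by x is pro-p, and
  \<open>p_regular\<close> below that its order is prime to p. Testing all open subgroups, normal or
  not, makes both notions invariant under conjugation in the whole group.\<close>

definition p_element :: "nat \<Rightarrow> 'a \<Rightarrow> bool" where
  "p_element p x \<longleftrightarrow> (\<forall>W. subgroup W G \<longrightarrow> openin T W \<longrightarrow> (\<exists>k. x [^] (p ^ k) \<in> W))"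

definition p_regular :: "nat \<Rightarrow> 'a \<Rightarrow> bool" where
  "p_regular p x \<longleftrightarrow> (\<forall>W. subgroup W G \<longrightarrow> openin T W \<longrightarrow> (\<exists>m. coprime m p \<and> x [^] m \<in> W))"

lemma pow_conjg_mem:
  assumes g: "g \<in> carrier G" "x \<in> carrier G" and W: "subgroup W G"
  shows "x [^] (n::nat) \<in> conjg (inv g) ` W \<longleftrightarrow> conjg g x [^] n \<in> W"
  using mem_conjg_image[of "inv g" W "x [^] n"] g sg_subset[OF W] by (simp add: conjg_pow)

lemma p_element_conjg:
  assumes "p_element p x" "g \<in> carrier G" "x \<in> carrier G"
  shows "p_element p (conjg g x)"
  unfolding p_element_def
proof (intro allI impI)
  fix W assume W: "subgroup W G" "openin T W"
  have "subgroup (conjg (inv g) ` W) G" "openin T (conjg (inv g) ` W)"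
    using subgroup_conjg[OF _ W(1), of "inv g"] openin_conjg_image[OF _ W(2), of "inv g"] assms(2) by simp_all
  then obtain k where "x [^] (p ^ k) \<in> conjg (inv g) ` W"
    using assms(1) unfolding p_element_def by blast
  then show "\<exists>k. conjg g x [^] (p ^ k) \<in> W" using pow_conjg_mem[OF assms(2,3) W(1)] by blast
qed

lemma p_regular_conjg:
  assumes "p_regular p x" "g \<in> carrier G" "x \<in> carrier G"
  shows "p_regular p (conjg g x)"
  unfolding p_regular_def
proof (intro allI impI)
  fix W assume W: "subgroup W G" "openin T W"
  have "subgroup (conjg (inv g) ` W) G" "openin T (conjg (inv g) ` W)"
    using subgroup_conjg[OF _ W(1), of "inv g"] openin_conjg_image[OF _ W(2), of "inv g"] assms(2) by simp_all
  then obtain m where "coprime m p" "x [^] m \<in> conjg (inv g) ` W"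
    using assms(1) unfolding p_regular_def by blast
  then show "\<exists>m. coprime m p \<and> conjg g x [^] m \<in> W" using pow_conjg_mem[OF assms(2,3) W(1)] by blast
qed

end

section \<open>Finiteness of compact subgroups with large normaliser\<close>

locale qjnc_group = tdlc +
  assumes noncompact: "\<not> compact_space T"
    and nondiscrete: "\<not> discretein T (carrier G)"
    and cg: "compactly_generated G T"
    and normal_cases: "\<And>N. N \<lhd> G \<Longrightarrow> closedin T N \<Longrightarrow> discretein T N \<or> cocompact G T N"
begin

lemma open_subgroup_infinite:
  assumes W: "subgroup W G" "openin T W"
  shows "infinite W"
proof
  assume "finite W"
  then have "finite (W - {\<one>})" by simp
  then obtain U where U: "subgroup U G" "openin T U" "U \<subseteq> W" "U \<inter> (W - {\<one>}) = {}"
    by (rule compact_open_subgroup_avoiding[OF W]) auto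
  have one: "U = {\<one>}" using U(3,4) sg_one[OF U(1)] by blast
  have "openin T {x}" if "x \<in> carrier G" for x
    by (rule coset_invariant_open[OF U(1,2)]) (use that one in auto)
  then have "discrete_topology (carrier G) = T"
    using discrete_topology_unique[of "carrier G" T] topspace_eq_carrier by blast
  then have "discretein T (carrier G)"
    unfolding discretein_def by (metis order_refl subtopology_topspace topspace_eq_carrier)
  then show False using nondiscrete by blast
qed

lemma compact_subset_discretein_finite:
  assumes "discretein T N" "compactin T L" "L \<subseteq> N"
  shows "finite L"
proof -
  have "compactin (discrete_topology N) L"
    using assms compactin_subtopology[of T N L] unfolding discretein_def by metis
  then show ?thesis by (simp add: compactin_discrete_topology)
qed

text \<open>The dichotomy for closed normal subgroups leaves two cases: a compact discrete one is
  finite, and a compact cocompact one would make the whole group compact.\<close>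

lemma compact_normal_finite:
  assumes M: "M \<lhd> G" "compactin T M"
  shows "finite M"
proof (cases "discretein T M")
  case True
  then show ?thesis using compact_subset_discretein_finite M(2) by blast
next
  case False
  then have co: "cocompact G T M" using normal_cases[OF M(1)] compactin_imp_closedin_T[OF M(2)] by blast
  have sM: "subgroup M G" using M(1) by (rule normal_imp_subgroup)
  obtain U where U: "subgroup U G" "openin T U" "compactin T U"
    by (rule compact_open_subgroup_exists, rule that)
  obtain R where R: "finite R" "R \<subseteq> carrier G"
    "\<And>g. g \<in> carrier G \<Longrightarrow> \<exists>n\<in>M. \<exists>r\<in>R. \<exists>u\<in>U. g = n \<otimes> (r \<otimes> u)"
    by (rule cocompact_cover[OF sM co U(1,2)], rule that)
  have "compactin T R" using R(1,2) finite_imp_compactin[of R T] by (simp add: topspace_eq_carrier)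
  then have Q: "compactin T (M <#> (R <#> U))" by (rule compactin_set_mult[OF M(2) compactin_set_mult[OF _ U(3)]])
  have "topspace T \<subseteq> M <#> (R <#> U)"
  proof
    fix g assume "g \<in> topspace T"
    then have "g \<in> carrier G" by (simp add: topspace_eq_carrier)
    from R(3)[OF this] obtain n r u where "n \<in> M" "r \<in> R" "u \<in> U" "g = n \<otimes> (r \<otimes> u)" by blast
    then show "g \<in> M <#> (R <#> U)" using set_multI[OF _ set_multI] by blast
  qed
  then have "topspace T = M <#> (R <#> U)" using compactin_subset_topspace[OF Q] by blast
  then have "compact_space T" unfolding compact_space_def by (simp only: Q)
  then show ?thesis using noncompact by blast
qed

lemma finite_if_finite_index_normalizer:
  assumes J: "subgroup J G" "openin T J" and R: "finite R" "R \<subseteq> carrier G"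
    and cov: "\<And>g. g \<in> carrier G \<Longrightarrow> \<exists>r\<in>R. \<exists>j\<in>J. g = r \<otimes> j"
    and K: "subgroup K G" "compactin T K" "K \<subseteq> J" "J \<subseteq> normzr K"
  shows "finite K"
proof -
  have Jc: "J \<subseteq> carrier G" and Kc: "K \<subseteq> carrier G" using sg_subset[OF J(1)] sg_subset[OF K(1)] .
  \<comment> \<open>Conjugates of \<open>K\<close> need not normalise each other. Those of
    \<open>K \<inter> I\<close> do: they lie in the open normal subgroup \<open>I\<close>, and
    \<open>I\<close> lies in every conjugate of \<open>J\<close>, which normalises the corresponding
    conjugate of \<open>K \<inter> I\<close>.\<close>
  define I where "I = core (carrier G) J"
  have I: "subgroup I G" unfolding I_def by (rule subgroup_core[OF order_refl J(1)])
  have IN: "carrier G \<subseteq> normzr I" unfolding I_def by (rule subset_normzr_core[OF carrier_subgroup])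
  have IJ: "I \<subseteq> J" unfolding I_def by (rule core_subset) simp
  have "I = core (m_inv G ` R) J"
  proof
    show "I \<subseteq> core (m_inv G ` R) J" using R(2) unfolding I_def core_def by auto
    show "core (m_inv G ` R) J \<subseteq> I"
    proof
      fix x assume x: "x \<in> core (m_inv G ` R) J"
      then have xc: "x \<in> carrier G" unfolding core_def by blast
      have "conjg g x \<in> J" if g: "g \<in> carrier G" for g
      proof -
        obtain r j where rj: "r \<in> R" "j \<in> J" "inv g = r \<otimes> j" using cov[of "inv g"] g by blast
        have c: "r \<in> carrier G" "j \<in> carrier G" using rj R(2) Jc by blast+
        have "g = inv (r \<otimes> j)" using rj(3) g by (metis inv_inv)
        then have "conjg g x = conjg (inv j) (conjg (inv r) x)"
          using c xc by (simp add: inv_mult_group conjg_conjg)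
        moreover have "conjg (inv r) x \<in> J" using x rj(1) unfolding core_def by blast
        ultimately show ?thesis using conjg_in_subgroup[OF J(1) sg_inv[OF J(1) rj(2)]] by simp
      qed
      then show "x \<in> I" using xc unfolding I_def core_def by blast
    qed
  qed
  moreover have "openin T (core (m_inv G ` R) J)"
    by (rule openin_core_finite) (use R J in auto)
  ultimately have openI: "openin T I" by simp
  define L0 where "L0 = K \<inter> I"
  have L0: "subgroup L0 G" "compactin T L0"
    unfolding L0_def using subgroup_Int2[OF K(1) I]
      compact_Int_closedin[OF K(2) open_subgroup_closed[OF I openI]] by blast+
  have JL0: "J \<subseteq> normzr L0"
    unfolding L0_def using K(4) IN Jc normzr_Int[of K I] by blast
  let ?P = "\<lambda>L. subgroup L G \<and> compactin T L \<and> L \<subseteq> I \<and> I \<subseteq> normzr L"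
  have "\<exists>L. ?P L \<and> (\<forall>r\<in>S. conjg r ` L0 \<subseteq> L)" if "finite S" "S \<subseteq> carrier G" for S
    using that
  proof (induction S)
    case empty
    have "?P {\<one>}"
      using triv_subgroup sg_one[OF I] sg_subset[OF I]
      by (auto simp: topspace_eq_carrier normzr_def conjg_eq_one_iff)
    then show ?case by blast
  next
    case (insert r S)
    then obtain L where L: "?P L" "\<forall>r\<in>S. conjg r ` L0 \<subseteq> L" by blast
    have rc: "r \<in> carrier G" using insert by blast
    have rI: "conjg r ` I = I"
    proof -
      have "\<And>y. y \<in> carrier G \<Longrightarrow> conjg (inv r) y \<in> I \<longleftrightarrow> y \<in> I"
        using normzrD[of "inv r" I] IN rc by blast
      then show ?thesis using mem_conjg_image[OF rc sg_subset[OF I]] sg_carrier[OF I] by blast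
    qed
    let ?A = "conjg r ` L0"
    have A: "subgroup ?A G" "compactin T ?A"
      using subgroup_conjg[OF rc L0(1)] compactin_conjg_image[OF rc L0(2)] by blast+
    have AI: "?A \<subseteq> I" using rI unfolding L0_def by blast
    have IA: "I \<subseteq> normzr ?A"
      using conjg_image_normzr[OF rc sg_subset[OF L0(1)], of I] IJ JL0 rI by blast
    have "L \<subseteq> normzr ?A" using L(1) IA by blast
    then have 1: "subgroup (L <#> ?A) G" using subgroup_set_mult[of L ?A] L(1) A(1) by blast
    have 2: "compactin T (L <#> ?A)" using compactin_set_mult[OF _ A(2)] L(1) by blast
    have 3: "L <#> ?A \<subseteq> I"
      by (rule set_mult_subset[OF I]) (use L(1) AI in blast)+
    have 4: "I \<subseteq> normzr (L <#> ?A)" using normzr_set_mult[of L ?A I] L(1) A(1) IA I by blast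
    have "L \<subseteq> L <#> ?A" "?A \<subseteq> L <#> ?A" using subset_set_mult[of L ?A] L(1) A(1) by blast+
    then have "\<forall>s\<in>insert r S. conjg s ` L0 \<subseteq> L <#> ?A" using L(2) by blast
    then show ?case using 1 2 3 4 by blast
  qed
  from this[OF R] obtain L where L: "?P L" "\<forall>r\<in>R. conjg r ` L0 \<subseteq> L" by blast
  \<comment> \<open>\<open>L\<close> contains the conjugates of \<open>L0\<close> by elements of
    \<open>R\<close>, hence all conjugates, because \<open>J\<close> normalises \<open>L0\<close>.
    So \<open>L0\<close> lies in the normal core of \<open>L\<close>, which is compact.\<close>
  define M where "M = core (carrier G) L"
  have sM: "subgroup M G" unfolding M_def using subgroup_core[OF order_refl, of L] L(1) by blast
  have "carrier G \<subseteq> normzr M" unfolding M_def by (rule subset_normzr_core[OF carrier_subgroup])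
  then have nM: "M \<lhd> G" using sM unfolding normal_iff_normzr by blast
  have M_sub_L: "M \<subseteq> L" unfolding M_def by (rule core_subset) simp
  have "closedin T M"
    unfolding M_def by (rule closedin_core) (use compactin_imp_closedin_T L(1) in auto)
  then have "compactin T M" using closed_compactin[OF _ M_sub_L] L(1) by blast
  then have "finite M" using compact_normal_finite[OF nM] by blast
  moreover have "L0 \<subseteq> M"
  proof
    fix x assume x: "x \<in> L0"
    then have xc: "x \<in> carrier G" using sg_carrier[OF L0(1)] by blast
    have "conjg g x \<in> L" if g: "g \<in> carrier G" for g
    proof -
      obtain r j where rj: "r \<in> R" "j \<in> J" "g = r \<otimes> j" using cov[OF g] by blast
      have c: "r \<in> carrier G" "j \<in> carrier G" using rj R(2) Jc by blast+
      have "conjg j x \<in> L0" using normzrD[of j L0 x] JL0 rj(2) x xc by blast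
      then have "conjg r (conjg j x) \<in> L" using L(2) rj(1) by blast
      then show ?thesis using c xc by (simp add: rj(3) conjg_conjg)
    qed
    then show "x \<in> M" using xc unfolding M_def core_def by blast
  qed
  ultimately have finL0: "finite L0" using finite_subset by blast
  \<comment> \<open>\<open>I\<close> is open, so \<open>L0\<close> has finite index in the compact
    group \<open>K\<close>.\<close>
  obtain P where P: "finite P" "P \<subseteq> K" "\<And>c. c \<in> K \<Longrightarrow> \<exists>r\<in>P. inv r \<otimes> c \<in> I"
    using compact_coset_cover[OF K(2) I openI] by blast
  have "K \<subseteq> (\<Union>r\<in>P. (\<lambda>x. r \<otimes> x) ` L0)"
  proof
    fix k assume k: "k \<in> K"
    obtain r where r: "r \<in> P" "inv r \<otimes> k \<in> I" using P(3)[OF k] by blast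
    have "inv r \<otimes> k \<in> K" using sg_mult[OF K(1) sg_inv[OF K(1)] k] r(1) P(2) by blast
    then have "inv r \<otimes> k \<in> L0" using r(2) unfolding L0_def by blast
    moreover have "k = r \<otimes> (inv r \<otimes> k)" using r(1) P(2) k Kc by (simp add: subset_iff)
    ultimately show "k \<in> (\<Union>r\<in>P. (\<lambda>x. r \<otimes> x) ` L0)" using r(1) by blast
  qed
  then show ?thesis using finite_subset P(1) finL0 by blast
qed

text \<open>\<open>U <#> D\<close> is open, so closed, and thus contains the closure of
  \<open>D\<close>, which is cocompact; hence it has finite index. That \<open>F\<close> lies in
  \<open>D\<close> and not merely in the closure is the point: in the applications the elements of
  \<open>D\<close> have open centralisers or are words in finitely many conjugates of a given group,
  and this may be lost in the closure.\<close>

lemma finite_set_forcing_finiteness: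
  assumes D: "D \<lhd> G" "\<not> discretein T (T closure_of D)"
    and U: "subgroup U G" "openin T U"
  obtains F where "finite F" "F \<subseteq> D"
    "\<And>K. subgroup K G \<Longrightarrow> compactin T K \<Longrightarrow> K \<subseteq> U \<Longrightarrow> U \<union> F \<subseteq> normzr K \<Longrightarrow> finite K"
proof -
  have sD: "subgroup D G" "carrier G \<subseteq> normzr D" using D(1) unfolding normal_iff_normzr by blast+
  have Uc: "U \<subseteq> carrier G" and Dc: "D \<subseteq> carrier G" using sg_subset[OF U(1)] sg_subset[OF sD(1)] .
  let ?N = "T closure_of D"
  have N: "?N \<lhd> G" using normal_closure_of[OF D(1)] .
  have sN: "subgroup ?N G" "carrier G \<subseteq> normzr ?N" using N unfolding normal_iff_normzr by blast+
  have co: "cocompact G T ?N" using normal_cases[OF N] D(2) closedin_closure_of by blast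
  define J where "J = U <#> D"
  have J: "subgroup J G" unfolding J_def
    using subgroup_set_mult[OF U(1) sD(1)] Uc sD(2) by blast
  have UJ: "U \<subseteq> J" and DJ: "D \<subseteq> J" unfolding J_def by (rule subset_set_mult[OF U(1) sD(1)])+
  have openJ: "openin T J" by (rule subgroup_over_open[OF U J UJ])
  have NJ: "?N \<subseteq> J" using closure_of_minimal[OF DJ open_subgroup_closed[OF J openJ]] .
  obtain R where R: "finite R" "R \<subseteq> carrier G"
    "\<And>g. g \<in> carrier G \<Longrightarrow> \<exists>n\<in>?N. \<exists>r\<in>R. \<exists>u\<in>U. g = n \<otimes> (r \<otimes> u)"
    by (rule cocompact_cover[OF sN(1) co U], rule that)
  have cov: "\<exists>r\<in>R. \<exists>j\<in>J. g = r \<otimes> j" if g: "g \<in> carrier G" for g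
  proof -
    obtain n r u where nru: "n \<in> ?N" "r \<in> R" "u \<in> U" "g = n \<otimes> (r \<otimes> u)" using R(3)[OF g] by blast
    have c: "n \<in> carrier G" "r \<in> carrier G" "u \<in> carrier G"
      using nru R(2) Uc sg_carrier[OF sN(1)] by blast+
    have "conjg (inv r) n \<in> ?N" using normzrD[of "inv r" ?N n] sN(2) c nru(1) by blast
    then have "conjg (inv r) n \<otimes> u \<in> J" using sg_mult[OF J] NJ UJ nru(3) by blast
    moreover have "g = r \<otimes> (conjg (inv r) n \<otimes> u)" using c by (simp add: nru(4) conjg_def word_simps)
    ultimately show ?thesis using nru(2) by blast
  qed
  have du: "\<exists>d\<in>D. \<exists>u\<in>U. j = d \<otimes> u" if j: "j \<in> J" for j
  proof -
    obtain u d where ud: "u \<in> U" "d \<in> D" "j = u \<otimes> d" using j unfolding J_def set_mult_def by blast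
    have c: "u \<in> carrier G" "d \<in> carrier G" using ud Uc Dc by blast+
    have "conjg u d \<in> D" using normzrD[of u D d] sD(2) c ud(2) by blast
    moreover have "j = conjg u d \<otimes> u" using c by (simp add: ud(3) conjg_def word_simps)
    ultimately show ?thesis using ud(1) by blast
  qed
  obtain F where F: "finite F" "F \<subseteq> D" "generate G (U \<union> F) = J"
    by (rule finite_index_generators[OF cg J openJ R(1,2) cov U UJ DJ du]) (assumption | rule that)+
  show thesis
  proof (rule that[OF F(1,2)])
    fix K assume K: "subgroup K G" "compactin T K" "K \<subseteq> U" "U \<union> F \<subseteq> normzr K"
    have "J \<subseteq> normzr K" using generate_subgroup_incl[OF K(4) subgroup_normzr] F(3) by simp
    then show "finite K"
      using finite_if_finite_index_normalizer[OF J openJ R(1,2) cov K(1,2)] K(3) UJ by blast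
  qed
qed

text \<open>Otherwise a finite set \<open>F\<close> of quasi-central elements forces finiteness.
  These elements have a common open centraliser, and its core in \<open>U\<close> is an infinite
  compact group normalised by \<open>U\<close> and by \<open>F\<close>.\<close>

lemma quasi_center_discrete:
  obtains U where "subgroup U G" "openin T U" "U \<inter> quasi_center = {\<one>}"
proof -
  let ?N = "T closure_of quasi_center"
  have sQ: "subgroup quasi_center G" using normal_quasi_center by (rule normal_imp_subgroup)
  have QN: "quasi_center \<subseteq> ?N"
    using closure_of_subset[of quasi_center T] sg_subset[OF sQ] topspace_eq_carrier by simp
  have "discretein T ?N"
  proof (rule ccontr)
    assume nd: "\<not> discretein T ?N"
    obtain U where U: "subgroup U G" "openin T U" "compactin T U"
      by (rule compact_open_subgroup_exists, rule that)
    obtain F where F: "finite F" "F \<subseteq> quasi_center"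
      "\<And>K. subgroup K G \<Longrightarrow> compactin T K \<Longrightarrow> K \<subseteq> U \<Longrightarrow> U \<union> F \<subseteq> normzr K \<Longrightarrow> finite K"
      by (rule finite_set_forcing_finiteness[OF normal_quasi_center nd U(1,2)], rule that)
    have "\<exists>W. subgroup W G \<and> openin T W \<and> W \<subseteq> U \<and> (\<forall>f\<in>F. \<forall>w\<in>W. conjg f w = w)"
      using F(1,2)
    proof (induction F)
      case empty
      then show ?case using U by blast
    next
      case (insert f F)
      then obtain W where W: "subgroup W G" "openin T W" "W \<subseteq> U" "\<forall>f\<in>F. \<forall>w\<in>W. conjg f w = w" by blast
      obtain V where V: "subgroup V G" "openin T V" "\<forall>w\<in>V. conjg f w = w"
        using insert.prems unfolding quasi_center_def by blast
      show ?case
        using W V subgroup_Int2[OF W(1) V(1)] openin_Int[OF W(2) V(2)]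
        by (intro exI[of _ "W \<inter> V"]) blast
    qed
    then obtain W where W: "subgroup W G" "openin T W" "W \<subseteq> U" "\<forall>f\<in>F. \<forall>w\<in>W. conjg f w = w" by blast
    define V where "V = core U W"
    have V: "subgroup V G" "openin T V"
      unfolding V_def by (rule subgroup_core[OF sg_subset[OF U(1)] W(1)], rule openin_core[OF U(3) W(1,2)])
    have VW: "V \<subseteq> W" unfolding V_def by (rule core_subset[OF sg_one[OF U(1)]])
    have VU: "V \<subseteq> U" using VW W(3) by blast
    have cV: "compactin T V" using closed_compactin[OF U(3) VU open_subgroup_closed[OF V]] .
    have UV: "U \<subseteq> normzr V" unfolding V_def by (rule subset_normzr_core[OF U(1)])
    have FV: "F \<subseteq> normzr V"
    proof
      fix f assume f: "f \<in> F"
      have fc: "f \<in> carrier G" using f F(2) sg_carrier[OF sQ] by blast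
      have fv: "conjg f v = v" if "v \<in> V" for v using W(4) VW f that by blast
      have "x \<in> V" if x: "x \<in> carrier G" "conjg f x \<in> V" for x
      proof -
        have "conjg f (conjg f x) = conjg f x" using fv[OF x(2)] .
        then have "conjg (inv f) (conjg f (conjg f x)) = conjg (inv f) (conjg f x)" by simp
        then have "conjg f x = x" using fc x(1) by simp
        then show ?thesis using x(2) by simp
      qed
      moreover have "conjg f x \<in> V" if "x \<in> V" for x using fv[OF that] that by simp
      ultimately show "f \<in> normzr V" using fc unfolding normzr_def by blast
    qed
    have "U \<union> F \<subseteq> normzr V" using UV FV by blast
    then have "finite V" by (rule F(3)[OF V(1) cV VU])
    then show False using open_subgroup_infinite[OF V] by blast
  qed
  then have d: "subtopology T ?N = discrete_topology ?N" unfolding discretein_def by blast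
  have oneQ: "\<one> \<in> quasi_center" using sg_one[OF sQ] .
  then have "openin (subtopology T ?N) {\<one>}" using QN unfolding d by auto
  then obtain A where A: "openin T A" "{\<one>} = A \<inter> ?N" unfolding openin_subtopology by blast
  have oneA: "\<one> \<in> A" using A(2) by blast
  obtain U where U: "subgroup U G" "openin T U" "compactin T U" "U \<subseteq> A"
    by (rule van_Dantzig[OF A(1) oneA], rule that)
  have "U \<inter> quasi_center = {\<one>}" using U(4) A(2) QN oneQ sg_one[OF U(1)] by blast
  then show thesis by (rule that[OF U(1,2)])
qed

end

section \<open>Open pro-p subgroups from infinite normal ones\<close>

lemma (in group) generate_finite_support:
  assumes "d \<in> generate G (\<Union>g\<in>A. M g)"
  shows "\<exists>S. finite S \<and> S \<subseteq> A \<and> d \<in> generate G (\<Union>g\<in>S. M g)"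
  using assms
proof induction
  case one
  then show ?case using generate.one[of G "\<Union>g\<in>{}. M g"] by blast
next
  case (incl h)
  then obtain g where g: "g \<in> A" "h \<in> M g" by blast
  then have "h \<in> generate G (\<Union>g\<in>{g}. M g)" using generate.incl[of h "\<Union>g\<in>{g}. M g" G] by blast
  then show ?case using g(1) by (intro exI[of _ "{g}"]) simp
next
  case (inv h)
  then obtain g where g: "g \<in> A" "h \<in> M g" by blast
  then have "inv h \<in> generate G (\<Union>g\<in>{g}. M g)" using generate.inv[of h "\<Union>g\<in>{g}. M g" G] by blast
  then show ?case using g(1) by (intro exI[of _ "{g}"]) simp
next
  case (eng h k)
  then obtain S S' where S: "finite S" "S \<subseteq> A" "h \<in> generate G (\<Union>g\<in>S. M g)"
    and S': "finite S'" "S' \<subseteq> A" "k \<in> generate G (\<Union>g\<in>S'. M g)" by blast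
  have "h \<in> generate G (\<Union>g\<in>S \<union> S'. M g)" "k \<in> generate G (\<Union>g\<in>S \<union> S'. M g)"
    using S(3) S'(3) mono_generate[of "\<Union>g\<in>S. M g" "\<Union>g\<in>S \<union> S'. M g"]
      mono_generate[of "\<Union>g\<in>S'. M g" "\<Union>g\<in>S \<union> S'. M g"] by auto
  then have "h \<otimes> k \<in> generate G (\<Union>g\<in>S \<union> S'. M g)" by (rule generate.eng)
  then show ?case using S S' by (intro exI[of _ "S \<union> S'"]) simp
qed

lemma (in group) generate_finite_support_set:
  assumes "finite F" "F \<subseteq> generate G (\<Union>g\<in>A. M g)"
  shows "\<exists>S. finite S \<and> S \<subseteq> A \<and> F \<subseteq> generate G (\<Union>g\<in>S. M g)"
  using assms
proof induction
  case empty
  then show ?case by blast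
next
  case (insert d F)
  then obtain S where S: "finite S" "S \<subseteq> A" "F \<subseteq> generate G (\<Union>g\<in>S. M g)" by blast
  obtain S' where S': "finite S'" "S' \<subseteq> A" "d \<in> generate G (\<Union>g\<in>S'. M g)"
    using generate_finite_support[of d M A] insert.prems by blast
  have "insert d F \<subseteq> generate G (\<Union>g\<in>S \<union> S'. M g)"
    using S(3) S'(3) mono_generate[of "\<Union>g\<in>S. M g" "\<Union>g\<in>S \<union> S'. M g"]
      mono_generate[of "\<Union>g\<in>S'. M g" "\<Union>g\<in>S \<union> S'. M g"] by auto
  then show ?case using S S' by (intro exI[of _ "S \<union> S'"]) simp
qed

section \<open>p-regular elements and the p-residual\<close>

context topological_group
begin

text \<open>For a pro-finite group \<open>V\<close> this is the residual \<open>O\<^sup>p(V)\<close>.\<close>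

definition p_residual :: "nat \<Rightarrow> 'a set \<Rightarrow> 'a set" where
  "p_residual p V = \<Inter>{C. subgroup C G \<and> closedin T C \<and> C \<subseteq> V \<and> (\<forall>x\<in>V. p_regular p x \<longrightarrow> x \<in> C)}"

lemma p_residual_props:
  assumes V: "subgroup V G" "closedin T V"
  shows "subgroup (p_residual p V) G" "closedin T (p_residual p V)" "p_residual p V \<subseteq> V"
    "\<And>x. x \<in> V \<Longrightarrow> p_regular p x \<Longrightarrow> x \<in> p_residual p V"
proof -
  let ?F = "{C. subgroup C G \<and> closedin T C \<and> C \<subseteq> V \<and> (\<forall>x\<in>V. p_regular p x \<longrightarrow> x \<in> C)}"
  have VF: "V \<in> ?F" using V by blast
  show "subgroup (p_residual p V) G"
    unfolding p_residual_def by (rule subgroups_Inter) (use VF in blast)+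
  show "closedin T (p_residual p V)"
    unfolding p_residual_def by (rule closedin_Inter) (use VF in blast)+
  show "p_residual p V \<subseteq> V" unfolding p_residual_def using VF by blast
  show "x \<in> p_residual p V" if "x \<in> V" "p_regular p x" for x
    unfolding p_residual_def using that by blast
qed

text \<open>If \<open>C\<close> is one of the groups intersected in \<open>p_residual\<close>, so is
  the part of \<open>V\<close> that \<open>a\<close> conjugates into \<open>C\<close>. For this it
  is enough that \<open>a\<close> keeps the p-regular elements of \<open>V\<close> inside
  \<open>V\<close>, so groups that do not normalise \<open>V\<close> are covered.\<close>

lemma p_residual_normalized:
  assumes V: "subgroup V G" "closedin T V" and A: "subgroup A G"
    and stable: "\<And>a x. a \<in> A \<Longrightarrow> x \<in> V \<Longrightarrow> p_regular p x \<Longrightarrow> conjg a x \<in> V"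
  shows "A \<subseteq> normzr (p_residual p V)"
proof (rule subgroup_subset_normzrI[OF A])
  fix a y assume a: "a \<in> A" and y: "y \<in> p_residual p V" "y \<in> carrier G"
  have ac: "a \<in> carrier G" using sg_carrier[OF A a] .
  show "conjg a y \<in> p_residual p V"
    unfolding p_residual_def
  proof
    fix C assume "C \<in> {C. subgroup C G \<and> closedin T C \<and> C \<subseteq> V \<and> (\<forall>x\<in>V. p_regular p x \<longrightarrow> x \<in> C)}"
    then have C: "subgroup C G" "closedin T C" "C \<subseteq> V" "\<And>x. x \<in> V \<Longrightarrow> p_regular p x \<Longrightarrow> x \<in> C"
      by blast+
    define E where "E = V \<inter> {x \<in> carrier G. conjg a x \<in> C}"
    have E': "{x \<in> carrier G. conjg a x \<in> C} = core {a} C" unfolding core_def by blast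
    have "subgroup (core {a} C) G" by (rule subgroup_core[OF _ C(1)]) (use ac in simp)
    then have "subgroup E G" unfolding E_def E' by (rule subgroup_Int2[OF V(1)])
    moreover have "closedin T E"
      unfolding E_def using closedin_Int[OF V(2) closedin_preimage[OF continuous_translate(3)[OF ac] C(2)]] .
    moreover have "\<forall>x\<in>V. p_regular p x \<longrightarrow> x \<in> E"
      using stable[OF a] C(4) p_regular_conjg[OF _ ac] sg_carrier[OF V(1)] unfolding E_def by blast
    ultimately have "y \<in> E" using y(1) unfolding p_residual_def E_def by blast
    then show "conjg a y \<in> C" unfolding E_def by blast
  qed
qed

text \<open>The commutator \<open>z\<close> of \<open>l\<close> and \<open>x\<close> lies in
  \<open>B\<close> and in \<open>L\<close>, so it normalises \<open>V\<close> and some p-power of it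
  lies in \<open>V\<close>. As \<open>x\<close> is in \<open>V\<close>, the same p-power of
  \<open>conjg l x = z \<otimes> x\<close> lies in \<open>V\<close>. Being p-regular,
  \<open>conjg l x\<close> also has a power prime to p in \<open>V\<close>, and Bezout
  applies.\<close>

lemma p_regular_conjugate_stays:
  assumes V: "subgroup V G" "openin T V" and B: "subgroup B G" "V \<subseteq> B" "B \<subseteq> normzr V"
    and U: "B \<subseteq> U" "U \<subseteq> normzr B"
    and L: "subgroup L G" "L \<subseteq> U" "U \<subseteq> normzr L" "\<And>x. x \<in> L \<Longrightarrow> p_element p x"
    and l: "l \<in> L" and x: "x \<in> V" "p_regular p x"
  shows "conjg l x \<in> V"
proof -
  have lc: "l \<in> carrier G" and xc: "x \<in> carrier G" using l x sg_carrier[OF L(1)] sg_carrier[OF V(1)] by blast+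
  have xB: "x \<in> B" using x(1) B(2) by blast
  have yB: "conjg l x \<in> B" using normzrD[of l B x] xB l L(2) U(2) xc by blast
  define z where "z = conjg l x \<otimes> inv x"
  have zB: "z \<in> B" unfolding z_def using sg_mult[OF B(1) yB sg_inv[OF B(1) xB]] .
  have "conjg x (inv l) \<in> L"
    using normzrD[of x L "inv l"] xB U(1) L(3) sg_inv[OF L(1) l] lc by blast
  then have "l \<otimes> conjg x (inv l) \<in> L" using sg_mult[OF L(1) l] by blast
  moreover have "l \<otimes> conjg x (inv l) = z" using lc xc by (simp add: z_def conjg_def word_simps)
  ultimately have "p_element p z" using L(4) by simp
  then obtain k where k: "z [^] (p ^ k) \<in> V" using V unfolding p_element_def by blast
  have yz: "conjg l x = z \<otimes> x" using lc xc by (simp add: z_def m_assoc)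
  have "z \<in> normzr V" using zB B(3) by blast
  then obtain w where "w \<in> V" "(z \<otimes> x) [^] (p ^ k) = z [^] (p ^ k) \<otimes> w"
    using mult_pow_mem_coset[OF V(1) _ x(1)] by blast
  then have 1: "conjg l x [^] (p ^ k) \<in> V" using yz sg_mult[OF V(1) k] by simp
  have "p_regular p (conjg l x)" using p_regular_conjg[OF x(2) lc xc] .
  then obtain m where m: "coprime m p" "conjg l x [^] m \<in> V" using V unfolding p_regular_def by blast
  have cop: "coprime (p ^ k) m" using m(1) by (simp add: coprime_commute[of p])
  show ?thesis by (rule pow_coprime_mem[OF V(1) _ 1 m(2) cop]) (use lc xc in simp)
qed

text \<open>A limit point y of the powers \<open>x [^] (p ^ k)\<close> retains only the part of x of
  order prime to p. It is p-regular, so it is trivial by assumption, and these powers come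
  arbitrarily close to \<open>\<one>\<close>.\<close>

lemma p_elements_if_no_p_regular:
  assumes p: "prime p" and W: "subgroup W G" "openin T W" "compactin T W"
    and trivial: "\<And>x. x \<in> W \<Longrightarrow> p_regular p x \<Longrightarrow> x = \<one>"
    and x: "x \<in> W"
  shows "p_element p x"
  unfolding p_element_def
proof (intro allI impI)
  fix N assume N: "subgroup N G" "openin T N"
  have Wc: "W \<subseteq> carrier G" using sg_subset[OF W(1)] .
  have xc: "x \<in> carrier G" using x Wc by blast
  define P where "P j = {x [^] (p ^ k) | k. k \<ge> j}" for j :: nat
  have PW: "P j \<subseteq> W" for j using subgroup_pow_closed[OF W(1) x] unfolding P_def by blast
  have PT: "P j \<subseteq> topspace T" for j using PW Wc topspace_eq_carrier by blast
  obtain y where y: "y \<in> W" "\<And>j. j \<in> UNIV \<Longrightarrow> y \<in> T closure_of (P j)"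
  proof (rule compactin_directed_Inter[OF W(3), of "UNIV :: nat set" "\<lambda>j. T closure_of (P j)"])
    show "W \<inter> T closure_of P j \<noteq> {}" for j
    proof -
      have "x [^] (p ^ j) \<in> P j" unfolding P_def by blast
      then show ?thesis using PW closure_of_subset[OF PT, of j] by blast
    qed
    show "\<exists>k\<in>UNIV. T closure_of P k \<subseteq> T closure_of P i \<inter> T closure_of P j" for i j
    proof -
      have "P (max i j) \<subseteq> P i" "P (max i j) \<subseteq> P j" unfolding P_def by auto
      then show ?thesis using closure_of_mono by (metis Int_greatest UNIV_I)
    qed
  qed (auto intro: that)
  have yc: "y \<in> carrier G" using y(1) Wc by blast
  have near: "\<exists>k\<ge>j. inv y \<otimes> x [^] (p ^ k) \<in> A" if A: "openin T A" "\<one> \<in> A" for A j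
  proof -
    let ?O = "{z \<in> carrier G. inv y \<otimes> z \<in> A}"
    have 1: "openin T ?O" using openin_preimage[OF continuous_translate(1) A(1)] yc by simp
    have 2: "y \<in> ?O" using yc A(2) by simp
    have "\<forall>B. y \<in> B \<and> openin T B \<longrightarrow> (\<exists>z. z \<in> P j \<and> z \<in> B)"
      using y(2)[OF UNIV_I, of j] unfolding in_closure_of by (rule conjunct2)
    from this[rule_format, OF conjI, OF 2 1] obtain z where "z \<in> P j" "z \<in> ?O" by blast
    then show ?thesis unfolding P_def by blast
  qed
  have "p_regular p y"
    unfolding p_regular_def
  proof (intro allI impI)
    fix M assume M: "subgroup M G" "openin T M"
    define Q where "Q = core W M"
    have Q: "subgroup Q G" "openin T Q"
      unfolding Q_def by (rule subgroup_core[OF Wc M(1)], rule openin_core[OF W(3) M])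
    have QM: "Q \<subseteq> M" unfolding Q_def by (rule core_subset[OF sg_one[OF W(1)]])
    have WQ: "W \<subseteq> normzr Q" unfolding Q_def by (rule subset_normzr_core[OF W(1)])
    obtain n :: nat where n: "\<forall>x\<in>W. \<exists>m. 0 < m \<and> m \<le> n \<and> x [^] m \<in> Q"
      by (rule bounded_power_in_open_subgroup[OF W(1,3) Q], rule that)
    obtain m0 :: nat where m0: "0 < m0" "x [^] m0 \<in> Q" using n x by blast
    \<comment> \<open>Modulo \<open>Q\<close> the order of x divides \<open>p ^ a * m\<close>. So
      for k \<ge> a the order of \<open>x [^] (p ^ k)\<close> divides m, and with it the order of y,
      which agrees with that power modulo \<open>Q\<close>.\<close>
    define a where "a = multiplicity p m0"
    obtain m where m: "m0 = p ^ a * m" "\<not> p dvd m"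
      using multiplicity_decompose'[of m0 p] m0(1) p unfolding a_def by (metis not_prime_unit neq0_conv)
    have cop: "coprime m p" using prime_imp_coprime[OF p m(2)] by (simp add: coprime_commute[of m])
    obtain k where k: "k \<ge> a" "inv y \<otimes> x [^] (p ^ k) \<in> Q"
      using near[OF Q(2) sg_one[OF Q(1)]] by blast
    let ?w = "inv y \<otimes> x [^] (p ^ k)"
    have "x [^] (p ^ k) = y \<otimes> ?w" using yc xc by simp
    moreover obtain w' where w': "w' \<in> Q" "(y \<otimes> ?w) [^] m = y [^] m \<otimes> w'"
      using mult_pow_mem_coset[OF Q(1) _ k(2)] WQ y(1) by blast
    moreover have "(x [^] (p ^ k)) [^] m \<in> Q"
    proof -
      have "m0 dvd p ^ k * m" unfolding m(1) using k(1) by (simp add: le_imp_power_dvd)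
      then have "x [^] (p ^ k * m) \<in> Q" using pow_mem_dvd[OF Q(1) xc m0(2)] by blast
      then show ?thesis using xc by (simp add: nat_pow_pow)
    qed
    ultimately have 1: "y [^] m \<otimes> w' \<in> Q" by simp
    have "w' \<in> carrier G" using w'(1) sg_carrier[OF Q(1)] by blast
    then have "y [^] m = (y [^] m \<otimes> w') \<otimes> inv w'" using yc by (simp add: m_assoc)
    then have "y [^] m \<in> Q" using sg_mult[OF Q(1) 1 sg_inv[OF Q(1) w'(1)]] by simp
    then show "\<exists>m. coprime m p \<and> y [^] m \<in> M" using QM cop by blast
  qed
  then have "y = \<one>" using trivial y(1) by blast
  then show "\<exists>k. x [^] (p ^ k) \<in> N" using near[OF N(2) sg_one[OF N(1)], of 0] xc by auto
qed

end

context qjnc_group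
begin

lemma virtually_pro_p:
  assumes p: "prime p" and U: "subgroup U G" "openin T U" "compactin T U"
    and L: "subgroup L G" "closedin T L" "L \<subseteq> U" "U \<subseteq> normzr L" "infinite L"
      "\<And>x. x \<in> L \<Longrightarrow> p_element p x"
  obtains W where "subgroup W G" "openin T W" "compactin T W" "W \<subseteq> U"
    "\<And>x. x \<in> W \<Longrightarrow> p_element p x"
proof -
  have Uc: "U \<subseteq> carrier G" and Lc: "L \<subseteq> carrier G" using sg_subset[OF U(1)] sg_subset[OF L(1)] .
  have cL: "compactin T L" using closed_compactin[OF U(3) L(3,2)] .
  define D where "D = generate G (\<Union>g\<in>carrier G. conjg g ` L)"
  have nD: "D \<lhd> G"
    unfolding D_def
  proof (rule normal_generateI)
    show "(\<Union>g\<in>carrier G. conjg g ` L) \<subseteq> carrier G" using Lc by auto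
    fix h g assume h: "h \<in> (\<Union>g\<in>carrier G. conjg g ` L)" and g: "g \<in> carrier G"
    then obtain a l where al: "a \<in> carrier G" "l \<in> L" "h = conjg a l" by blast
    have "g \<otimes> h \<otimes> inv g = conjg (g \<otimes> a) l"
      using al g Lc conjg_conjg[of g a l] by (auto simp: conjg_def[of g])
    then show "g \<otimes> h \<otimes> inv g \<in> (\<Union>g\<in>carrier G. conjg g ` L)" using al g by blast
  qed
  have sD: "subgroup D G" using nD by (rule normal_imp_subgroup)
  have LD: "L \<subseteq> D"
  proof
    fix l assume l: "l \<in> L"
    then have "conjg \<one> l = l" using Lc by auto
    then have "l \<in> (\<Union>g\<in>carrier G. conjg g ` L)" using l by force
    then show "l \<in> D" unfolding D_def by (rule generate.incl)
  qed
  have "D \<subseteq> T closure_of D" using closure_of_subset[of D T] sg_subset[OF sD] topspace_eq_carrier by simp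
  then have nd: "\<not> discretein T (T closure_of D)"
    using compact_subset_discretein_finite[OF _ cL, of "T closure_of D"] LD L(5) by blast
  obtain F where F: "finite F" "F \<subseteq> D"
    "\<And>K. subgroup K G \<Longrightarrow> compactin T K \<Longrightarrow> K \<subseteq> U \<Longrightarrow> U \<union> F \<subseteq> normzr K \<Longrightarrow> finite K"
    by (rule finite_set_forcing_finiteness[OF nD nd U(1,2)], rule that)
  \<comment> \<open>\<open>F\<close> involves only finitely many conjugates \<open>g L g^-1\<close>,
    so a single \<open>V\<close> can be subnormal in all the corresponding
    \<open>g U g^-1\<close>.\<close>
  obtain S where S: "finite S" "S \<subseteq> carrier G" "F \<subseteq> generate G (\<Union>g\<in>S. conjg g ` L)"
    using generate_finite_support_set[OF F(1), of "\<lambda>g. conjg g ` L" "carrier G"] F(2) unfolding D_def by blast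
  have cS: "compactin T S" using S(1,2) finite_imp_compactin[of S T] by (simp add: topspace_eq_carrier)
  obtain V where V: "subgroup V G" "openin T V" "V \<subseteq> U" "U \<subseteq> normzr V"
    "\<And>g. g \<in> S \<Longrightarrow> \<exists>B. subgroup B G \<and> V \<subseteq> B \<and> B \<subseteq> conjg g ` U \<and>
        conjg g ` U \<subseteq> normzr B \<and> B \<subseteq> normzr V"
    by (rule open_subnormal_in_conjugates[OF U cS], rule that)
  have clV: "closedin T V" by (rule open_subgroup_closed[OF V(1,2)])
  define K where "K = p_residual p V"
  have K: "subgroup K G" "closedin T K" "K \<subseteq> V" "\<And>x. x \<in> V \<Longrightarrow> p_regular p x \<Longrightarrow> x \<in> K"
    unfolding K_def by (fact p_residual_props[OF V(1) clV])+
  have KU: "K \<subseteq> U" using K(3) V(3) by blast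
  have cK: "compactin T K" using closed_compactin[OF U(3) KU K(2)] .
  have UK: "U \<subseteq> normzr K"
    unfolding K_def
  proof (rule p_residual_normalized[OF V(1) clV U(1)])
    fix a x assume "a \<in> U" "x \<in> V"
    then show "conjg a x \<in> V" using normzrD[of a V x] V(4) sg_carrier[OF V(1)] by blast
  qed
  have SK: "conjg g ` L \<subseteq> normzr K" if g: "g \<in> S" for g
  proof -
    have gc: "g \<in> carrier G" using g S(2) by blast
    have sL: "subgroup (conjg g ` L) G" by (rule subgroup_conjg[OF gc L(1)])
    obtain B where B: "subgroup B G" "V \<subseteq> B" "B \<subseteq> conjg g ` U" "conjg g ` U \<subseteq> normzr B" "B \<subseteq> normzr V"
      using V(5)[OF g] by blast
    have 1: "conjg g ` L \<subseteq> conjg g ` U" using L(3) by blast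
    have 2: "conjg g ` U \<subseteq> normzr (conjg g ` L)" by (rule conjg_image_normzr[OF gc Lc L(4)])
    have 3: "p_element p x" if "x \<in> conjg g ` L" for x
      using that p_element_conjg[OF L(6) gc] Lc by blast
    show ?thesis
      unfolding K_def
    proof (rule p_residual_normalized[OF V(1) clV sL])
      fix a x assume ax: "a \<in> conjg g ` L" "x \<in> V" "p_regular p x"
      show "conjg a x \<in> V"
        by (rule p_regular_conjugate_stays[OF V(1,2) B(1,2,5,3,4) sL 1 2 _ ax]) (rule 3)
    qed
  qed
  have "(\<Union>g\<in>S. conjg g ` L) \<subseteq> normzr K" using SK by blast
  then have "generate G (\<Union>g\<in>S. conjg g ` L) \<subseteq> normzr K"
    by (rule generate_subgroup_incl[OF _ subgroup_normzr])
  then have "U \<union> F \<subseteq> normzr K" using UK S(3) by blast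
  then have "finite K" by (rule F(3)[OF K(1) cK KU])
  then have fK: "finite (K - {\<one>})" by simp
  \<comment> \<open>All p-regular elements of \<open>V\<close> lie in the finite group
    \<open>K\<close>, so a subgroup of \<open>V\<close> that avoids its non-trivial elements has no
    p-regular element besides \<open>\<one>\<close>.\<close>
  obtain W where W: "subgroup W G" "openin T W" "compactin T W" "W \<subseteq> V" "W \<inter> (K - {\<one>}) = {}"
    by (rule compact_open_subgroup_avoiding[OF V(1,2) fK _ that]) simp
  have "x = \<one>" if "x \<in> W" "p_regular p x" for x using K(4)[of x] that W(4,5) by blast
  then have pW: "p_element p x" if "x \<in> W" for x
    using p_elements_if_no_p_regular[OF p W(1-3) _ that] by blast
  have "W \<subseteq> U" using W(4) V(3) by blast
  then show thesis using that W(1-3) pW by blast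
qed

end

section \<open>Minimal subnormal subgroups of a discrete subgroup\<close>

context group
begin

lemma min_subnormal_outside:
  assumes \<Gamma>: "subgroup \<Gamma> G" and U: "subgroup U G" and E: "E \<subseteq> carrier G"
    and A: "finite (\<Gamma> \<inter> U)" "\<Gamma> \<inter> U \<noteq> {\<one>}"
    and V: "subgroup V G" "V \<subseteq> U" "U \<subseteq> normzr V"
    and sub: "\<And>g. g \<in> U <#> (E <#> U) \<Longrightarrow> \<exists>B. subgroup B G \<and> V \<subseteq> B \<and> B \<subseteq> conjg g ` U \<and>
        conjg g ` U \<subseteq> normzr B \<and> B \<subseteq> normzr V"
    and inv_E: "m_inv G ` E \<subseteq> E"
    and dense: "\<And>q. q \<in> U <#> (E <#> U) \<Longrightarrow> \<exists>\<gamma>\<in>\<Gamma>. inv q \<otimes> \<gamma> \<in> U"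
    and core: "\<And>x. x \<in> carrier G \<Longrightarrow> (\<And>h. h \<in> generate G (U \<union> E) \<Longrightarrow> conjg (inv h) x \<in> U) \<Longrightarrow> x = \<one>"
  shows "\<exists>S. min_subnormal S (\<Gamma> \<inter> U) \<and> S \<inter> V = {\<one>}"
proof (rule ccontr)
  assume neg: "\<not> ?thesis"
  let ?A = "\<Gamma> \<inter> U" and ?Q = "U <#> (E <#> U)"
  have sA: "subgroup ?A G" by (rule subgroup_Int2[OF \<Gamma> U])
  have Uc: "U \<subseteq> carrier G" and \<Gamma>c: "\<Gamma> \<subseteq> carrier G" using sg_subset[OF U] sg_subset[OF \<Gamma>] .
  have sV: "subgroup (\<Gamma> \<inter> V) G" by (rule subgroup_Int2[OF \<Gamma> V(1)])
  have VA: "subnormal (\<Gamma> \<inter> V) ?A"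
  proof (rule normal_imp_subnormal[OF sV sA])
    show "\<Gamma> \<inter> V \<subseteq> ?A" using V(2) by blast
    show "?A \<subseteq> normzr (\<Gamma> \<inter> V)"
      using subgroup_subset_normzr[OF \<Gamma>] V(3) normzr_Int[of \<Gamma> V] by blast
  qed
  \<comment> \<open>\<open>S \<inter> V\<close> is subnormal in \<open>\<Gamma> \<inter> U\<close>,
    so by minimality it is trivial or all of \<open>S\<close>.\<close>
  have inV: "S \<subseteq> \<Gamma> \<inter> V" if S: "min_subnormal S ?A" for S
  proof -
    have SA: "subnormal S ?A" using S unfolding min_subnormal_def by blast
    have sS: "subgroup S G" "S \<subseteq> ?A" using subnormal_subgroups[OF SA] by blast+
    have "subnormal ((\<Gamma> \<inter> V) \<inter> S) (?A \<inter> S)" by (rule subnormal_Int[OF VA sS(1)])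
    moreover have "?A \<inter> S = S" "(\<Gamma> \<inter> V) \<inter> S = S \<inter> V" using sS(2) by blast+
    ultimately have "subnormal (S \<inter> V) S" by simp
    then have "subnormal (S \<inter> V) ?A" by (rule subnormal_trans[OF SA])
    moreover have "S \<inter> V \<noteq> {\<one>}" using neg S by blast
    ultimately have "S \<inter> V = S" using S unfolding min_subnormal_def by blast
    then show ?thesis using sS(2) by blast
  qed
  define M where "M = \<Union>{S. min_subnormal S ?A}"
  have Mc: "M \<subseteq> U" using inV V(2) unfolding M_def by blast
  have Mconj: "conjg (inv \<gamma>) x \<in> M" if \<gamma>: "\<gamma> \<in> \<Gamma>" "\<gamma> \<in> ?Q" and x: "x \<in> M" for \<gamma> x
  proof -
    obtain S where S: "min_subnormal S ?A" "x \<in> S" using x unfolding M_def by blast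
    have gc: "\<gamma> \<in> carrier G" using \<gamma>(1) \<Gamma>c by blast
    have g\<Gamma>: "conjg \<gamma> y \<in> \<Gamma> \<longleftrightarrow> y \<in> \<Gamma>" if "y \<in> carrier G" for y
      using subgroup_subset_normzr[OF \<Gamma>] \<gamma>(1) normzrD[of \<gamma> \<Gamma> y] that by blast
    have cA: "conjg \<gamma> ` ?A = \<Gamma> \<inter> conjg \<gamma> ` U"
    proof
      show "conjg \<gamma> ` ?A \<subseteq> \<Gamma> \<inter> conjg \<gamma> ` U" using g\<Gamma> \<Gamma>c by blast
      show "\<Gamma> \<inter> conjg \<gamma> ` U \<subseteq> conjg \<gamma> ` ?A" using g\<Gamma> Uc by blast
    qed
    obtain B where B: "subgroup B G" "V \<subseteq> B" "B \<subseteq> conjg \<gamma> ` U" "conjg \<gamma> ` U \<subseteq> normzr B" "B \<subseteq> normzr V"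
      using sub[OF \<gamma>(2)] by blast
    have sB: "subgroup (\<Gamma> \<inter> B) G" by (rule subgroup_Int2[OF \<Gamma> B(1)])
    have 1: "subnormal (\<Gamma> \<inter> V) (\<Gamma> \<inter> B)"
    proof (rule normal_imp_subnormal[OF sV sB])
      show "\<Gamma> \<inter> V \<subseteq> \<Gamma> \<inter> B" using B(2) by blast
      show "\<Gamma> \<inter> B \<subseteq> normzr (\<Gamma> \<inter> V)"
        using subgroup_subset_normzr[OF \<Gamma>] B(5) normzr_Int[of \<Gamma> V] by blast
    qed
    have 2: "subnormal (\<Gamma> \<inter> B) (conjg \<gamma> ` ?A)"
    proof (rule normal_imp_subnormal[OF sB subgroup_conjg[OF gc sA]])
      show "\<Gamma> \<inter> B \<subseteq> conjg \<gamma> ` ?A" unfolding cA using B(3) by blast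
      show "conjg \<gamma> ` ?A \<subseteq> normzr (\<Gamma> \<inter> B)"
        unfolding cA using subgroup_subset_normzr[OF \<Gamma>] B(4) normzr_Int[of \<Gamma> B] by blast
    qed
    \<comment> \<open>\<open>\<Gamma> \<inter> V\<close> is subnormal in
      \<open>\<Gamma> \<inter> U\<close> and in its conjugate by \<gamma>, so \<open>S\<close> is
      minimal subnormal in the conjugate too. Conjugating back gives another member of the
      family.\<close>
    have "min_subnormal S (conjg \<gamma> ` ?A)"
      by (rule min_subnormal_transfer[OF S(1) inV[OF S(1)] VA subnormal_trans[OF 2 1]])
    then have "min_subnormal (conjg (inv \<gamma>) ` S) (conjg (inv \<gamma>) ` conjg \<gamma> ` ?A)"
      by (rule min_subnormal_conjg) (use gc in simp)
    moreover have "conjg (inv \<gamma>) ` conjg \<gamma> ` ?A = ?A"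
      by (rule conjg_image_cancel[OF gc]) (use Uc in blast)
    ultimately show ?thesis using S(2) unfolding M_def by auto
  qed
  \<comment> \<open>\<open>U\<close> may fail to preserve \<open>M\<close>, so the invariant follows
    only the \<Gamma>-part of h. The factor u is absorbed at the end, because \<open>M\<close> lies
    in \<open>U\<close>.\<close>
  define P where "P h \<longleftrightarrow> (\<exists>\<gamma>\<in>\<Gamma>. \<exists>u\<in>U. h = \<gamma> \<otimes> u \<and> (\<forall>x\<in>M. conjg (inv \<gamma>) x \<in> M))" for h
  have one: "P \<one>"
    unfolding P_def using sg_one[OF \<Gamma>] sg_one[OF U] Mc Uc
    by (intro bexI[of _ \<one>]) auto
  have stepU: "P (h \<otimes> v)" if h: "P h" and v: "v \<in> U" for h v
  proof -
    obtain \<gamma> u where gu: "\<gamma> \<in> \<Gamma>" "u \<in> U" "h = \<gamma> \<otimes> u" "\<forall>x\<in>M. conjg (inv \<gamma>) x \<in> M"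
      using h unfolding P_def by blast
    have "h \<otimes> v = \<gamma> \<otimes> (u \<otimes> v)" using gu v Uc \<Gamma>c by (simp add: m_assoc subset_iff)
    then show ?thesis unfolding P_def using gu sg_mult[OF U gu(2) v] by blast
  qed
  have stepE: "P (h \<otimes> e)" if h: "P h" and e: "e \<in> E" for h e
  proof -
    obtain \<gamma> u where gu: "\<gamma> \<in> \<Gamma>" "u \<in> U" "h = \<gamma> \<otimes> u" "\<forall>x\<in>M. conjg (inv \<gamma>) x \<in> M"
      using h unfolding P_def by blast
    have c: "\<gamma> \<in> carrier G" "u \<in> carrier G" "e \<in> carrier G" using gu e E Uc \<Gamma>c by blast+
    have "u \<otimes> (e \<otimes> \<one>) \<in> ?Q" by (intro set_multI gu(2) e sg_one[OF U])
    then have q: "u \<otimes> e \<in> ?Q" using c by simp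
    \<comment> \<open>\<delta> imitates \<open>u \<otimes> e\<close> modulo \<open>U\<close>. It
      lies in \<open>u e U\<close>, hence in \<open>?Q\<close>, where conjugation by its inverse
      preserves \<open>M\<close>.\<close>
    obtain \<delta> where \<delta>: "\<delta> \<in> \<Gamma>" "inv (u \<otimes> e) \<otimes> \<delta> \<in> U" using dense[OF q] by blast
    let ?v = "inv (u \<otimes> e) \<otimes> \<delta>"
    have dc: "\<delta> \<in> carrier G" using \<delta>(1) \<Gamma>c by blast
    have "u \<otimes> (e \<otimes> ?v) \<in> ?Q" by (intro set_multI gu(2) e \<delta>(2))
    moreover have "u \<otimes> (e \<otimes> ?v) = \<delta>" using c dc by (simp add: word_simps)
    ultimately have "\<delta> \<in> ?Q" by simp
    then have conj: "conjg (inv (\<gamma> \<otimes> \<delta>)) x \<in> M" if "x \<in> M" for x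
    proof -
      have xc: "x \<in> carrier G" using that Mc Uc by blast
      have "conjg (inv \<delta>) (conjg (inv \<gamma>) x) \<in> M"
        using Mconj[OF \<delta>(1) \<open>\<delta> \<in> ?Q\<close>] gu(4) that by blast
      then show ?thesis using c dc xc by (simp add: conjg_conjg inv_mult_group)
    qed
    have "h \<otimes> e = (\<gamma> \<otimes> \<delta>) \<otimes> inv ?v" using c dc by (simp add: gu(3) word_simps)
    then show ?thesis
      unfolding P_def using conj sg_mult[OF \<Gamma> gu(1) \<delta>(1)] sg_inv[OF U \<delta>(2)] by blast
  qed
  have UE: "U \<union> E \<subseteq> carrier G" using Uc E by blast
  have prod: "P h \<Longrightarrow> P (h \<otimes> x)" if "x \<in> generate G (U \<union> E)" "h \<in> carrier G" for x h
    using that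
  proof (induction arbitrary: h)
    case one
    then show ?case by simp
  next
    case (incl c)
    then show ?case using stepU stepE by blast
  next
    case (inv c)
    then show ?case using stepU[of h "inv c"] stepE[of h "inv c"] sg_inv[OF U] inv_E by blast
  next
    case (eng x y)
    then have xc: "x \<in> carrier G" "y \<in> carrier G" using generate_in_carrier[OF UE] by blast+
    have "P (h \<otimes> x)" using eng by blast
    then have "P (h \<otimes> x \<otimes> y)" using eng xc by simp
    then show ?case using xc eng.prems by (simp add: m_assoc)
  qed
  have all: "P h" if "h \<in> generate G (U \<union> E)" for h
    using prod[OF that one_closed one] generate_in_carrier[OF UE that] by simp
  have triv: "x = \<one>" if x: "x \<in> M" for x
  proof (rule core)
    show xc: "x \<in> carrier G" using x Mc Uc by blast
    fix h assume "h \<in> generate G (U \<union> E)"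
    then obtain \<gamma> u where gu: "\<gamma> \<in> \<Gamma>" "u \<in> U" "h = \<gamma> \<otimes> u" "\<forall>x\<in>M. conjg (inv \<gamma>) x \<in> M"
      using all unfolding P_def by blast
    have c: "\<gamma> \<in> carrier G" "u \<in> carrier G" using gu Uc \<Gamma>c by blast+
    have "conjg (inv \<gamma>) x \<in> U" using gu(4) x Mc by blast
    then have "conjg (inv u) (conjg (inv \<gamma>) x) \<in> U"
      using conjg_in_subgroup[OF U sg_inv[OF U gu(2)]] by blast
    then show "conjg (inv h) x \<in> U" using c xc by (simp add: gu(3) conjg_conjg inv_mult_group)
  qed
  obtain S where S: "min_subnormal S ?A" by (rule min_subnormal_exists[OF sA A], rule that)
  have "S \<subseteq> {\<one>}" using triv S unfolding M_def by blast
  moreover have "subgroup S G" using S subnormal_subgroups unfolding min_subnormal_def by blast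
  then have "\<one> \<in> S" by (rule sg_one)
  ultimately have "S = {\<one>}" by blast
  then show False using S unfolding min_subnormal_def by blast
qed

text \<open>Any non-trivial x in \<open>S\<close> lies outside \<open>V\<close>. In the abelian case
  x has order p, while some exponent m \<le> \<open>n\<close> brings x into \<open>V\<close>; by
  Bezout p divides m, so the bound \<open>n\<close> on these exponents also bounds p.\<close>

lemma min_subnormal_outside_cases:
  assumes min: "min_subnormal S A" "finite A" and V: "subgroup V G" "A \<subseteq> normzr V" "S \<inter> V = {\<one>}"
    and bound: "\<forall>x\<in>A. \<exists>m. 0 < m \<and> m \<le> (n::nat) \<and> x [^] m \<in> V"
  shows "\<exists>x\<in>A - V. (\<forall>k\<in>A \<inter> V. conjg k x = x) \<or>
    (\<exists>p\<le>n. prime p \<and> (\<exists>P. subgroup P G \<and> x \<in> P \<and> P \<subseteq> A \<and> A \<subseteq> normzr P \<and> p_power_into p {\<one>} P))"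
proof -
  have SA: "subnormal S A" using min unfolding min_subnormal_def by blast
  have S: "subgroup S G" "S \<subseteq> A" and A: "subgroup A G" using subnormal_subgroups[OF SA] by blast+
  obtain x where x: "x \<in> S" "x \<noteq> \<one>"
    using min(1) sg_one[OF S(1)] unfolding min_subnormal_def by blast
  have xAV: "x \<in> A - V" using x S(2) V(3) by blast
  have xc: "x \<in> carrier G" using sg_carrier[OF S(1) x(1)] .
  show ?thesis
  proof (cases "\<exists>a\<in>S. \<exists>b\<in>S. a \<otimes> b \<noteq> b \<otimes> a")
    case True
    then obtain a b where ab: "a \<in> S" "b \<in> S" "a \<otimes> b \<noteq> b \<otimes> a" by blast
    have "conjg k x = x" if k: "k \<in> A \<inter> V" for k
      by (rule min_subnormal_centralizes[OF min(1) V ab _ _ x(1)]) (use k in auto)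
    then show ?thesis using xAV by blast
  next
    case False
    then have comm: "\<And>a b. a \<in> S \<Longrightarrow> b \<in> S \<Longrightarrow> a \<otimes> b = b \<otimes> a" by blast
    obtain p :: nat where p: "prime p" "\<And>y. y \<in> S \<Longrightarrow> y [^] p = \<one>"
      by (rule min_subnormal_abelian_exponent[OF min comm]) (assumption | rule that)+
    obtain m where m: "0 < m" "m \<le> n" "x [^] m \<in> V" using bound xAV by blast
    have "p dvd m"
    proof (rule ccontr)
      assume "\<not> p dvd m"
      then have cop: "coprime p m" using prime_imp_coprime[OF p(1)] by blast
      have "x [^] p \<in> V" using p(2)[OF x(1)] sg_one[OF V(1)] by simp
      from pow_coprime_mem[OF V(1) xc this m(3) cop] show False using xAV by blast
    qed
    then have "p \<le> n" using m(1,2) dvd_imp_le le_trans by blast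
    moreover have "p_power_into p {\<one>} S"
      unfolding p_power_into_def
    proof
      fix y assume "y \<in> S"
      then have "y [^] (p ^ 1) = \<one>" using p(2) by simp
      then show "\<exists>k. y [^] (p ^ k) \<in> {\<one>}" by blast
    qed
    then obtain P where "subgroup P G" "S \<subseteq> P" "P \<subseteq> A" "A \<subseteq> normzr P" "p_power_into p {\<one>} P"
      using subnormal_p_subgroup_in_normal[OF SA] by blast
    ultimately show ?thesis using xAV x(1) p(1) by blast
  qed
qed

end

section \<open>Discrete subgroups and finite normal subgroups\<close>

context tdlc
begin

text \<open>\<open>\<Gamma>\<close> meets a small open subgroup \<open>W\<close> only in
  \<open>\<one>\<close>, so each of the finitely many cosets of \<open>W\<close> that cover
  \<open>U\<close> contains at most one element of \<open>\<Gamma>\<close>.\<close>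

lemma discrete_Int_compact_finite:
  assumes \<Gamma>: "subgroup \<Gamma> G" "discretein T \<Gamma>" and U: "compactin T U"
  shows "finite (\<Gamma> \<inter> U)"
proof -
  have d: "subtopology T \<Gamma> = discrete_topology \<Gamma>" using \<Gamma>(2) unfolding discretein_def by blast
  have "openin (subtopology T \<Gamma>) {\<one>}" unfolding d using sg_one[OF \<Gamma>(1)] by simp
  then obtain A where A: "openin T A" "{\<one>} = A \<inter> \<Gamma>" unfolding openin_subtopology by blast
  have oneA: "\<one> \<in> A" using A(2) by blast
  obtain W where W: "subgroup W G" "openin T W" "compactin T W" "W \<subseteq> A"
    by (rule van_Dantzig[OF A(1) oneA], rule that)
  obtain R where R: "finite R" "R \<subseteq> U" "\<And>c. c \<in> U \<Longrightarrow> \<exists>r\<in>R. inv r \<otimes> c \<in> W"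
    using compact_coset_cover[OF U W(1,2)] by blast
  have "\<forall>c\<in>\<Gamma> \<inter> U. \<exists>r. r \<in> R \<and> inv r \<otimes> c \<in> W" using R(3) by blast
  then obtain f where f: "\<And>c. c \<in> \<Gamma> \<inter> U \<Longrightarrow> f c \<in> R \<and> inv (f c) \<otimes> c \<in> W" by metis
  have "inj_on f (\<Gamma> \<inter> U)"
  proof (rule inj_onI)
    fix a b assume ab: "a \<in> \<Gamma> \<inter> U" "b \<in> \<Gamma> \<inter> U" "f a = f b"
    have c: "a \<in> carrier G" "b \<in> carrier G" "f a \<in> carrier G"
      using ab f[OF ab(1)] R(2) compactin_imp_carrier[OF U] by blast+
    have "inv (inv (f a) \<otimes> a) \<otimes> (inv (f a) \<otimes> b) \<in> W"
      using f[OF ab(1)] f[OF ab(2)] ab(3) sg_mult[OF W(1) sg_inv[OF W(1)]] by simp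
    moreover have "inv (inv (f a) \<otimes> a) \<otimes> (inv (f a) \<otimes> b) = inv a \<otimes> b" using c by (simp add: word_simps)
    moreover have "inv a \<otimes> b \<in> \<Gamma>" using ab sg_mult[OF \<Gamma>(1) sg_inv[OF \<Gamma>(1)]] by blast
    ultimately have "inv a \<otimes> b = \<one>" using W(4) A(2) by auto
    then have "a \<otimes> (inv a \<otimes> b) = a \<otimes> \<one>" by simp
    then show "a = b" using c by simp
  qed
  moreover have "f ` (\<Gamma> \<inter> U) \<subseteq> R" using f by blast
  ultimately show ?thesis using R(1) finite_subset finite_imageD by metis
qed

text \<open>The open subgroups normalised by \<open>U\<close> still form a neighbourhood basis of
  \<open>\<one>\<close>, since every open subgroup contains its core in \<open>U\<close>.\<close>

lemma eq_one_if_in_all: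
  assumes U: "subgroup U G" "compactin T U" and V: "subgroup V G" "openin T V" and x: "x \<in> carrier G"
    and all: "\<And>W. subgroup W G \<Longrightarrow> openin T W \<Longrightarrow> U \<subseteq> normzr W \<Longrightarrow> W \<subseteq> V \<Longrightarrow> x \<in> W"
  shows "x = \<one>"
proof (rule ccontr)
  assume "x \<noteq> \<one>"
  then have *: "finite {x}" "\<one> \<notin> {x}" by auto
  obtain W where W: "subgroup W G" "openin T W" "compactin T W" "W \<subseteq> V" "W \<inter> {x} = {}"
    by (rule compact_open_subgroup_avoiding[OF V *], rule that)
  have CW: "core U W \<subseteq> W" by (rule core_subset[OF sg_one[OF U(1)]])
  have "x \<in> core U W"
  proof (rule all)
    show "subgroup (core U W) G" by (rule subgroup_core[OF sg_subset[OF U(1)] W(1)])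
    show "openin T (core U W)" by (rule openin_core[OF U(2) W(1,2)])
    show "U \<subseteq> normzr (core U W)" by (rule subset_normzr_core[OF U(1)])
    show "core U W \<subseteq> V" using CW W(4) by blast
  qed
  then show False using CW W(5) by blast
qed

text \<open>\<open>U\<close> permutes the finite set \<open>L\<close> by conjugation, and for a
  small open \<open>W\<close> the coset of x meets \<open>L\<close> only in x. Hence the stabiliser
  of x in \<open>U\<close>, which is its centraliser there, is open.\<close>

lemma finite_normal_quasi_central:
  assumes U: "subgroup U G" "openin T U" and L: "subgroup L G" "finite L" "L \<subseteq> U" "U \<subseteq> normzr L"
    and x: "x \<in> L"
  shows "x \<in> quasi_center"
proof -
  have xc: "x \<in> carrier G" using sg_carrier[OF L(1) x] .
  have Uc: "U \<subseteq> carrier G" using sg_subset[OF U(1)] .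
  let ?F = "(\<lambda>y. inv x \<otimes> y) ` (L - {x})"
  have F: "finite ?F" "\<one> \<notin> ?F"
  proof -
    show "finite ?F" using L(2) by simp
    show "\<one> \<notin> ?F"
    proof
      assume "\<one> \<in> ?F"
      then obtain y where y: "y \<in> L" "y \<noteq> x" "\<one> = inv x \<otimes> y" by blast
      have "y \<in> carrier G" using sg_carrier[OF L(1) y(1)] .
      then have "x \<otimes> (inv x \<otimes> y) = y" using xc by simp
      then show False using y(2) xc unfolding y(3)[symmetric] by simp
    qed
  qed
  obtain W where W: "subgroup W G" "openin T W" "compactin T W" "W \<subseteq> U" "W \<inter> ?F = {}"
    by (rule compact_open_subgroup_avoiding[OF U F], rule that)
  define Z where "Z = U \<inter> {u \<in> carrier G. conjg u x = x}"
  have "subgroup {u \<in> carrier G. conjg u x = x} G"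
  proof (rule subgroupI)
    show "{u \<in> carrier G. conjg u x = x} \<noteq> {}" using xc by (auto intro!: exI[of _ \<one>])
    show "inv u \<in> {u \<in> carrier G. conjg u x = x}" if "u \<in> {u \<in> carrier G. conjg u x = x}" for u
      using that conjg_fixes_inv[OF _ xc] by simp
    show "u \<otimes> v \<in> {u \<in> carrier G. conjg u x = x}"
      if "u \<in> {u \<in> carrier G. conjg u x = x}" "v \<in> {u \<in> carrier G. conjg u x = x}" for u v
      using that conjg_fixes_mult[OF _ _ xc] by simp
  qed auto
  then have Z: "subgroup Z G" unfolding Z_def by (rule subgroup_Int2[OF U(1)])
  have "Z = U \<inter> {u \<in> carrier G. inv x \<otimes> conjg u x \<in> W}"
  proof (intro subset_antisym subsetI)
    fix u assume "u \<in> Z"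
    then show "u \<in> U \<inter> {u \<in> carrier G. inv x \<otimes> conjg u x \<in> W}"
      unfolding Z_def using xc sg_one[OF W(1)] by simp
  next
    fix u assume u: "u \<in> U \<inter> {u \<in> carrier G. inv x \<otimes> conjg u x \<in> W}"
    have "conjg u x \<in> L" using normzrD[of u L x] L(4) x xc u by blast
    then have "conjg u x = x" using u W(5) by blast
    then show "u \<in> Z" unfolding Z_def using u by blast
  qed
  moreover have "openin T {u \<in> carrier G. inv x \<otimes> conjg u x \<in> W}"
    by (rule openin_preimage[OF _ W(2)])
      (intro continuous_map_mult continuous_map_const_carrier continuous_translate(4), use xc in simp_all)
  ultimately have "openin T Z" using U(2) by auto
  moreover have "\<forall>w\<in>Z. conjg x w = w"
  proof
    fix w assume "w \<in> Z"
    then have "w \<in> carrier G" "conjg w x = x" unfolding Z_def by blast+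
    then show "conjg x w = w" using conjg_eq_iff_commute[of w x] conjg_eq_iff_commute[of x w] xc by simp
  qed
  ultimately show ?thesis using xc Z unfolding quasi_center_def by blast
qed

end

section \<open>Limits of discrete subgroups\<close>

text \<open>The basic open set with empty compact part and a single open set. This is the form in
  which the Chabauty limit enters everything below.\<close>

lemma chabauty_limit_eventually_meets:
  assumes lim: "limitin (chabauty_topology G T) \<Gamma> H sequentially"
    and A: "openin T A" "H \<inter> A \<noteq> {}"
  shows "\<forall>\<^sub>F n in sequentially. \<Gamma> n \<inter> A \<noteq> {}"
proof -
  let ?B = "chabauty_basic_set G T {} {A}"
  have "H \<in> closed_subgroups G T"
    using limitin_topspace[OF lim] by (simp add: topspace_chabauty_topology)
  then have "H \<in> ?B" using A(2) by (simp add: chabauty_basic_set_def)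
  moreover have "openin (chabauty_topology G T) ?B"
    unfolding chabauty_topology_def
    by (rule topology_generated_by_Basis) (use A(1) in \<open>auto intro!: exI[of _ "{}"] exI[of _ "{A}"]\<close>)
  ultimately have "\<forall>\<^sub>F n in sequentially. \<Gamma> n \<in> ?B" using lim unfolding limitin_def by blast
  then show ?thesis by (rule eventually_mono) (simp add: chabauty_basic_set_def)
qed

context topological_group
begin

text \<open>Finitely many cosets of \<open>W\<close> cover \<open>C\<close>, each containing a point
  of \<open>H\<close>. Eventually \<open>\<Gamma> n\<close> meets all of them at once, so the
  approximation is uniform on \<open>C\<close>.\<close>

lemma eventually_approximates:
  assumes meets: "\<And>A. openin T A \<Longrightarrow> H \<inter> A \<noteq> {} \<Longrightarrow> \<forall>\<^sub>F n in sequentially. \<Gamma> n \<inter> A \<noteq> {}"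
    and C: "compactin T C" "C \<subseteq> H" and W: "subgroup W G" "openin T W"
  shows "\<forall>\<^sub>F n in sequentially. \<forall>c\<in>C. \<exists>\<gamma>\<in>\<Gamma> n. inv c \<otimes> \<gamma> \<in> W"
proof -
  have Cc: "C \<subseteq> carrier G" using compactin_imp_carrier[OF C(1)] .
  obtain R where R: "finite R" "R \<subseteq> C" "\<And>c. c \<in> C \<Longrightarrow> \<exists>r\<in>R. inv r \<otimes> c \<in> W"
    using compact_coset_cover[OF C(1) W] by blast
  let ?A = "\<lambda>r. {z \<in> carrier G. inv r \<otimes> z \<in> W}"
  have "\<forall>\<^sub>F n in sequentially. \<Gamma> n \<inter> ?A r \<noteq> {}" if r: "r \<in> R" for r
  proof (rule meets)
    have rc: "r \<in> carrier G" using r R(2) Cc by blast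
    show "openin T (?A r)" using rc by (intro openin_preimage continuous_translate(1) W(2)) simp
    have "r \<in> ?A r" using rc sg_one[OF W(1)] by simp
    then show "H \<inter> ?A r \<noteq> {}" using r R(2) C(2) by blast
  qed
  then have "\<forall>\<^sub>F n in sequentially. \<forall>r\<in>R. \<Gamma> n \<inter> ?A r \<noteq> {}"
    by (intro eventually_ball_finite[OF R(1)] ballI)
  then show ?thesis
  proof (rule eventually_mono)
    fix n assume n: "\<forall>r\<in>R. \<Gamma> n \<inter> ?A r \<noteq> {}"
    show "\<forall>c\<in>C. \<exists>\<gamma>\<in>\<Gamma> n. inv c \<otimes> \<gamma> \<in> W"
    proof
      fix c assume c: "c \<in> C"
      obtain r where r: "r \<in> R" "inv r \<otimes> c \<in> W" using R(3)[OF c] by blast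
      obtain \<gamma> where g: "\<gamma> \<in> \<Gamma> n" "\<gamma> \<in> carrier G" "inv r \<otimes> \<gamma> \<in> W" using n r(1) by blast
      have cc: "r \<in> carrier G" "c \<in> carrier G" using r(1) R(2) c Cc by blast+
      have "inv (inv r \<otimes> c) \<otimes> (inv r \<otimes> \<gamma>) \<in> W" by (rule sg_mult[OF W(1) sg_inv[OF W(1) r(2)] g(3)])
      moreover have "inv (inv r \<otimes> c) \<otimes> (inv r \<otimes> \<gamma>) = inv c \<otimes> \<gamma>" using cc g(2) by (simp add: word_simps)
      ultimately show "\<exists>\<gamma>\<in>\<Gamma> n. inv c \<otimes> \<gamma> \<in> W" using g(1) by auto
    qed
  qed
qed

end

text \<open>The setting in which properties of elements of \<open>\<Gamma> n \<inter> U\<close>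
  outside \<open>V\<close> are carried over to \<open>U\<close>: for large n every point of
  \<open>U\<close> is an element of \<open>\<Gamma> n\<close> up to a factor from a prescribed open
  subgroup.\<close>

locale approximated_subgroup = tdlc +
  fixes U V :: "'a set" and \<Gamma> :: "nat \<Rightarrow> 'a set"
  assumes U: "subgroup U G" "openin T U" "compactin T U"
    and V: "subgroup V G" "openin T V" "V \<subseteq> U" "U \<subseteq> normzr V"
    and \<Gamma>: "\<And>n. subgroup (\<Gamma> n) G"
    and approx: "\<And>W. subgroup W G \<Longrightarrow> openin T W \<Longrightarrow> \<forall>\<^sub>F n in sequentially. \<forall>u\<in>U. \<exists>\<gamma>\<in>\<Gamma> n. inv u \<otimes> \<gamma> \<in> W"
begin

text \<open>A neighbourhood basis of \<open>\<one>\<close> modulo which to compute: each member is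
  normal in \<open>U\<close>, and its inclusion in \<open>V\<close> makes \<open>U - V\<close> a
  union of its cosets.\<close>

definition small :: "'a set set" where
  "small = {W. subgroup W G \<and> openin T W \<and> U \<subseteq> normzr W \<and> W \<subseteq> V}"

lemma V_small: "V \<in> small"
  using V by (simp add: small_def)

lemma small_Int: "W \<in> small \<Longrightarrow> W' \<in> small \<Longrightarrow> W \<inter> W' \<in> small"
  unfolding small_def using subgroup_Int2[of W W'] normzr_Int[of W W'] by blast

lemma U_carrier: "U \<subseteq> carrier G"
  using sg_subset[OF U(1)] .

lemma smallD:
  assumes "W \<in> small"
  shows "subgroup W G" "openin T W" "U \<subseteq> normzr W" "W \<subseteq> V" "W \<subseteq> U"
  using assms V(3) unfolding small_def by blast+

text \<open>Compactness of \<open>U - V\<close> turns approximate solutions, one modulo each small \<open>W\<close>, into a solution.\<close>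

lemma limit_point:
  assumes mult: "\<And>W x w. W \<in> small \<Longrightarrow> x \<in> U - V \<Longrightarrow> P W x \<Longrightarrow> w \<in> W \<Longrightarrow> P W (x \<otimes> w)"
    and mono: "\<And>W W' x. W \<in> small \<Longrightarrow> W' \<in> small \<Longrightarrow> W \<subseteq> W' \<Longrightarrow> x \<in> U - V \<Longrightarrow> P W x \<Longrightarrow> P W' x"
    and ex: "\<And>W. W \<in> small \<Longrightarrow> \<exists>x\<in>U - V. P W x"
  shows "\<exists>x\<in>U - V. \<forall>W\<in>small. P W x"
proof -
  let ?F = "\<lambda>W. {x \<in> U - V. P W x}"
  obtain x where x: "x \<in> U" "\<And>W. W \<in> small \<Longrightarrow> x \<in> ?F W"
  proof (rule compactin_directed_Inter[OF U(3), of small ?F])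
    show "small \<noteq> {}" using V_small by blast
    show "closedin T (?F W)" if W: "W \<in> small" for W
    proof (rule coset_invariant_closed[OF smallD(1,2)[OF W]])
      show "?F W \<subseteq> carrier G" using U_carrier by blast
      fix x w assume x: "x \<in> ?F W" and w: "w \<in> W"
      have wU: "w \<in> U" "w \<in> V" using w smallD[OF W] by blast+
      have c: "x \<in> carrier G" "w \<in> carrier G" using x wU U_carrier by blast+
      have "x \<otimes> w \<in> U" using x wU sg_mult[OF U(1)] by blast
      moreover have "x \<otimes> w \<notin> V"
      proof
        assume "x \<otimes> w \<in> V"
        from sg_mult[OF V(1) this sg_inv[OF V(1) wU(2)]] show False using c x by (simp add: m_assoc)
      qed
      ultimately show "x \<otimes> w \<in> ?F W" using mult[OF W _ _ w] x by blast
    qed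
    show "U \<inter> ?F W \<noteq> {}" if "W \<in> small" for W using ex[OF that] by blast
    show "\<exists>W''\<in>small. ?F W'' \<subseteq> ?F W \<inter> ?F W'" if W: "W \<in> small" "W' \<in> small" for W W'
    proof
      show "W \<inter> W' \<in> small" by (rule small_Int[OF W])
      then show "?F (W \<inter> W') \<subseteq> ?F W \<inter> ?F W'"
        using mono[OF _ W(1)] mono[OF _ W(2)] by blast
    qed
    fix x assume "x \<in> U" "\<And>W. W \<in> small \<Longrightarrow> x \<in> ?F W"
    then show thesis by (rule that)
  qed
  have "x \<in> U - V" using x(2)[OF V_small] by blast
  then show ?thesis using x(2) by blast
qed

lemma frequently_good:
  assumes "\<exists>\<^sub>F n in sequentially. Q n" "W \<in> small"
  obtains n where "Q n" "\<And>u. u \<in> U \<Longrightarrow> \<exists>\<gamma>\<in>\<Gamma> n. inv u \<otimes> \<gamma> \<in> W"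
proof -
  have "\<exists>\<^sub>F n in sequentially. Q n \<and> (\<forall>u\<in>U. \<exists>\<gamma>\<in>\<Gamma> n. inv u \<otimes> \<gamma> \<in> W)"
    using frequently_eventually_frequently[OF assms(1) approx[OF smallD(1,2)[OF assms(2)]]] .
  then obtain n where "Q n \<and> (\<forall>u\<in>U. \<exists>\<gamma>\<in>\<Gamma> n. inv u \<otimes> \<gamma> \<in> W)" using frequently_ex by blast
  then show thesis using that by blast
qed

text \<open>Modulo \<open>W\<close> every element of \<open>V\<close> is one of
  \<open>\<Gamma> n \<inter> V\<close>, and these commute with x. So some x outside \<open>V\<close>
  centralises \<open>V\<close> modulo \<open>W\<close>, for each small \<open>W\<close>, and the
  limit point centralises \<open>V\<close> exactly.\<close>

lemma limit_centralizing:
  assumes freq: "\<exists>\<^sub>F n in sequentially. \<exists>x\<in>\<Gamma> n \<inter> U - V. \<forall>k\<in>\<Gamma> n \<inter> U \<inter> V. conjg k x = x"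
  shows "\<exists>x\<in>U - V. x \<in> quasi_center"
proof -
  let ?P = "\<lambda>W x. \<forall>k\<in>V. inv x \<otimes> conjg k x \<in> W"
  have Vc: "V \<subseteq> carrier G" using sg_subset[OF V(1)] .
  have "\<exists>x\<in>U - V. \<forall>W\<in>small. ?P W x"
  proof (rule limit_point)
    fix W x w assume W: "W \<in> small" and x: "x \<in> U - V" "?P W x" and w: "w \<in> W"
    show "?P W (x \<otimes> w)"
    proof
      fix k assume k: "k \<in> V"
      have c: "k \<in> carrier G" "x \<in> carrier G" "w \<in> carrier G"
        using k x w Vc U_carrier smallD(4)[OF W] by blast+
      have "conjg k w \<in> W" using normzrD[of k W w] smallD(3)[OF W] k V(3) w c by blast
      then have "inv w \<otimes> ((inv x \<otimes> conjg k x) \<otimes> conjg k w) \<in> W"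
        using x(2) k sg_mult[OF smallD(1)[OF W]] sg_inv[OF smallD(1)[OF W] w] by blast
      moreover have "inv w \<otimes> ((inv x \<otimes> conjg k x) \<otimes> conjg k w) = inv (x \<otimes> w) \<otimes> conjg k (x \<otimes> w)"
        using c by (simp add: conjg_def word_simps)
      ultimately show "inv (x \<otimes> w) \<otimes> conjg k (x \<otimes> w) \<in> W" by simp
    qed
  next
    fix W W' x assume "W \<subseteq> W'" "?P W x"
    then show "?P W' x" by blast
  next
    fix W assume W: "W \<in> small"
    obtain n where n: "\<exists>x\<in>\<Gamma> n \<inter> U - V. \<forall>k\<in>\<Gamma> n \<inter> U \<inter> V. conjg k x = x"
      "\<And>u. u \<in> U \<Longrightarrow> \<exists>\<gamma>\<in>\<Gamma> n. inv u \<otimes> \<gamma> \<in> W"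
      by (rule frequently_good[OF freq W]) (use that in blast)
    obtain x where x: "x \<in> \<Gamma> n \<inter> U - V" "\<forall>k\<in>\<Gamma> n \<inter> U \<inter> V. conjg k x = x" using n(1) by blast
    have xc: "x \<in> carrier G" using x U_carrier by blast
    have "inv x \<otimes> conjg k x \<in> W" if k: "k \<in> V" for k
    proof -
      have kc: "k \<in> carrier G" "k \<in> U" using k Vc V(3) by blast+
      obtain \<gamma> where g: "\<gamma> \<in> \<Gamma> n" "inv k \<otimes> \<gamma> \<in> W" using n(2)[OF kc(2)] by blast
      define w where "w = inv k \<otimes> \<gamma>"
      have gc: "\<gamma> \<in> carrier G" using sg_carrier[OF \<Gamma> g(1)] .
      have w: "w \<in> W" "w \<in> V" using g(2) smallD(4)[OF W] unfolding w_def by blast+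
      have wc: "w \<in> carrier G" using w Vc by blast
      have gk: "\<gamma> = k \<otimes> w" using kc gc unfolding w_def by simp
      have gV: "\<gamma> \<in> V" unfolding gk by (rule sg_mult[OF V(1) k w(2)])
      then have gx: "conjg \<gamma> x = x" using x(2) g(1) V(3) by blast
      have "conjg (inv x) (inv w) \<in> W"
        using normzrD[of "inv x" W "inv w"] smallD(3)[OF W] sg_inv[OF U(1), of x] x(1)
          sg_inv[OF smallD(1)[OF W] w(1)] wc by blast
      then have "conjg (inv x) (inv w) \<otimes> w \<in> W" using sg_mult[OF smallD(1)[OF W] _ w(1)] by blast
      then have "conjg \<gamma> (conjg (inv x) (inv w) \<otimes> w) \<in> W"
        using normzrD[of \<gamma> W "conjg (inv x) (inv w) \<otimes> w"] smallD(3)[OF W] gV V(3) wc xc by blast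
      moreover have "conjg \<gamma> (conjg (inv x) (inv w) \<otimes> w) = inv (conjg \<gamma> x) \<otimes> conjg (\<gamma> \<otimes> inv w) x"
        using gc wc xc by (simp add: conjg_def word_simps)
      moreover have "\<gamma> \<otimes> inv w = k" using gk kc wc by (simp add: m_assoc)
      ultimately show ?thesis using gx by simp
    qed
    then show "\<exists>x\<in>U - V. ?P W x" using x(1) by blast
  qed
  then obtain x where x: "x \<in> U - V" "\<And>W. W \<in> small \<Longrightarrow> ?P W x" by blast
  have xc: "x \<in> carrier G" using x(1) U_carrier by blast
  have "conjg x k = k" if k: "k \<in> V" for k
  proof -
    have kc: "k \<in> carrier G" using k Vc by blast
    have "inv x \<otimes> conjg k x = \<one>"
    proof (rule eq_one_if_in_all[OF U(1,3) V(1,2)])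
      show "inv x \<otimes> conjg k x \<in> carrier G" using xc kc by simp
      fix W assume "subgroup W G" "openin T W" "U \<subseteq> normzr W" "W \<subseteq> V"
      then have "W \<in> small" unfolding small_def by blast
      then show "inv x \<otimes> conjg k x \<in> W" using x(2) k by blast
    qed
    then have "x \<otimes> (inv x \<otimes> conjg k x) = x" using xc by simp
    then have "conjg k x = x" using xc kc by simp
    then show ?thesis using conjg_eq_iff_commute[OF kc xc] conjg_eq_iff_commute[OF xc kc] by simp
  qed
  then have "x \<in> quasi_center" using xc V(1,2) unfolding quasi_center_def by blast
  then show ?thesis using x(1) by blast
qed

text \<open>Modulo \<open>W\<close> the groups \<open>\<Gamma> n \<inter> U\<close> and
  \<open>U\<close> agree, so \<open>P <#> W\<close> is normal in \<open>U\<close> and a p-group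
  modulo \<open>W\<close>. For the limit point x, \<open>L\<close> is the closed normal subgroup of
  \<open>U\<close> generated by x; it lies in every one of the open normal subgroups
  \<open>R\<close> obtained from the various \<open>W\<close>.\<close>

lemma limit_p_normal:
  assumes freq: "\<exists>\<^sub>F n in sequentially. \<exists>x\<in>\<Gamma> n \<inter> U - V. \<exists>P. subgroup P G \<and> x \<in> P \<and> P \<subseteq> \<Gamma> n \<inter> U \<and>
      \<Gamma> n \<inter> U \<subseteq> normzr P \<and> p_power_into p {\<one>} P"
  shows "\<exists>L. subgroup L G \<and> closedin T L \<and> L \<subseteq> U \<and> U \<subseteq> normzr L \<and> \<not> L \<subseteq> V \<and> (\<forall>x\<in>L. p_element p x)"
proof -
  let ?R = "\<lambda>W x R. subgroup R G \<and> W \<subseteq> R \<and> R \<subseteq> U \<and> U \<subseteq> normzr R \<and> x \<in> R \<and> p_power_into p W R"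
  have triv: "p_power_into p W W" if W: "W \<in> small" for W
    unfolding p_power_into_def
  proof
    fix x assume x: "x \<in> W"
    then have "x [^] (p ^ 0) = x" using sg_carrier[OF smallD(1)[OF W]] by simp
    then show "\<exists>k. x [^] (p ^ k) \<in> W" using x by metis
  qed
  have "\<exists>x\<in>U - V. \<forall>W\<in>small. \<exists>R. ?R W x R"
  proof (rule limit_point)
    fix W x w assume "\<exists>R. ?R W x R" "w \<in> W" "x \<in> U - V"
    then obtain R where R: "?R W x R" "w \<in> R" by blast
    then have "x \<otimes> w \<in> R" using sg_mult[of R x w] by blast
    then show "\<exists>R. ?R W (x \<otimes> w) R" using R(1) by blast
  next
    fix W W' x assume W: "W \<in> small" "W' \<in> small" "W \<subseteq> W'" and "\<exists>R. ?R W x R"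
    then obtain R where R: "subgroup R G" "W \<subseteq> R" "R \<subseteq> U" "U \<subseteq> normzr R" "x \<in> R" "p_power_into p W R"
      by blast
    have RW': "R \<subseteq> normzr W'" using R(3) smallD(3)[OF W(2)] by blast
    have s: "subgroup (R <#> W') G" by (rule subgroup_set_mult[OF R(1) smallD(1)[OF W(2)] RW'])
    have sub: "R \<subseteq> R <#> W'" "W' \<subseteq> R <#> W'" by (rule subset_set_mult[OF R(1) smallD(1)[OF W(2)]])+
    have RU: "R <#> W' \<subseteq> U"
      by (rule set_mult_subset[OF U(1)]) (use R(3) smallD(5)[OF W(2)] in blast)+
    have N: "U \<subseteq> normzr (R <#> W')"
      by (rule normzr_set_mult[OF R(1) smallD(1)[OF W(2)] R(4) smallD(3)[OF W(2)] U(1)])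
    have "p_power_into p W' R" using R(6) W(3) unfolding p_power_into_def by blast
    then have "p_power_into p W' (R <#> W')"
      by (rule p_power_into_set_mult[OF R(1) smallD(1)[OF W(2)] RW' _ triv[OF W(2)] order_refl])
    then show "\<exists>R. ?R W' x R" using s sub RU N R(5) by blast
  next
    fix W assume W: "W \<in> small"
    note sW = smallD[OF W]
    obtain n where n: "\<exists>x\<in>\<Gamma> n \<inter> U - V. \<exists>P. subgroup P G \<and> x \<in> P \<and> P \<subseteq> \<Gamma> n \<inter> U \<and>
        \<Gamma> n \<inter> U \<subseteq> normzr P \<and> p_power_into p {\<one>} P"
      "\<And>u. u \<in> U \<Longrightarrow> \<exists>\<gamma>\<in>\<Gamma> n. inv u \<otimes> \<gamma> \<in> W"
      by (rule frequently_good[OF freq W]) (use that in blast)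
    obtain x P where x: "x \<in> \<Gamma> n \<inter> U - V"
      and P: "subgroup P G" "x \<in> P" "P \<subseteq> \<Gamma> n \<inter> U" "\<Gamma> n \<inter> U \<subseteq> normzr P" "p_power_into p {\<one>} P"
      using n(1) by blast
    have PW: "P \<subseteq> normzr W" using P(3) sW(3) by blast
    have s: "subgroup (P <#> W) G" by (rule subgroup_set_mult[OF P(1) sW(1) PW])
    have sub: "P \<subseteq> P <#> W" "W \<subseteq> P <#> W" by (rule subset_set_mult[OF P(1) sW(1)])+
    have RU: "P <#> W \<subseteq> U"
      by (rule set_mult_subset[OF U(1)]) (use P(3) sW(5) in blast)+
    have "\<Gamma> n \<inter> U \<subseteq> normzr W" using sW(3) by blast
    then have \<Gamma>N: "\<Gamma> n \<inter> U \<subseteq> normzr (P <#> W)"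
      by (rule normzr_set_mult[OF P(1) sW(1) P(4) _ subgroup_Int2[OF \<Gamma> U(1)]])
    have N: "U \<subseteq> normzr (P <#> W)"
    proof
      fix u assume u: "u \<in> U"
      obtain \<gamma> where g: "\<gamma> \<in> \<Gamma> n" "inv u \<otimes> \<gamma> \<in> W" using n(2)[OF u] by blast
      let ?w = "inv u \<otimes> \<gamma>"
      have c: "u \<in> carrier G" "\<gamma> \<in> carrier G" using u U_carrier sg_carrier[OF \<Gamma> g(1)] by blast+
      have "u \<otimes> ?w \<in> U" using sg_mult[OF U(1) u] g(2) sW(5) by blast
      then have "\<gamma> \<in> \<Gamma> n \<inter> U" using g(1) c by simp
      then have 1: "\<gamma> \<in> normzr (P <#> W)" using \<Gamma>N by blast
      have "inv ?w \<in> P <#> W" using sg_inv[OF sW(1) g(2)] sub(2) by blast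
      then have "inv ?w \<in> normzr (P <#> W)" using subgroup_subset_normzr[OF s] by blast
      then have "\<gamma> \<otimes> inv ?w \<in> normzr (P <#> W)" using sg_mult[OF subgroup_normzr 1] by blast
      moreover have "\<gamma> \<otimes> inv ?w = u" using c by (simp add: word_simps)
      ultimately show "u \<in> normzr (P <#> W)" by simp
    qed
    have "p_power_into p W P" using P(5) sg_one[OF sW(1)] unfolding p_power_into_def by (metis singletonD)
    then have "p_power_into p W (P <#> W)"
      by (rule p_power_into_set_mult[OF P(1) sW(1) PW _ triv[OF W] order_refl])
    then have "?R W x (P <#> W)" using s sub RU N P(2) by blast
    then show "\<exists>x\<in>U - V. \<exists>R. ?R W x R" using x by blast
  qed
  then obtain x where x: "x \<in> U - V" "\<And>W. W \<in> small \<Longrightarrow> \<exists>R. ?R W x R" by blast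
  let ?C = "{C. subgroup C G \<and> closedin T C \<and> C \<subseteq> U \<and> U \<subseteq> normzr C \<and> x \<in> C}"
  define L where "L = \<Inter>?C"
  have UC: "U \<in> ?C"
    using U open_subgroup_closed[OF U(1,2)] subgroup_subset_normzr[OF U(1)] x(1) by blast
  have sL: "subgroup L G" unfolding L_def by (rule subgroups_Inter) (use UC in blast)+
  have cL: "closedin T L" unfolding L_def by (rule closedin_Inter) (use UC in blast)+
  have LU: "L \<subseteq> U" unfolding L_def using UC by blast
  have xL: "x \<in> L" unfolding L_def by blast
  have NL: "U \<subseteq> normzr L"
  proof (rule subgroup_subset_normzrI[OF U(1)])
    fix u y assume u: "u \<in> U" and y: "y \<in> L" "y \<in> carrier G"
    show "conjg u y \<in> L"
      unfolding L_def
    proof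
      fix C assume C: "C \<in> ?C"
      then have "y \<in> C" using y(1) unfolding L_def by blast
      then show "conjg u y \<in> C" using normzrD[of u C y] C u y(2) by blast
    qed
  qed
  have "p_element p y" if y: "y \<in> L" for y
    unfolding p_element_def
  proof (intro allI impI)
    fix N assume N: "subgroup N G" "openin T N"
    have s: "subgroup (N \<inter> V) G" "openin T (N \<inter> V)"
      using subgroup_Int2[OF N(1) V(1)] N(2) V(2) by blast+
    let ?W = "core U (N \<inter> V)"
    have W1: "?W \<subseteq> N \<inter> V" by (rule core_subset[OF sg_one[OF U(1)]])
    have "subgroup ?W G" by (rule subgroup_core[OF U_carrier s(1)])
    moreover have "openin T ?W" by (rule openin_core[OF U(3) s])
    moreover have "U \<subseteq> normzr ?W" by (rule subset_normzr_core[OF U(1)])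
    ultimately have W: "?W \<in> small" unfolding small_def using W1 by blast
    obtain R where R: "subgroup R G" "?W \<subseteq> R" "R \<subseteq> U" "U \<subseteq> normzr R" "x \<in> R" "p_power_into p ?W R"
      using x(2)[OF W] by blast
    have "openin T R" by (rule subgroup_over_open[OF smallD(1,2)[OF W] R(1,2)])
    then have "closedin T R" by (rule open_subgroup_closed[OF R(1)])
    then have "y \<in> R" using y R unfolding L_def by blast
    then show "\<exists>k. y [^] (p ^ k) \<in> N" using R(6) W1 unfolding p_power_into_def by blast
  qed
  then show ?thesis using sL cL LU NL xL x(1) by blast
qed

end

section \<open>Existence of an open pro-p subgroup in an approximable subgroup\<close>

context qjnc_group
begin

lemma approximable_imp_open_p_subgroup:
  assumes H: "subgroup H G" "openin T H" and R: "finite R" "R \<subseteq> carrier G"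
    and cov: "\<And>g. g \<in> carrier G \<Longrightarrow> \<exists>r\<in>R. \<exists>h\<in>H. g = r \<otimes> h"
    and \<Gamma>: "\<And>n. subgroup (\<Gamma> n) G" "\<And>n. discretein T (\<Gamma> n)"
    and meets: "\<And>A. openin T A \<Longrightarrow> H \<inter> A \<noteq> {} \<Longrightarrow> \<forall>\<^sub>F n in sequentially. \<Gamma> n \<inter> A \<noteq> {}"
  obtains p W where "prime p" "subgroup W G" "openin T W" "compactin T W" "W \<subseteq> H"
    "\<forall>x\<in>W. p_element p x"
proof -
  have Hc: "H \<subseteq> carrier G" using sg_subset[OF H(1)] .
  have oneH: "\<one> \<in> H" by (rule sg_one[OF H(1)])
  obtain U1 where U1: "subgroup U1 G" "openin T U1" "U1 \<inter> quasi_center = {\<one>}"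
    by (rule quasi_center_discrete, rule that)
  obtain U0 where U0: "subgroup U0 G" "openin T U0" "compactin T U0" "U0 \<subseteq> H"
    by (rule van_Dantzig[OF H(2) oneH], rule that)
  \<comment> \<open>\<open>H\<close> normalises this compact core and has finite index, so the core
    is finite and \<open>U\<close> can be chosen to meet it trivially. Then no non-trivial element
    lies in all \<open>H\<close>-conjugates of \<open>U\<close>.\<close>
  let ?K = "core H U0"
  have KU0: "?K \<subseteq> U0" by (rule core_subset[OF oneH])
  have sK: "subgroup ?K G" by (rule subgroup_core[OF Hc U0(1)])
  have "closedin T ?K" by (rule closedin_core[OF open_subgroup_closed[OF U0(1,2)] _ Hc]) (use oneH in blast)
  then have cK: "compactin T ?K" by (rule closed_compactin[OF U0(3) KU0])
  have KH: "?K \<subseteq> H" using KU0 U0(4) by blast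
  have "finite ?K"
    by (rule finite_if_finite_index_normalizer[OF H R cov sK cK KH subset_normzr_core[OF H(1)]])
  then have fK: "finite (?K - {\<one>})" by simp
  have sU: "subgroup (U0 \<inter> U1) G" by (rule subgroup_Int2[OF U0(1) U1(1)])
  have oU: "openin T (U0 \<inter> U1)" using U0(2) U1(2) by blast
  obtain U where U: "subgroup U G" "openin T U" "compactin T U" "U \<subseteq> U0 \<inter> U1" "U \<inter> (?K - {\<one>}) = {}"
    by (rule compact_open_subgroup_avoiding[OF sU oU fK _ that]) simp
  have UH: "U \<subseteq> H" using U(4) U0(4) by blast
  have Uc: "U \<subseteq> carrier G" using UH Hc by blast
  have HU: "\<exists>h\<in>H. \<exists>u\<in>U. j = h \<otimes> u" if j: "j \<in> H" for j
    using sg_one[OF U(1)] j Hc by (intro bexI[of _ j] bexI[of _ \<one>]) auto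
  obtain E0 where E0: "finite E0" "E0 \<subseteq> H" "generate G (U \<union> E0) = H"
    by (rule finite_index_generators[OF cg H R cov U(1,2) UH order_refl HU]) (assumption | rule that)+
  define E where "E = E0 \<union> m_inv G ` E0"
  have E: "finite E" "E \<subseteq> H" "m_inv G ` E \<subseteq> E"
    using E0(1,2) sg_inv[OF H(1)] Hc unfolding E_def by auto
  have Ec: "E \<subseteq> carrier G" using E(2) Hc by blast
  have genE: "generate G (U \<union> E) = H"
  proof
    show "generate G (U \<union> E) \<subseteq> H" by (rule generate_subgroup_incl[OF _ H(1)]) (use UH E(2) in blast)
    have "U \<union> E0 \<subseteq> U \<union> E" unfolding E_def by blast
    from mono_generate[OF this] show "H \<subseteq> generate G (U \<union> E)" unfolding E0(3) .
  qed
  define Q where "Q = U <#> (E <#> U)"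
  have "compactin T E" using E(1) Ec finite_imp_compactin[of E T] by (simp add: topspace_eq_carrier)
  then have Q: "compactin T Q"
    unfolding Q_def by (intro compactin_set_mult U(3))
  have QH: "Q \<subseteq> H"
  proof
    fix q assume "q \<in> Q"
    then obtain u e v where "u \<in> U" "e \<in> E" "v \<in> U" "q = u \<otimes> (e \<otimes> v)"
      unfolding Q_def set_mult_def by blast
    then show "q \<in> H" using sg_mult[OF H(1), of u "e \<otimes> v"] sg_mult[OF H(1), of e v] UH E(2) by blast
  qed
  obtain V where V: "subgroup V G" "openin T V" "V \<subseteq> U" "U \<subseteq> normzr V"
    "\<And>g. g \<in> Q \<Longrightarrow> \<exists>B. subgroup B G \<and> V \<subseteq> B \<and> B \<subseteq> conjg g ` U \<and>
        conjg g ` U \<subseteq> normzr B \<and> B \<subseteq> normzr V"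
    by (rule open_subnormal_in_conjugates[OF U(1-3) Q], rule that)
  have app: "\<forall>\<^sub>F n in sequentially. \<forall>u\<in>U. \<exists>\<gamma>\<in>\<Gamma> n. inv u \<otimes> \<gamma> \<in> W" if "subgroup W G" "openin T W" for W
    by (rule eventually_approximates[OF meets U(3) UH that])
  interpret A: approximated_subgroup G T U V \<Gamma>
    by (rule approximated_subgroup.intro[OF tdlc_axioms], rule approximated_subgroup_axioms.intro)
      (fact U(1-3) V(1-4) \<Gamma>(1) | rule app, assumption, assumption)+
  \<comment> \<open>\<open>N\<close> depends on \<open>U\<close> and \<open>V\<close> but not on n,
    so the same finite set of primes serves all n.\<close>
  obtain N :: nat where N: "\<forall>x\<in>U. \<exists>m. 0 < m \<and> m \<le> N \<and> x [^] m \<in> V"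
    by (rule bounded_power_in_open_subgroup[OF U(1,3) V(1,2)], rule that)
  let ?b = "\<lambda>n. \<exists>x\<in>\<Gamma> n \<inter> U - V. \<forall>k\<in>\<Gamma> n \<inter> U \<inter> V. conjg k x = x"
  let ?a = "\<lambda>p n. \<exists>x\<in>\<Gamma> n \<inter> U - V. \<exists>P. subgroup P G \<and> x \<in> P \<and> P \<subseteq> \<Gamma> n \<inter> U \<and>
      \<Gamma> n \<inter> U \<subseteq> normzr P \<and> p_power_into p {\<one>} P"
  have cases: "?b n \<or> (\<exists>p\<in>{p. p \<le> N \<and> prime p}. ?a p n)"
    if d: "\<forall>q\<in>Q. \<exists>\<gamma>\<in>\<Gamma> n. inv q \<otimes> \<gamma> \<in> U" and ne: "\<Gamma> n \<inter> (U - {\<one>}) \<noteq> {}" for n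
  proof -
    have fin: "finite (\<Gamma> n \<inter> U)" by (rule discrete_Int_compact_finite[OF \<Gamma> U(3)])
    have "\<exists>S. min_subnormal S (\<Gamma> n \<inter> U) \<and> S \<inter> V = {\<one>}"
    proof (rule min_subnormal_outside[OF \<Gamma>(1) U(1) Ec fin _ V(1,3,4)])
      show "\<Gamma> n \<inter> U \<noteq> {\<one>}" using ne by blast
      show "m_inv G ` E \<subseteq> E" by (rule E(3))
      show "\<exists>B. subgroup B G \<and> V \<subseteq> B \<and> B \<subseteq> conjg g ` U \<and> conjg g ` U \<subseteq> normzr B \<and> B \<subseteq> normzr V"
        if "g \<in> U <#> (E <#> U)" for g using V(5)[of g] that unfolding Q_def by blast
      show "\<exists>\<gamma>\<in>\<Gamma> n. inv q \<otimes> \<gamma> \<in> U" if "q \<in> U <#> (E <#> U)" for q using that d unfolding Q_def by blast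
      fix x assume x: "x \<in> carrier G" "\<And>h. h \<in> generate G (U \<union> E) \<Longrightarrow> conjg (inv h) x \<in> U"
      have U': "conjg h x \<in> U" if h: "h \<in> H" for h
      proof -
        have "inv h \<in> generate G (U \<union> E)" unfolding genE by (rule sg_inv[OF H(1) h])
        from x(2)[OF this] show ?thesis using h Hc by (simp add: subset_iff)
      qed
      then have "x \<in> ?K" using x(1) U(4) unfolding core_def by blast
      moreover have "x \<in> U" using U'[OF oneH] x(1) by simp
      ultimately show "x = \<one>" using U(5) by blast
    qed
    then obtain S where S: "min_subnormal S (\<Gamma> n \<inter> U)" "S \<inter> V = {\<one>}" by blast
    have "\<Gamma> n \<inter> U \<subseteq> normzr V" using V(4) by blast
    moreover have "\<forall>x\<in>\<Gamma> n \<inter> U. \<exists>m. 0 < m \<and> m \<le> N \<and> x [^] m \<in> V" using N by blast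
    ultimately have "\<exists>x\<in>\<Gamma> n \<inter> U - V. (\<forall>k\<in>\<Gamma> n \<inter> U \<inter> V. conjg k x = x) \<or>
      (\<exists>p\<le>N. prime p \<and> (\<exists>P. subgroup P G \<and> x \<in> P \<and> P \<subseteq> \<Gamma> n \<inter> U \<and> \<Gamma> n \<inter> U \<subseteq> normzr P \<and>
        p_power_into p {\<one>} P))"
      by (rule min_subnormal_outside_cases[OF S(1) fin V(1) _ S(2)])
    then show ?thesis by blast
  qed
  have ev: "\<forall>\<^sub>F n in sequentially. ?b n \<or> (\<exists>p\<in>{p. p \<le> N \<and> prime p}. ?a p n)"
  proof -
    have 1: "\<forall>\<^sub>F n in sequentially. \<forall>q\<in>Q. \<exists>\<gamma>\<in>\<Gamma> n. inv q \<otimes> \<gamma> \<in> U"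
      by (rule eventually_approximates[OF meets Q QH U(1,2)])
    have 2: "\<forall>\<^sub>F n in sequentially. \<Gamma> n \<inter> (U - {\<one>}) \<noteq> {}"
    proof (rule meets)
      have "closedin T {\<one>}" using closedin_Hausdorff_singleton[OF Hausdorff] by (simp add: topspace_eq_carrier)
      then show "openin T (U - {\<one>})" using U(2) openin_diff by blast
      have "\<not> U \<subseteq> {\<one>}" using open_subgroup_infinite[OF U(1,2)] finite_subset[of U "{\<one>}"] by blast
      then show "H \<inter> (U - {\<one>}) \<noteq> {}" using UH by blast
    qed
    from eventually_conj[OF 1 2] show ?thesis
      by (rule eventually_mono) (elim conjE, rule cases)
  qed
  have noQZ: False if "x \<in> U - V" "x \<in> quasi_center" for x
  proof -
    have "x \<in> U1 \<inter> quasi_center" using that U(4) by blast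
    then have "x = \<one>" unfolding U1(3) by blast
    then show False using that(1) sg_one[OF V(1)] by blast
  qed
  have "\<not> (\<exists>\<^sub>F n in sequentially. ?b n)"
  proof
    assume "\<exists>\<^sub>F n in sequentially. ?b n"
    from A.limit_centralizing[OF this] show False using noQZ by blast
  qed
  then have nb: "\<forall>\<^sub>F n in sequentially. \<not> ?b n" unfolding frequently_def by simp
  have ea: "\<forall>\<^sub>F n in sequentially. \<exists>p\<in>{p. p \<le> N \<and> prime p}. ?a p n"
    using eventually_conj[OF ev nb] by (rule eventually_mono) blast
  \<comment> \<open>Almost every n has a prime from a finite set, so one prime occurs for infinitely
    many n.\<close>
  have "\<exists>p\<in>{p. p \<le> N \<and> prime p}. \<exists>\<^sub>F n in sequentially. ?a p n"
  proof (rule ccontr)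
    assume "\<not> ?thesis"
    then have "\<forall>p\<in>{p. p \<le> N \<and> prime p}. \<forall>\<^sub>F n in sequentially. \<not> ?a p n"
      unfolding frequently_def by simp
    then have "\<forall>\<^sub>F n in sequentially. \<forall>p\<in>{p. p \<le> N \<and> prime p}. \<not> ?a p n"
      by (intro eventually_ball_finite) auto
    from eventually_conj[OF ea this] have "\<forall>\<^sub>F n in sequentially. False"
      by (rule eventually_mono) blast
    then show False by simp
  qed
  then obtain p where p: "prime p" "\<exists>\<^sub>F n in sequentially. ?a p n" by blast
  obtain L where L: "subgroup L G" "closedin T L" "L \<subseteq> U" "U \<subseteq> normzr L" "\<not> L \<subseteq> V"
    "\<forall>x\<in>L. p_element p x"
    using A.limit_p_normal[OF p(2)] by blast
  have infL: "infinite L"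
  proof
    assume fin: "finite L"
    obtain x where x: "x \<in> L" "x \<notin> V" using L(5) by blast
    have "x \<in> quasi_center" by (rule finite_normal_quasi_central[OF U(1,2) L(1) fin L(3,4) x(1)])
    then show False using noQZ x L(3) by blast
  qed
  obtain W where W: "subgroup W G" "openin T W" "compactin T W" "W \<subseteq> U" "\<And>x. x \<in> W \<Longrightarrow> p_element p x"
    by (rule virtually_pro_p[OF p(1) U(1-3) L(1-4) infL]) (use L(6) that in blast)+
  have "W \<subseteq> H" using W(4) UH by blast
  then show thesis using that[OF p(1) W(1-3)] W(5) by blast
qed

end

section \<open>Finite generation of pro-p groups\<close>

context tdlc
begin

text \<open>Here powers of elements turn into orders: compactness makes the quotient finite, and
  each of its elements is killed by a p-power.\<close>

lemma quotient_p_group: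
  assumes p: "prime p" and V: "subgroup V G" "compactin T V" "\<And>x. x \<in> V \<Longrightarrow> p_element p x"
    and W: "W \<lhd> G\<lparr>carrier := V\<rparr>" "openin T W"
  shows "group (G\<lparr>carrier := V\<rparr> Mod W)" "finite (carrier (G\<lparr>carrier := V\<rparr> Mod W))"
    "\<exists>k. order (G\<lparr>carrier := V\<rparr> Mod W) = p ^ k"
proof -
  let ?V = "G\<lparr>carrier := V\<rparr>"
  interpret V: group ?V by (rule subgroup.subgroup_is_group[OF V(1) is_group])
  interpret W: normal W ?V by (rule W(1))
  have Vc: "V \<subseteq> carrier G" by (rule sg_subset[OF V(1)])
  have sW: "subgroup W G" by (rule incl_subgroup[OF V(1) W.subgroup_axioms])
  show gr: "group (?V Mod W)" by (rule W.factorgroup_is_group)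
  have car: "carrier (?V Mod W) = (\<lambda>v. W #>\<^bsub>?V\<^esub> v) ` V" by (simp add: carrier_FactGroup)
  have cos: "W #>\<^bsub>?V\<^esub> v = W #> v" for v by (simp add: r_coset_def)
  obtain R where R: "finite R" "R \<subseteq> V" "\<And>c. c \<in> V \<Longrightarrow> \<exists>r\<in>R. c \<otimes> inv r \<in> W"
    by (rule compact_coset_cover_right[OF V(2) sW W(2)], rule that)
  have "carrier (?V Mod W) \<subseteq> (\<lambda>v. W #> v) ` R"
  proof
    fix X assume "X \<in> carrier (?V Mod W)"
    then obtain v where v: "v \<in> V" "X = W #> v" unfolding car cos by blast
    obtain r where r: "r \<in> R" "v \<otimes> inv r \<in> W" using R(3)[OF v(1)] by blast
    have c: "r \<in> carrier G" "v \<in> carrier G" using v(1) r(1) R(2) Vc by blast+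
    have "(v \<otimes> inv r) \<otimes> r \<in> W #> r" using r(2) unfolding r_coset_def by blast
    then have "v \<in> W #> r" using c by (simp add: m_assoc)
    then have "W #> r = W #> v" by (rule repr_independence[OF _ c(1) sW])
    then show "X \<in> (\<lambda>v. W #> v) ` R" using v(2) r(1) by blast
  qed
  then show fin: "finite (carrier (?V Mod W))" using R(1) finite_surj by blast
  interpret Q: group "?V Mod W" by (rule gr)
  have hom: "(\<lambda>v. W #>\<^bsub>?V\<^esub> v) \<in> hom ?V (?V Mod W)" by (rule W.r_coset_hom_Mod)
  have "group_hom ?V (?V Mod W) (\<lambda>v. W #>\<^bsub>?V\<^esub> v)"
    by (rule group_hom.intro[OF V.is_group gr]) (rule group_hom_axioms.intro[OF hom])
  then interpret h: group_hom ?V "?V Mod W" "\<lambda>v. W #>\<^bsub>?V\<^esub> v" .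
  have "\<exists>k. X [^]\<^bsub>?V Mod W\<^esub> (p ^ k) = \<one>\<^bsub>?V Mod W\<^esub>" if X: "X \<in> carrier (?V Mod W)" for X
  proof -
    obtain v where v: "v \<in> V" "X = W #>\<^bsub>?V\<^esub> v" using X unfolding car by blast
    obtain k where k: "v [^] (p ^ k) \<in> W" using V(3)[OF v(1)] sW W(2) unfolding p_element_def by blast
    have "X [^]\<^bsub>?V Mod W\<^esub> (p ^ k) = W #>\<^bsub>?V\<^esub> (v [^]\<^bsub>?V\<^esub> (p ^ k))"
      unfolding v(2) by (rule h.hom_nat_pow[symmetric]) (use v(1) in simp)
    also have "v [^]\<^bsub>?V\<^esub> (p ^ k) = v [^] (p ^ k)" by (simp add: nat_pow_def)
    also have "W #>\<^bsub>?V\<^esub> (v [^] (p ^ k)) = W"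
      unfolding cos by (rule coset_join2[OF _ sW k]) (use v(1) Vc in auto)
    finally show ?thesis by (simp add: FactGroup_def) blast
  qed
  then have "Q.p_power_into p {\<one>\<^bsub>?V Mod W\<^esub>} (carrier (?V Mod W))"
    unfolding Q.p_power_into_def by blast
  then show "\<exists>k. order (?V Mod W) = p ^ k" by (rule Q.order_p_power[OF fin p])
qed

lemma pro_p_group_subgroup:
  assumes p: "prime p" and V: "subgroup V G" "openin T V" "compactin T V"
    "\<And>x. x \<in> V \<Longrightarrow> p_element p x"
  shows "pro_p_group p (G\<lparr>carrier := V\<rparr>) (subtopology T V)"
proof -
  let ?V = "G\<lparr>carrier := V\<rparr>" and ?T = "subtopology T V"
  have Vc: "V \<subseteq> carrier G" by (rule sg_subset[OF V(1)])
  have top: "topspace ?T = V" using Vc by (simp add: topspace_eq_carrier Int_absorb1)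
  have gV: "group ?V" by (rule subgroup.subgroup_is_group[OF V(1) is_group])
  have "topological_group ?V ?T"
  proof (rule topological_group.intro[OF gV], rule topological_group_axioms.intro)
    show "topspace ?T = carrier ?V" using top by simp
    have "continuous_map (prod_topology ?T ?T) T (\<lambda>(x, y). x \<otimes> y)"
    proof -
      have "continuous_map (prod_topology ?T ?T) T fst" "continuous_map (prod_topology ?T ?T) T snd"
        using continuous_map_into_fulltopology continuous_map_fst continuous_map_snd by blast+
      from continuous_map_mult[OF this] show ?thesis by (simp add: case_prod_beta')
    qed
    moreover have "(\<lambda>(x, y). x \<otimes> y) \<in> topspace (prod_topology ?T ?T) \<rightarrow> V"
      using sg_mult[OF V(1)] top by auto
    ultimately show "continuous_map (prod_topology ?T ?T) ?T (\<lambda>(x, y). x \<otimes>\<^bsub>?V\<^esub> y)"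
      by (simp add: continuous_map_in_subtopology image_subset_iff_funcset)
    have "continuous_map ?T T (m_inv G)"
      by (rule continuous_map_from_subtopology[OF continuous_inv])
    moreover have "m_inv G ` topspace ?T \<subseteq> V" using sg_inv[OF V(1)] top by auto
    ultimately have "continuous_map ?T ?T (m_inv G)"
      by (simp add: continuous_map_in_subtopology image_subset_iff_funcset)
    then show "continuous_map ?T ?T (\<lambda>x. inv\<^bsub>?V\<^esub> x)"
      by (rule continuous_map_eq) (use top m_inv_consistent[OF V(1)] in simp)
  qed
  moreover have "compact_space ?T" by (rule compact_space_subtopology[OF V(3)])
  moreover have "Hausdorff_space ?T" by (rule Hausdorff_space_subtopology[OF Hausdorff])
  moreover have "totally_disconnected_space ?T"
    using totally_disconnected unfolding totally_disconnected_space_def by (simp add: connectedin_subtopology)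
  moreover have "\<exists>k. order (?V Mod N) = p ^ k" if N: "N \<lhd> ?V" "openin ?T N" for N
  proof -
    have "openin T N" using openin_trans_full[OF N(2) V(2)] .
    from quotient_p_group(3)[OF p V(1,3) _ N(1) this] V(4) show ?thesis by blast
  qed
  ultimately show ?thesis using p unfolding pro_p_group_def profinite_group_def by blast
qed

section \<open>Maximal open subgroups and the Frattini subgroup\<close>

lemma normal_in_subgroupI:
  assumes V: "subgroup V G" and W: "subgroup W G" "W \<subseteq> V" "V \<subseteq> normzr W"
  shows "W \<lhd> G\<lparr>carrier := V\<rparr>"
proof -
  interpret V: group "G\<lparr>carrier := V\<rparr>" by (rule subgroup.subgroup_is_group[OF V is_group])
  have "subgroup W (G\<lparr>carrier := V\<rparr>)" by (rule subgroup_incl[OF W(1) V W(2)])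
  moreover have "x \<otimes>\<^bsub>G\<lparr>carrier := V\<rparr>\<^esub> h \<otimes>\<^bsub>G\<lparr>carrier := V\<rparr>\<^esub> inv\<^bsub>G\<lparr>carrier := V\<rparr>\<^esub> x \<in> W"
    if x: "x \<in> V" and h: "h \<in> W" for x h
  proof -
    have "conjg x h \<in> W" using normzrD[of x W h] W(3) x h sg_carrier[OF W(1) h] by blast
    then show ?thesis using m_inv_consistent[OF V x] by (simp add: conjg_def)
  qed
  ultimately show ?thesis unfolding V.normal_inv_iff by simp
qed

text \<open>Pulled back from the finite p-group \<open>V\<close> modulo \<open>W\<close>. As
  \<open>M\<close> contains \<open>W\<close>, it is the full preimage in \<open>V\<close> of its
  image, so an element of \<open>V\<close> normalising the image normalises
  \<open>M\<close>.\<close>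

lemma normalizer_grows:
  assumes p: "prime p" and V: "subgroup V G" "compactin T V" "\<And>x. x \<in> V \<Longrightarrow> p_element p x"
    and W: "subgroup W G" "openin T W" "V \<subseteq> normzr W" and M: "subgroup M G" "W \<subseteq> M" "M \<subseteq> V" "M \<noteq> V"
  shows "\<exists>y\<in>V - M. y \<in> normzr M"
proof -
  let ?V = "G\<lparr>carrier := V\<rparr>"
  have WV: "W \<subseteq> V" using M(2,3) by blast
  have nW: "W \<lhd> ?V" by (rule normal_in_subgroupI[OF V(1) W(1) WV W(3)])
  interpret V: group ?V by (rule subgroup.subgroup_is_group[OF V(1) is_group])
  interpret W: normal W ?V by (rule nW)
  let ?Q = "?V Mod W" and ?f = "\<lambda>v. W #> v"
  have Vc: "V \<subseteq> carrier G" by (rule sg_subset[OF V(1)])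
  have q: "group ?Q" "finite (carrier ?Q)" "\<exists>k. order ?Q = p ^ k"
    by (rule quotient_p_group[OF p V(1,2) _ nW W(2)], erule V(3))+
  interpret Q: group ?Q by (rule q(1))
  have cos: "W #>\<^bsub>?V\<^esub> v = ?f v" for v by (simp add: r_coset_def)
  have car: "carrier ?Q = ?f ` V" by (simp add: carrier_FactGroup cos)
  have hom: "?f \<in> hom ?V ?Q" using W.r_coset_hom_Mod unfolding cos .
  have "group_hom ?V ?Q ?f"
    by (rule group_hom.intro[OF V.is_group q(1)]) (rule group_hom_axioms.intro[OF hom])
  then interpret h: group_hom ?V ?Q ?f .
  have fmult: "?f (x \<otimes> y) = ?f x \<otimes>\<^bsub>?Q\<^esub> ?f y" if "x \<in> V" "y \<in> V" for x y
    using h.hom_mult[of x y] that by simp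
  have finv: "?f (inv x) = inv\<^bsub>?Q\<^esub> (?f x)" if "x \<in> V" for x
    using h.hom_inv[of x] that m_inv_consistent[OF V(1) that] by simp
  have fconj: "?f (conjg x y) = Q.conjg (?f x) (?f y)" if "x \<in> V" "y \<in> V" for x y
    using that sg_mult[OF V(1)] sg_inv[OF V(1)] unfolding conjg_def Q.conjg_def
    by (simp add: fmult finv)
  have fM: "x \<in> M \<longleftrightarrow> ?f x \<in> ?f ` M" if x: "x \<in> V" for x
  proof
    assume "?f x \<in> ?f ` M"
    then obtain m where m: "m \<in> M" "?f x = ?f m" by blast
    have "x \<in> ?f x" using rcos_self[OF _ W(1)] x Vc by blast
    then have "x \<in> ?f m" using m(2) by simp
    then obtain w where "w \<in> W" "x = w \<otimes> m" unfolding r_coset_def by blast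
    then show "x \<in> M" using m(1) M(2) sg_mult[OF M(1)] by blast
  qed blast
  have "subgroup M ?V" by (rule subgroup_incl[OF M(1) V(1) M(3)])
  then have sM: "subgroup (?f ` M) ?Q" by (rule h.subgroup_img_is_subgroup)
  obtain v where v: "v \<in> V" "v \<notin> M" using M(3,4) by blast
  have "?f ` M \<noteq> carrier ?Q" using fM[OF v(1)] v unfolding car by blast
  then obtain X where X: "X \<in> carrier ?Q - ?f ` M" "X \<in> Q.normzr (?f ` M)"
    using q(3) Q.p_group_normalizer_grows[OF q(2) p _ sM] by blast
  obtain y where y: "y \<in> V" "X = ?f y" using X(1) unfolding car by blast
  have yM: "y \<notin> M" using X(1) y(2) by blast
  have yc: "y \<in> carrier G" using y(1) Vc by blast
  have "conjg y x \<in> M \<longleftrightarrow> x \<in> M" if x: "x \<in> carrier G" for x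
  proof (cases "x \<in> V")
    case True
    have "conjg y x \<in> V" by (rule conjg_in_subgroup[OF V(1) y(1) True])
    moreover have "?f x \<in> carrier ?Q" unfolding car using True by blast
    ultimately show ?thesis
      using fM[OF True] fM[of "conjg y x"] fconj[OF y(1) True] Q.normzrD[OF X(2), of "?f x"] y(2) by simp
  next
    case False
    have "conjg y x \<notin> V"
    proof
      assume "conjg y x \<in> V"
      from conjg_in_subgroup[OF V(1) sg_inv[OF V(1) y(1)] this] show False using False x yc by simp
    qed
    then show ?thesis using False M(3) by blast
  qed
  then have "y \<in> normzr M" using yc unfolding normzr_def by blast
  then show ?thesis using y(1) yM by blast
qed

text \<open>Maximality gives \<open>V = generate G {z} <#> M\<close>, so modulo \<open>M\<close> the
  group \<open>V\<close> is cyclic, generated by an element with trivial p-th power; hence p-th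
  powers and commutators lie in \<open>M\<close>.\<close>

lemma normal_maximal_frattini:
  fixes p :: nat
  assumes V: "subgroup V G" and M: "subgroup M G" "M \<subseteq> V" "V \<subseteq> normzr M"
    and max: "\<And>M'. subgroup M' G \<Longrightarrow> M \<subseteq> M' \<Longrightarrow> M' \<subseteq> V \<Longrightarrow> M' \<noteq> M \<Longrightarrow> M' = V"
    and z: "z \<in> V" "z \<notin> M" "z [^] p \<in> M"
  shows "x \<in> V \<Longrightarrow> x [^] p \<in> M" "x \<in> V \<Longrightarrow> y \<in> V \<Longrightarrow> conjg x y \<otimes> inv y \<in> M"
proof -
  have zc: "z \<in> carrier G" using z(1) sg_carrier[OF V] by blast
  have Mc: "M \<subseteq> carrier G" by (rule sg_subset[OF M(1)])
  let ?Z = "generate G {z}"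
  have sZ: "subgroup ?Z G" by (rule generate_is_subgroup) (use zc in blast)
  have ZV: "?Z \<subseteq> V" by (rule generate_subgroup_incl[OF _ V]) (use z(1) in blast)
  have sZM: "subgroup (?Z <#> M) G" by (rule subgroup_set_mult[OF sZ M(1)]) (use ZV M(3) in blast)
  have sub: "?Z \<subseteq> ?Z <#> M" "M \<subseteq> ?Z <#> M" by (rule subset_set_mult[OF sZ M(1)])+
  have ZMV: "?Z <#> M \<subseteq> V"
    by (rule set_mult_subset[OF V]) (use ZV M(2) in blast)+
  have "z \<in> ?Z" by (rule generate.incl) simp
  then have "?Z <#> M \<noteq> M" using sub(1) z(2) by blast
  then have ZM: "?Z <#> M = V" by (rule max[OF sZM sub(2) ZMV])
  have rep: "\<exists>i::int. \<exists>m\<in>M. x = z [^] i \<otimes> m" if x: "x \<in> V" for x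
  proof -
    obtain a m where am: "a \<in> ?Z" "m \<in> M" "x = a \<otimes> m" using x ZM unfolding set_mult_def by blast
    then obtain i :: int where "a = z [^] i" using generate_pow[OF zc] by blast
    then show ?thesis using am by blast
  qed
  have zN: "z [^] (i::int) \<in> normzr M" for i
    using M(3) subgroup_int_pow_closed[OF V z(1)] by blast
  show "x [^] p \<in> M" if x: "x \<in> V"
  proof -
    obtain i :: int and m where im: "m \<in> M" "x = z [^] i \<otimes> m" using rep[OF x] by blast
    obtain m' where m': "m' \<in> M" "x [^] p = (z [^] i) [^] p \<otimes> m'"
      using mult_pow_mem_coset[OF M(1) zN im(1)] im(2) by blast
    have "(z [^] i) [^] p = (z [^] p) [^] i"
      using zc by (simp add: int_pow_pow mult.commute flip: int_pow_int)
    moreover have "(z [^] p) [^] i \<in> M" by (rule subgroup_int_pow_closed[OF M(1) z(3)])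
    ultimately show ?thesis using m' sg_mult[OF M(1)] by simp
  qed
  show "conjg x y \<otimes> inv y \<in> M" if x: "x \<in> V" and y: "y \<in> V"
  proof -
    obtain i :: int and m where im: "m \<in> M" "x = z [^] i \<otimes> m" using rep[OF x] by blast
    obtain j :: int and n where jn: "n \<in> M" "y = z [^] j \<otimes> n" using rep[OF y] by blast
    let ?a = "z [^] i" and ?b = "z [^] j"
    have c: "?a \<in> carrier G" "?b \<in> carrier G" "m \<in> carrier G" "n \<in> carrier G"
      using zc im(1) jn(1) Mc by auto
    have ab: "?a \<otimes> ?b = ?b \<otimes> ?a" 
      using int_pow_mult[OF zc, of i j] int_pow_mult[OF zc, of j i] by (simp add: add.commute[of i])
    have nz: "conjg (z [^] k) w \<in> M" if "w \<in> M" for k :: int and w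
      using normzrD[OF zN, of w] that Mc by blast
    have ib: "inv ?b = z [^] (- j)" using zc by (simp add: int_pow_neg)
    \<comment> \<open>Since \<open>?a\<close> and \<open>?b\<close> commute, the commutator of
      \<open>?a \<otimes> m\<close> and \<open>?b \<otimes> n\<close> can be written with elements
      of \<open>M\<close> and conjugations by powers of \<open>z\<close> alone. The expression is
      assembled from the inside.\<close>
    have "conjg (inv ?b) m \<otimes> n \<otimes> inv m \<in> M"
      unfolding ib using nz[OF im(1)] im(1) jn(1) by (intro sg_mult[OF M(1)] sg_inv[OF M(1)])
    then have "conjg ?a (conjg (inv ?b) m \<otimes> n \<otimes> inv m) \<otimes> inv n \<in> M"
      using nz jn(1) by (intro sg_mult[OF M(1)] sg_inv[OF M(1)])
    then have "conjg ?b (conjg ?a (conjg (inv ?b) m \<otimes> n \<otimes> inv m) \<otimes> inv n) \<in> M" by (rule nz)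
    moreover have "conjg ?b (conjg ?a (conjg (inv ?b) m \<otimes> n \<otimes> inv m) \<otimes> inv n) = conjg x y \<otimes> inv y"
    proof -
      have "conjg ?b (conjg ?a (conjg (inv ?b) m \<otimes> n \<otimes> inv m) \<otimes> inv n) =
        (?b \<otimes> ?a) \<otimes> inv ?b \<otimes> m \<otimes> ?b \<otimes> n \<otimes> inv m \<otimes> inv ?a \<otimes> inv n \<otimes> inv ?b"
        using c by (simp add: conjg_def word_simps)
      also have "\<dots> = (?a \<otimes> ?b) \<otimes> inv ?b \<otimes> m \<otimes> ?b \<otimes> n \<otimes> inv m \<otimes> inv ?a \<otimes> inv n \<otimes> inv ?b"
        using ab by simp
      also have "\<dots> = conjg x y \<otimes> inv y" using c by (simp add: im(2) jn(2) conjg_def word_simps)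
      finally show ?thesis .
    qed
    ultimately show ?thesis by simp
  qed
qed

text \<open>Finitely many cosets of \<open>W\<close> cover \<open>V\<close>, and a subgroup
  containing \<open>W\<close> equals a larger one if both meet the same cosets. So a proper subgroup
  over \<open>Q\<close> that meets as many cosets as possible is maximal.\<close>

lemma maximal_overgroup:
  assumes V: "subgroup V G" "compactin T V" and W: "subgroup W G" "openin T W"
    and Q: "subgroup Q G" "W \<subseteq> Q" "Q \<subseteq> V" "Q \<noteq> V"
  obtains M where "subgroup M G" "Q \<subseteq> M" "M \<subseteq> V" "M \<noteq> V"
    "\<And>M'. subgroup M' G \<Longrightarrow> M \<subseteq> M' \<Longrightarrow> M' \<subseteq> V \<Longrightarrow> M' \<noteq> M \<Longrightarrow> M' = V"
proof -
  obtain R where R: "finite R" "R \<subseteq> V" "\<And>c. c \<in> V \<Longrightarrow> \<exists>r\<in>R. inv r \<otimes> c \<in> W"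
    by (rule compact_coset_cover[OF V(2) W], rule that)
  have Vc: "V \<subseteq> carrier G" by (rule sg_subset[OF V(1)])
  define f where "f M = {r \<in> R. \<exists>m\<in>M. inv r \<otimes> m \<in> W}" for M
  have fin: "finite (f M)" for M using R(1) unfolding f_def by simp
  have inj: "M = M'" if M: "subgroup M G" "W \<subseteq> M" and M': "M \<subseteq> M'" "M' \<subseteq> V" and eq: "f M = f M'" for M M'
  proof
    show "M' \<subseteq> M"
    proof
      fix x assume x: "x \<in> M'"
      then have xc: "x \<in> carrier G" and xV: "x \<in> V" using M'(2) Vc by blast+
      obtain r where r: "r \<in> R" "inv r \<otimes> x \<in> W" using R(3)[OF xV] by blast
      then have "r \<in> f M" unfolding eq unfolding f_def using x by blast
      then obtain m where m: "m \<in> M" "inv r \<otimes> m \<in> W" unfolding f_def by blast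
      have c: "r \<in> carrier G" "m \<in> carrier G" using r(1) R(2) Vc m(1) sg_carrier[OF M(1)] by blast+
      have "inv (inv r \<otimes> m) \<otimes> (inv r \<otimes> x) \<in> M"
        using sg_mult[OF W(1) sg_inv[OF W(1) m(2)] r(2)] M(2) by blast
      from sg_mult[OF M(1) m(1) this] show "x \<in> M" using c xc by (simp add: word_simps)
    qed
  qed (rule M'(1))
  let ?P = "\<lambda>M. subgroup M G \<and> Q \<subseteq> M \<and> M \<subseteq> V \<and> M \<noteq> V"
  have bd: "\<forall>M. ?P M \<longrightarrow> card (f M) < Suc (card R)"
    using card_mono[OF R(1)] unfolding f_def by (simp add: less_Suc_eq_le)
  have "?P Q" using Q by blast
  from ex_has_greatest_nat[of ?P Q "\<lambda>M. card (f M)", OF this bd]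
  obtain M where M: "?P M" "\<And>M'. ?P M' \<Longrightarrow> card (f M') \<le> card (f M)" by blast
  show thesis
  proof (rule that)
    show "subgroup M G" "Q \<subseteq> M" "M \<subseteq> V" "M \<noteq> V" using M(1) by blast+
    fix M' assume M': "subgroup M' G" "M \<subseteq> M'" "M' \<subseteq> V" "M' \<noteq> M"
    show "M' = V"
    proof (rule ccontr)
      assume "M' \<noteq> V"
      then have "?P M'" using M' M(1) by blast
      then have "card (f M') \<le> card (f M)" by (rule M(2))
      moreover have "f M \<subseteq> f M'" using M'(2) unfolding f_def by blast
      ultimately have "f M = f M'" using card_seteq[OF fin] by blast
      moreover have "W \<subseteq> M" using Q(2) M(1) by blast
      ultimately have "M = M'" using inj[of M M'] M' M(1) by blast
      then show False using M'(4) by blast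
    qed
  qed
qed

text \<open>For a pro-p group \<open>V\<close> this is the Frattini subgroup, the intersection of
  the maximal open subgroups. Describing it by p-th powers and commutators makes \<open>V\<close>
  modulo it abelian of exponent dividing p by construction.\<close>

definition frattini :: "nat \<Rightarrow> 'a set \<Rightarrow> 'a set" where
  "frattini p V = \<Inter>{C. subgroup C G \<and> closedin T C \<and> C \<subseteq> V \<and> V \<subseteq> normzr C \<and>
     (\<forall>x\<in>V. x [^] p \<in> C) \<and> (\<forall>x\<in>V. \<forall>y\<in>V. conjg x y \<otimes> inv y \<in> C)}"

lemma frattini_props:
  assumes V: "subgroup V G" "closedin T V"
  shows "subgroup (frattini p V) G" "closedin T (frattini p V)" "frattini p V \<subseteq> V"
    "V \<subseteq> normzr (frattini p V)" "\<And>x. x \<in> V \<Longrightarrow> x [^] p \<in> frattini p V"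
    "\<And>x y. x \<in> V \<Longrightarrow> y \<in> V \<Longrightarrow> conjg x y \<otimes> inv y \<in> frattini p V"
proof -
  let ?C = "{C. subgroup C G \<and> closedin T C \<and> C \<subseteq> V \<and> V \<subseteq> normzr C \<and>
     (\<forall>x\<in>V. x [^] p \<in> C) \<and> (\<forall>x\<in>V. \<forall>y\<in>V. conjg x y \<otimes> inv y \<in> C)}"
  have VC: "V \<in> ?C"
    using V subgroup_subset_normzr[OF V(1)] subgroup_pow_closed[OF V(1)]
      sg_mult[OF V(1) conjg_in_subgroup[OF V(1)] sg_inv[OF V(1)]] by blast
  show "subgroup (frattini p V) G"
    unfolding frattini_def by (rule subgroups_Inter) (use VC in blast)+
  show "closedin T (frattini p V)"
    unfolding frattini_def by (rule closedin_Inter) (use VC in blast)+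
  show "frattini p V \<subseteq> V" unfolding frattini_def using VC by blast
  show "V \<subseteq> normzr (frattini p V)"
  proof (rule subgroup_subset_normzrI[OF V(1)])
    fix u y assume u: "u \<in> V" and y: "y \<in> frattini p V" "y \<in> carrier G"
    show "conjg u y \<in> frattini p V"
      unfolding frattini_def
    proof
      fix C assume C: "C \<in> ?C"
      then have "y \<in> C" using y(1) unfolding frattini_def by blast
      then show "conjg u y \<in> C" using normzrD[of u C y] C u y(2) by blast
    qed
  qed
  show "\<And>x. x \<in> V \<Longrightarrow> x [^] p \<in> frattini p V" unfolding frattini_def by blast
  show "\<And>x y. x \<in> V \<Longrightarrow> y \<in> V \<Longrightarrow> conjg x y \<otimes> inv y \<in> frattini p V"
    unfolding frattini_def by blast
qed

text \<open>Elements of the Frattini subgroup are non-generators. If the finite \<open>Z\<close> is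
  proper, so is \<open>Z <#> W\<close> for a small open \<open>W\<close> normal in \<open>V\<close>;
  a maximal subgroup \<open>M\<close> over it is normal because normalisers grow, and of index p, so
  it contains \<open>frattini p V\<close>. Together with \<open>Z\<close> this would put all of
  \<open>V\<close> into \<open>M\<close>.\<close>

lemma frattini_supplement:
  assumes p: "prime p" and V: "subgroup V G" "openin T V" "compactin T V" "\<And>x. x \<in> V \<Longrightarrow> p_element p x"
    and Z: "subgroup Z G" "finite Z" "Z \<subseteq> V"
    and cov: "\<And>v. v \<in> V \<Longrightarrow> \<exists>z\<in>Z. inv v \<otimes> z \<in> frattini p V"
  shows "Z = V"
proof (rule ccontr)
  assume "Z \<noteq> V"
  then obtain x where x: "x \<in> V" "x \<notin> Z" using Z(3) by blast
  have Vc: "V \<subseteq> carrier G" by (rule sg_subset[OF V(1)])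
  have xc: "x \<in> carrier G" using x Vc by blast
  \<comment> \<open>A subgroup \<open>W\<close> that avoids these quotients keeps \<open>x\<close>
    outside \<open>Z <#> W\<close>.\<close>
  let ?F = "(\<lambda>z. inv z \<otimes> x) ` Z"
  have F: "finite ?F" "\<one> \<notin> ?F"
  proof -
    show "finite ?F" using Z(2) by simp
    show "\<one> \<notin> ?F"
    proof
      assume "\<one> \<in> ?F"
      then obtain z where z: "z \<in> Z" "\<one> = inv z \<otimes> x" by blast
      have "z \<in> carrier G" using sg_carrier[OF Z(1) z(1)] .
      then have "z \<otimes> (inv z \<otimes> x) = x" using xc by simp
      then show False using z(1) x(2) \<open>z \<in> carrier G\<close> unfolding z(2)[symmetric] by simp
    qed
  qed
  obtain W0 where W0: "subgroup W0 G" "openin T W0" "compactin T W0" "W0 \<subseteq> V" "W0 \<inter> ?F = {}"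
    by (rule compact_open_subgroup_avoiding[OF V(1,2) F], rule that)
  define W where "W = core V W0"
  have W: "subgroup W G" "openin T W"
    unfolding W_def by (rule subgroup_core[OF Vc W0(1)], rule openin_core[OF V(3) W0(1,2)])
  have WW0: "W \<subseteq> W0" unfolding W_def by (rule core_subset[OF sg_one[OF V(1)]])
  have NW: "V \<subseteq> normzr W" unfolding W_def by (rule subset_normzr_core[OF V(1)])
  define Q where "Q = Z <#> W"
  have sQ: "subgroup Q G" unfolding Q_def by (rule subgroup_set_mult[OF Z(1) W(1)]) (use Z(3) NW in blast)
  have sub: "Z \<subseteq> Q" "W \<subseteq> Q" unfolding Q_def by (rule subset_set_mult[OF Z(1) W(1)])+
  have QV: "Q \<subseteq> V"
    unfolding Q_def by (rule set_mult_subset[OF V(1)]) (use Z(3) WW0 W0(4) in blast)+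
  have "x \<notin> Q"
  proof
    assume "x \<in> Q"
    then obtain z w where zw: "z \<in> Z" "w \<in> W" "x = z \<otimes> w" unfolding Q_def set_mult_def by blast
    have "z \<in> carrier G" "w \<in> carrier G" using zw sg_carrier[OF Z(1)] sg_carrier[OF W(1)] by blast+
    then have "inv z \<otimes> x = w" using zw(3) by simp
    then show False using zw(1,2) WW0 W0(5) by blast
  qed
  then have "Q \<noteq> V" using x(1) by blast
  obtain M where M: "subgroup M G" "Q \<subseteq> M" "M \<subseteq> V" "M \<noteq> V"
    "\<And>M'. subgroup M' G \<Longrightarrow> M \<subseteq> M' \<Longrightarrow> M' \<subseteq> V \<Longrightarrow> M' \<noteq> M \<Longrightarrow> M' = V"
    by (rule maximal_overgroup[OF V(1,3) W sQ sub(2) QV \<open>Q \<noteq> V\<close>], rule that)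
  have WM: "W \<subseteq> M" using sub(2) M(2) by blast
  have oM: "openin T M" by (rule subgroup_over_open[OF W M(1) WM])
  obtain y where y: "y \<in> V - M" "y \<in> normzr M"
    using normalizer_grows[OF p V(1,3) _ W NW M(1) WM M(3,4)] V(4) by blast
  have "normzr M \<inter> V = V"
  proof (rule M(5))
    show "subgroup (normzr M \<inter> V) G" by (rule subgroup_Int2[OF subgroup_normzr V(1)])
    show "M \<subseteq> normzr M \<inter> V" using subgroup_subset_normzr[OF M(1)] M(3) by blast
    show "normzr M \<inter> V \<noteq> M" using y by blast
  qed blast
  then have NM: "V \<subseteq> normzr M" by blast
  \<comment> \<open>Minimality of k makes the power of \<open>y\<close> with exponent
    \<open>p ^ (k - 1)\<close> an element outside \<open>M\<close> whose p-th power is inside, as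
    \<open>normal_maximal_frattini\<close> asks.\<close>
  obtain k where k: "y [^] (p ^ k) \<in> M" "\<And>j. j < k \<Longrightarrow> y [^] (p ^ j) \<notin> M"
  proof -
    have "\<exists>k. y [^] (p ^ k) \<in> M" using V(4)[of y] y(1) M(1) oM unfolding p_element_def by blast
    then show thesis
      using that[of "LEAST k. y [^] (p ^ k) \<in> M"] LeastI_ex not_less_Least by metis
  qed
  have yc: "y \<in> carrier G" using y(1) Vc by blast
  have "k \<noteq> 0"
  proof
    assume "k = 0"
    then have "y \<in> M" using k(1) yc by simp
    then show False using y(1) by blast
  qed
  then obtain j where j: "k = Suc j" by (cases k) auto
  let ?z = "y [^] (p ^ j)"
  have z: "?z \<in> V" "?z \<notin> M" "?z [^] p \<in> M"
    using subgroup_pow_closed[OF V(1), of y] y(1) k(1) k(2)[of j] yc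
    unfolding j by (auto simp: nat_pow_pow mult.commute)
  have fr: "x \<in> V \<Longrightarrow> x [^] p \<in> M" "x \<in> V \<Longrightarrow> y \<in> V \<Longrightarrow> conjg x y \<otimes> inv y \<in> M" for x y
    by (rule normal_maximal_frattini[OF V(1) M(1,3) NM _ z], erule M(5), assumption+)+
  have "frattini p V \<subseteq> M"
    unfolding frattini_def
    by (rule Inter_lower, intro CollectI conjI ballI)
      (fact M(1,3) open_subgroup_closed[OF M(1) oM] NM | erule fr, assumption | erule fr)+
  moreover have "Z \<subseteq> M" using sub(1) M(2) by blast
  ultimately have "V \<subseteq> M"
  proof (intro subsetI)
    fix v assume FM: "frattini p V \<subseteq> M" "Z \<subseteq> M" and v: "v \<in> V"
    obtain z where z: "z \<in> Z" "inv v \<otimes> z \<in> frattini p V" using cov[OF v] by blast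
    have c: "v \<in> carrier G" "z \<in> carrier G" using v Vc z(1) sg_carrier[OF Z(1)] by blast+
    have zM: "z \<in> M" "inv v \<otimes> z \<in> M" using z FM by blast+
    have "z \<otimes> inv (inv v \<otimes> z) \<in> M" by (rule sg_mult[OF M(1) zM(1) sg_inv[OF M(1) zM(2)]])
    then show "v \<in> M" using c by (simp add: word_simps)
  qed
  then show False using M(3,4) by blast
qed

text \<open>Modulo \<open>frattini p V\<close> each new generator multiplies the number of cosets by
  at most p. The finitely many cosets reached are closed, so they cover the closure of the generated
  subgroup, which contains \<open>V\<close>; and a closed subgroup with finitely many cosets is
  open.\<close>

lemma frattini_open:
  assumes V: "subgroup V G" "openin T V" and p: "prime p"
    and S: "finite S" "S \<subseteq> V" "V \<subseteq> T closure_of (generate G S)"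
  shows "openin T (frattini p V)"
proof -
  let ?F = "frattini p V"
  have Vc: "V \<subseteq> carrier G" by (rule sg_subset[OF V(1)])
  note F = frattini_props[OF V(1) open_subgroup_closed[OF V], where p = p]
  have "\<exists>Q E. subgroup Q G \<and> ?F \<subseteq> Q \<and> Q \<subseteq> V \<and> S \<subseteq> Q \<and> finite E \<and> E \<subseteq> V \<and>
      (\<forall>q\<in>Q. \<exists>e\<in>E. inv e \<otimes> q \<in> ?F)"
    using S(1,2)
  proof induction
    case empty
    have "\<forall>q\<in>?F. \<exists>e\<in>{\<one>}. inv e \<otimes> q \<in> ?F" using sg_carrier[OF F(1)] by simp
    then show ?case using F(1,3) sg_one[OF V(1)] by (intro exI[of _ ?F] exI[of _ "{\<one>}"]) simp
  next
    case (insert s S)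
    then obtain Q E where Q: "subgroup Q G" "?F \<subseteq> Q" "Q \<subseteq> V" "S \<subseteq> Q"
      and E: "finite E" "E \<subseteq> V" "\<forall>q\<in>Q. \<exists>e\<in>E. inv e \<otimes> q \<in> ?F" by auto
    have s: "s \<in> V" "s \<in> carrier G" using insert.prems Vc by blast+
    \<comment> \<open>Commutators lie in \<open>?F\<close>, so every subgroup between
      \<open>?F\<close> and \<open>V\<close> is normal in \<open>V\<close>.\<close>
    have NQ: "V \<subseteq> normzr Q"
    proof (rule subgroup_subset_normzrI[OF V(1)])
      fix v q assume v: "v \<in> V" and q: "q \<in> Q" "q \<in> carrier G"
      have "(conjg v q \<otimes> inv q) \<otimes> q \<in> Q" using F(6)[OF v, of q] Q q(1) sg_mult[OF Q(1)] by blast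
      then show "conjg v q \<in> Q" using v Vc q(2) by (simp add: m_assoc subset_iff)
    qed
    let ?Z = "generate G {s}"
    have sZ: "subgroup ?Z G" by (rule generate_is_subgroup) (use s in blast)
    have ZV: "?Z \<subseteq> V" by (rule generate_subgroup_incl[OF _ V(1)]) (use s in blast)
    let ?Q = "?Z <#> Q"
    have sQ: "subgroup ?Q G" by (rule subgroup_set_mult[OF sZ Q(1)]) (use ZV NQ in blast)
    have sub: "?Z \<subseteq> ?Q" "Q \<subseteq> ?Q" by (rule subset_set_mult[OF sZ Q(1)])+
    have QV: "?Q \<subseteq> V"
    proof
      fix y assume "y \<in> ?Q"
      then obtain a b where "a \<in> ?Z" "b \<in> Q" "y = a \<otimes> b" unfolding set_mult_def by blast
      then show "y \<in> V" using sg_mult[OF V(1), of a b] ZV Q(3) by blast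
    qed
    have "s \<in> ?Z" by (rule generate.incl) simp
    then have SQ: "insert s S \<subseteq> ?Q" using sub Q(4) by blast
    let ?E = "(\<lambda>(i::nat, e). s [^] i \<otimes> e) ` ({..<p} \<times> E)"
    have fE: "finite ?E" using E(1) by simp
    have EV: "?E \<subseteq> V" using subgroup_pow_closed[OF V(1) s(1)] E(2) sg_mult[OF V(1)] by auto
    have "\<exists>e\<in>?E. inv e \<otimes> q \<in> ?F" if q: "q \<in> ?Q" for q
    proof -
      obtain a b where ab: "a \<in> ?Z" "b \<in> Q" "q = a \<otimes> b" using q unfolding set_mult_def by blast
      obtain k :: int where k: "a = s [^] k" using ab(1) generate_pow[OF s(2)] by blast
      obtain e where e: "e \<in> E" "inv e \<otimes> b \<in> ?F" using E(3) ab(2) by blast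
      have c: "b \<in> carrier G" "e \<in> carrier G" using ab(2) Q(3) e(1) E(2) Vc by blast+
      define i where "i = nat (k mod int p)"
      have p0: "int p > 0" using prime_gt_0_nat[OF p] by simp
      have i: "i < p" "int i = k mod int p"
        using p0 unfolding i_def by (auto simp: nat_less_iff)
      define f where "f = (s [^] p) [^] (k div int p)"
      have fF: "f \<in> ?F" unfolding f_def by (rule subgroup_int_pow_closed[OF F(1) F(5)[OF s(1)]])
      have fc: "f \<in> carrier G" using sg_carrier[OF F(1) fF] .
      have "a = s [^] (int i + int p * (k div int p))" unfolding k i(2) by simp
      also have "\<dots> = s [^] i \<otimes> f"
        unfolding f_def using s(2) by (simp add: int_pow_mult int_pow_pow flip: int_pow_int)
      finally have a: "a = s [^] i \<otimes> f" .
      have "inv e \<in> V" using sg_inv[OF V(1)] e(1) E(2) by blast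
      then have "conjg (inv e) f \<in> ?F" using normzrD[of "inv e" ?F f] F(4) fF fc by blast
      then have "conjg (inv e) f \<otimes> (inv e \<otimes> b) \<in> ?F" by (rule sg_mult[OF F(1) _ e(2)])
      moreover have "inv (s [^] i \<otimes> e) \<otimes> q = conjg (inv e) f \<otimes> (inv e \<otimes> b)"
        using c fc s(2) by (simp add: ab(3) a conjg_def word_simps)
      moreover have "s [^] i \<otimes> e \<in> ?E" using i(1) e(1) by force
      ultimately show ?thesis by metis
    qed
    then have rep: "\<forall>q\<in>?Q. \<exists>e\<in>?E. inv e \<otimes> q \<in> ?F" by (rule ballI)
    have "?F \<subseteq> ?Q" using sub(2) Q(2) by (rule order_trans[rotated])
    with sQ QV SQ fE EV rep show ?case
      by (intro exI[of _ ?Q] exI[of _ ?E] conjI)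
  qed
  then obtain Q E where Q: "subgroup Q G" "Q \<subseteq> V" "S \<subseteq> Q" and E: "finite E" "E \<subseteq> V"
    "\<forall>q\<in>Q. \<exists>e\<in>E. inv e \<otimes> q \<in> ?F" by blast
  let ?C = "\<lambda>e. {x \<in> carrier G. inv e \<otimes> x \<in> ?F}"
  have cl: "closedin T (?C e)" if "e \<in> E" for e
    using that E(2) Vc by (intro closedin_preimage continuous_translate(1) F(2)) blast
  have Qcov: "Q \<subseteq> \<Union>(?C ` E)" using E(3) sg_carrier[OF Q(1)] by blast
  have "closedin T (\<Union>(?C ` E))" using E(1) cl by (intro closedin_Union) auto
  moreover have "generate G S \<subseteq> Q" by (rule generate_subgroup_incl[OF Q(3,1)])
  ultimately have "T closure_of (generate G S) \<subseteq> \<Union>(?C ` E)"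
    using Qcov by (intro closure_of_minimal) blast+
  then have cov: "V \<subseteq> \<Union>(?C ` E)" using S(3) by blast
  \<comment> \<open>The cosets of the representatives outside \<open>?F\<close> make up the
    complement of \<open>?F\<close> in \<open>V\<close>, which is therefore closed.\<close>
  let ?E = "{e \<in> E. e \<notin> ?F}"
  have eq: "?F = V - \<Union>(?C ` ?E)"
  proof (intro subset_antisym subsetI)
    fix x assume x: "x \<in> ?F"
    have "x \<notin> ?C e" if e: "e \<in> ?E" for e
    proof
      assume "x \<in> ?C e"
      then have 1: "inv e \<otimes> x \<in> ?F" by blast
      have c: "e \<in> carrier G" "x \<in> carrier G" using e E(2) Vc sg_carrier[OF F(1) x] by blast+
      have "x \<otimes> inv (inv e \<otimes> x) \<in> ?F" by (rule sg_mult[OF F(1) x sg_inv[OF F(1) 1]])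
      then have "e \<in> ?F" using c by (simp add: word_simps)
      then show False using e by blast
    qed
    then show "x \<in> V - \<Union>(?C ` ?E)" using x F(3) by blast
  next
    fix x assume x: "x \<in> V - \<Union>(?C ` ?E)"
    then obtain e where e: "e \<in> E" "x \<in> ?C e" using cov by blast
    then have eF: "e \<in> ?F" using x by blast
    have "inv e \<otimes> x \<in> ?F" using e(2) by blast
    then have "e \<otimes> (inv e \<otimes> x) \<in> ?F" by (rule sg_mult[OF F(1) eF])
    moreover have "e \<in> carrier G" "x \<in> carrier G" using x Vc e(1) E(2) by blast+
    ultimately show "x \<in> ?F" by simp
  qed
  have "closedin T (\<Union>(?C ` ?E))" using E(1) cl by (intro closedin_Union) auto
  then show ?thesis by (subst eq) (rule openin_diff[OF V(2)])
qed

lemma not_topologically_finitely_generated: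
  assumes p: "prime p" and V: "subgroup V G" "openin T V" "compactin T V" "\<And>x. x \<in> V \<Longrightarrow> p_element p x"
    and inf: "infinite V" and \<Gamma>: "\<And>n. subgroup (\<Gamma> n) G" "\<And>n. discretein T (\<Gamma> n)"
    and H: "V \<subseteq> H"
    and meets: "\<And>A. openin T A \<Longrightarrow> H \<inter> A \<noteq> {} \<Longrightarrow> \<forall>\<^sub>F n in sequentially. \<Gamma> n \<inter> A \<noteq> {}"
  shows "\<not> topologically_finitely_generated (G\<lparr>carrier := V\<rparr>) (subtopology T V)"
proof
  assume "topologically_finitely_generated (G\<lparr>carrier := V\<rparr>) (subtopology T V)"
  then obtain S where S: "finite S" "S \<subseteq> V"
    "subtopology T V closure_of (generate (G\<lparr>carrier := V\<rparr>) S) = V"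
    unfolding topologically_finitely_generated_def by auto
  have "generate (G\<lparr>carrier := V\<rparr>) S = generate G S" by (rule generate_consistent[OF S(2) V(1)])
  then have "V = V \<inter> T closure_of (V \<inter> generate G S)"
    using S(3) by (simp add: closure_of_subtopology)
  then have "V \<subseteq> T closure_of (generate G S)"
    using closure_of_mono[of "V \<inter> generate G S" "generate G S" T] by blast
  then have oF: "openin T (frattini p V)" by (rule frattini_open[OF V(1,2) p S(1,2)])
  note F = frattini_props[OF V(1) open_subgroup_closed[OF V(1,2)], where p = p]
  have "\<forall>\<^sub>F n in sequentially. \<forall>v\<in>V. \<exists>\<gamma>\<in>\<Gamma> n. inv v \<otimes> \<gamma> \<in> frattini p V"
    by (rule eventually_approximates[OF meets V(3) H F(1) oF])
  then obtain n where n: "\<forall>v\<in>V. \<exists>\<gamma>\<in>\<Gamma> n. inv v \<otimes> \<gamma> \<in> frattini p V"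
    using eventually_happens'[OF sequentially_bot] by blast
  have fin: "finite (\<Gamma> n \<inter> V)" by (rule discrete_Int_compact_finite[OF \<Gamma> V(3)])
  have "\<Gamma> n \<inter> V = V"
  proof (rule frattini_supplement[OF p V(1-3) _ subgroup_Int2[OF \<Gamma>(1) V(1)] fin])
    show "p_element p x" if "x \<in> V" for x using V(4)[OF that] .
    show "\<exists>z\<in>\<Gamma> n \<inter> V. inv v \<otimes> z \<in> frattini p V" if v: "v \<in> V" for v
    proof -
      obtain z where z: "z \<in> \<Gamma> n" "inv v \<otimes> z \<in> frattini p V" using n v by blast
      have "inv v \<otimes> z \<in> V" using z(2) F(3) by blast
      then have "v \<otimes> (inv v \<otimes> z) \<in> V" by (rule sg_mult[OF V(1) v])
      then have "z \<in> V" using sg_carrier[OF V(1) v] sg_carrier[OF \<Gamma>(1) z(1)] by simp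
      then show ?thesis using z by blast
    qed
  qed blast
  then show False using fin inf by simp
qed

end

text \<open>The representatives are inverted because \<open>rcosets\<close> consists of right
  cosets, while the argument above writes elements as \<open>r \<otimes> h\<close>, that is, by left
  cosets.\<close>

lemma (in group) finite_rcosets_cover:
  assumes H: "subgroup H G" "finite (rcosets H)"
  obtains R where "finite R" "R \<subseteq> carrier G" "\<forall>g\<in>carrier G. \<exists>r\<in>R. \<exists>h\<in>H. g = r \<otimes> h"
proof -
  have Hc: "H \<subseteq> carrier G" by (rule sg_subset[OF H(1)])
  have "\<forall>X\<in>rcosets H. \<exists>a. a \<in> carrier G \<and> X = H #> a" unfolding RCOSETS_def by blast
  then obtain f where f: "\<And>X. X \<in> rcosets H \<Longrightarrow> f X \<in> carrier G \<and> X = H #> f X" by metis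
  define R where "R = (\<lambda>X. inv (f X)) ` (rcosets H)"
  have R: "finite R" "R \<subseteq> carrier G" using H(2) f unfolding R_def by auto
  have cov: "\<exists>r\<in>R. \<exists>h\<in>H. g = r \<otimes> h" if g: "g \<in> carrier G" for g
  proof -
    let ?X = "H #> inv g"
    have X: "?X \<in> rcosets H" using g unfolding RCOSETS_def by blast
    have "inv g \<in> ?X" using rcos_self[OF _ H(1)] g by simp
    then have "inv g \<in> H #> f ?X" using f[OF X] by simp
    then obtain h where h: "h \<in> H" "inv g = h \<otimes> f ?X" unfolding r_coset_def by blast
    have c: "h \<in> carrier G" "f ?X \<in> carrier G" using h(1) Hc f[OF X] by blast+
    have "g = inv (h \<otimes> f ?X)" using h(2) g by (metis inv_inv)
    then have "g = inv (f ?X) \<otimes> inv h" using c by (simp add: inv_mult_group)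
    moreover have "inv (f ?X) \<in> R" using X unfolding R_def by blast
    ultimately show ?thesis using sg_inv[OF H(1) h(1)] by blast
  qed
  show thesis using that[OF R] cov by blast
qed

theorem theorem6:
  fixes G :: "('a, 'b) monoid_scheme" and T :: "'a topology"
    and H :: "'a set" and \<Gamma> :: "nat \<Rightarrow> 'a set"
  assumes "tdlc_group G T"
    and "\<not> discretein T (carrier G)"
    and "compactly_generated G T"
    and "quasi_just_non_compact G T"
    and "subgroup H G" and "openin T H" and "finite (rcosets\<^bsub>G\<^esub> H)"
    and "\<And>n. subgroup (\<Gamma> n) G" and "\<And>n. discretein T (\<Gamma> n)"
    and "limitin (chabauty_topology G T) \<Gamma> H sequentially"
  shows "\<exists>p V. prime p \<and> subgroup V G \<and> compactin T V \<and> openin T V \<and>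
           pro_p_group p (G\<lparr>carrier := V\<rparr>) (subtopology T V) \<and>
           \<not> topologically_finitely_generated (G\<lparr>carrier := V\<rparr>) (subtopology T V)"
proof -
  have tg: "topological_group G T"
    using assms(1) unfolding tdlc_group_def locally_compact_group_def by blast
  interpret qjnc_group G T
  proof (rule qjnc_group.intro)
    show "tdlc G T"
      using assms(1) tg unfolding tdlc_group_def locally_compact_group_def tdlc_def tdlc_axioms_def by blast
    show "qjnc_group_axioms G T"
      using assms(2-4) unfolding quasi_just_non_compact_def qjnc_group_axioms_def by blast
  qed
  obtain R where R: "finite R" "R \<subseteq> carrier G"
    "\<forall>g\<in>carrier G. \<exists>r\<in>R. \<exists>h\<in>H. g = r \<otimes>\<^bsub>G\<^esub> h"
    by (rule finite_rcosets_cover[OF assms(5,7)], rule that)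
  have cov: "\<exists>r\<in>R. \<exists>h\<in>H. g = r \<otimes>\<^bsub>G\<^esub> h" if "g \<in> carrier G" for g
    using R(3) that by (rule bspec)
  note meets = chabauty_limit_eventually_meets[OF assms(10)]
  obtain p W where W: "prime p" "subgroup W G" "openin T W" "compactin T W" "W \<subseteq> H"
    "\<forall>x\<in>W. p_element p x"
    by (rule approximable_imp_open_p_subgroup[OF assms(5,6) R(1,2) cov assms(8,9) meets])
      (assumption | rule that)+
  have el: "p_element p x" if "x \<in> W" for x using W(6) that by blast
  have "pro_p_group p (G\<lparr>carrier := W\<rparr>) (subtopology T W)"
    by (rule pro_p_group_subgroup[OF W(1-4) el])
  moreover have "\<not> topologically_finitely_generated (G\<lparr>carrier := W\<rparr>) (subtopology T W)"
    by (rule not_topologically_finitely_generated[OF W(1-4) el open_subgroup_infinite[OF W(2,3)]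
          assms(8,9) W(5) meets])
  ultimately show ?thesis using W(1-4) by blast
qed

end
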